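(* Let $\mathfrak{C}$ be an $(\!(n,k)\!)$ code with isometric encoding channel $\mathcal E$, on qubits at the sites of a $D$-dimensional integer lattice $\Lambda$ with nearest-neighbour adjacency graph $\mathsf G_D$. Let $d\ge1$, $\delta\ge0$ and $\tilde d$ with $1\le\tilde d<d$. Suppose either $$k>C(\mathsf G_D,\tilde d)H_2\!\left(\tfrac12\varepsilon_{\mathsf G_D}(\mathfrak{C},d)+\tfrac{\delta}{2}\right)+C(\mathsf G_D,\tilde d)\log(2^{\tilde d}-1)\left(\tfrac12\varepsilon_{\mathsf G_D}(\mathfrak{C},d)+\tfrac{\delta}{2}\right),$$ or $$k>C(\mathsf G_D,\tilde d)H_2\!\left(2\max_{\mathcal N}\tilde\varepsilon(\mathcal N,\mathcal E)+\tfrac{\delta}{2}\right)+C(\mathsf G_D,\tilde d)\log(2^{\tilde d}-1)\left(2\max_{\mathcal N}\tilde\varepsilon(\mathcal N,\mathcal E)+\tfrac{\delta}{2}\right),$$ where the maximum is over replacement channels $\mathcal N$ acting on any $\mathsf G_D$-connected region of $d$ qubits, and the arguments of $H_2$ are less than $1/2$. Then every code state $|\psi\rangle\in\mathfrak{C}$ satisfies $$\mathscr{C}^\delta_{\mathsf G_D}(\psi)>\tfrac12 d^{1/D}\big(1-(\tilde d/d)^{1/D}\big).$$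
   Context: An $(\!(n,k)\!)$ code is a $2^k$-dimensional subspace $\mathfrak{C}\subseteq(\mathbb{C}^2)^{\otimes n}$; $\Gamma=\Pi/2^k$. $C(\mathsf G_D,\tilde d)$ is the minimum number of hypercubes of size $\tilde d$ (containing $\tilde d$ sites) needed to cover $\Lambda$. $\varepsilon_{\mathsf G_D}(\mathfrak{C},d)=\max\{\|\psi_S-\Gamma_S\|_1:|\psi\rangle\in\mathfrak{C}, S\text{ connected in }\mathsf G_D,|S|\le d\}$. A replacement channel on $S$ maps $\sigma\mapsto(\mathrm{Tr}_S\sigma)\otimes\gamma$ for fixed $\gamma$. $\tilde\varepsilon(\mathcal N,\mathcal E)=\min_{\mathcal R}P(\mathcal R\circ\mathcal N\circ\mathcal E,\mathrm{id}_L)$ with $P$ the channel purified distance $\sqrt{1-F^2}$, $F=\min_\rho f((\mathcal M_1\otimes\mathrm{id})(\rho),(\mathcal M_2\otimes\mathrm{id})(\rho))$, $f(\rho,\sigma)=\|\sqrt\rho\sqrt\sigma\|_1$. $\mathscr{C}^\delta_{\mathsf G_D}(\psi)$ is the minimum, over pure $\psi'$ with $\|\psi'-\psi\|_1\le\delta$, of the minimum depth of circuits of layers of disjoint 2-qubit gates on $\mathsf G_D$-adjacent pairs preparing $|\psi'\rangle$ from $|0\rangle^{\otimes n}$. Logs base 2; $H_2$ binary entropy. *)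

theory Defs
  imports Complex_Main
begin

section \<open>Qubit registers\<close>

text \<open>Qubits are labelled: physical qubits sit at lattice sites (integer lists of length D),
logical qubits are Log 0, ..., Log (k-1), and Ref labels supply reference systems.
A computational-basis configuration of a register S is a function label => bool that is
False outside S. Vectors and operators are complex functions of configurations, supported
on the configurations of the register.\<close>

datatype label = Site "int list" | Log nat | Ref nat

type_synonym cfg = "label \<Rightarrow> bool"
type_synonym vec = "cfg \<Rightarrow> complex"
type_synonym op = "cfg \<Rightarrow> cfg \<Rightarrow> complex"

definition cfgs :: "label set \<Rightarrow> cfg set" where
  "cfgs S = {c. \<forall>x. x \<notin> S \<longrightarrow> \<not> c x}"

definition restr :: "cfg \<Rightarrow> label set \<Rightarrow> cfg" where
  "restr c T = (\<lambda>x. x \<in> T \<and> c x)"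

definition join :: "cfg \<Rightarrow> cfg \<Rightarrow> cfg" where
  "join c e = (\<lambda>x. c x \<or> e x)"

definition vec_on :: "label set \<Rightarrow> vec \<Rightarrow> bool" where
  "vec_on S v \<longleftrightarrow> (\<forall>c. c \<notin> cfgs S \<longrightarrow> v c = 0)"

definition op_on :: "label set \<Rightarrow> op \<Rightarrow> bool" where
  "op_on S A \<longleftrightarrow> (\<forall>c c'. c \<notin> cfgs S \<or> c' \<notin> cfgs S \<longrightarrow> A c c' = 0)"

definition inner :: "label set \<Rightarrow> vec \<Rightarrow> vec \<Rightarrow> complex" where
  "inner S u v = (\<Sum>c\<in>cfgs S. cnj (u c) * v c)"

definition vnorm :: "label set \<Rightarrow> vec \<Rightarrow> real" where
  "vnorm S v = sqrt (Re (inner S v v))"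

definition app :: "label set \<Rightarrow> op \<Rightarrow> vec \<Rightarrow> vec" where
  "app S A v = (\<lambda>c. if c \<in> cfgs S then (\<Sum>e\<in>cfgs S. A c e * v e) else 0)"

definition mmult :: "label set \<Rightarrow> op \<Rightarrow> op \<Rightarrow> op" where
  "mmult S A B = (\<lambda>c c'. if c \<in> cfgs S \<and> c' \<in> cfgs S then (\<Sum>e\<in>cfgs S. A c e * B e c') else 0)"

definition adj :: "op \<Rightarrow> op" where
  "adj A = (\<lambda>c c'. cnj (A c' c))"

definition ident :: "label set \<Rightarrow> op" where
  "ident S = (\<lambda>c c'. if c \<in> cfgs S \<and> c' = c then 1 else 0)"

definition opdiff :: "op \<Rightarrow> op \<Rightarrow> op" where
  "opdiff A B = (\<lambda>c c'. A c c' - B c c')"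

definition tr :: "label set \<Rightarrow> op \<Rightarrow> complex" where
  "tr S A = (\<Sum>c\<in>cfgs S. A c c)"

definition psd :: "label set \<Rightarrow> op \<Rightarrow> bool" where
  "psd S A \<longleftrightarrow> op_on S A \<and>
     (\<forall>v. vec_on S v \<longrightarrow> Im (inner S v (app S A v)) = 0 \<and> Re (inner S v (app S A v)) \<ge> 0)"

definition density :: "label set \<Rightarrow> op \<Rightarrow> bool" where
  "density S \<rho> \<longleftrightarrow> psd S \<rho> \<and> tr S \<rho> = 1"

text \<open>The (unique) positive semidefinite square root.\<close>
definition msqrt :: "label set \<Rightarrow> op \<Rightarrow> op" where
  "msqrt S A = (THE B. psd S B \<and> mmult S B B = A)"

text \<open>Trace norm  ||A||_1 = Tr sqrt(A^* A).\<close>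
definition tnorm :: "label set \<Rightarrow> op \<Rightarrow> real" where
  "tnorm S A = Re (tr S (msqrt S (mmult S (adj A) A)))"

text \<open>Fidelity f(rho,sigma) = || sqrt rho sqrt sigma ||_1.\<close>
definition fid :: "label set \<Rightarrow> op \<Rightarrow> op \<Rightarrow> real" where
  "fid S \<rho> \<sigma> = tnorm S (mmult S (msqrt S \<rho>) (msqrt S \<sigma>))"

definition proj :: "vec \<Rightarrow> op" where
  "proj v = (\<lambda>c c'. v c * cnj (v c'))"

text \<open>Partial trace over T of an operator on S \<union> T (S, T disjoint); result lives on S.\<close>
definition ptrace :: "label set \<Rightarrow> label set \<Rightarrow> op \<Rightarrow> op" where
  "ptrace S T A = (\<lambda>c c'. if c \<in> cfgs S \<and> c' \<in> cfgs S
       then (\<Sum>t\<in>cfgs T. A (join c t) (join c' t)) else 0)"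

text \<open>Tensor product of an operator on S and one on T (S, T disjoint).\<close>
definition tensor :: "label set \<Rightarrow> label set \<Rightarrow> op \<Rightarrow> op \<Rightarrow> op" where
  "tensor S T A B = (\<lambda>c c'. if c \<in> cfgs (S \<union> T) \<and> c' \<in> cfgs (S \<union> T)
       then A (restr c S) (restr c' S) * B (restr c T) (restr c' T) else 0)"

section \<open>Channels\<close>

definition block :: "label set \<Rightarrow> op \<Rightarrow> cfg \<Rightarrow> cfg \<Rightarrow> op" where
  "block A X r r' = (\<lambda>a a'. if a \<in> cfgs A \<and> a' \<in> cfgs A then X (join a r) (join a' r') else 0)"

text \<open>(Phi \<otimes> id_R) for a map Phi from register A to register B, R a reference register.\<close>
definition ext :: "label set \<Rightarrow> label set \<Rightarrow> label set \<Rightarrow> (op \<Rightarrow> op) \<Rightarrow> op \<Rightarrow> op" where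
  "ext A B R \<Phi> X = (\<lambda>c c'. if c \<in> cfgs (B \<union> R) \<and> c' \<in> cfgs (B \<union> R)
       then \<Phi> (block A X (restr c R) (restr c' R)) (restr c B) (restr c' B) else 0)"

text \<open>Quantum channel (linear, CPTP) from register A to register B.\<close>
definition channel :: "label set \<Rightarrow> label set \<Rightarrow> (op \<Rightarrow> op) \<Rightarrow> bool" where
  "channel A B \<Phi> \<longleftrightarrow>
     (\<forall>X. op_on A X \<longrightarrow> op_on B (\<Phi> X)) \<and>
     (\<forall>X Y a. op_on A X \<longrightarrow> op_on A Y \<longrightarrow>
         \<Phi> (\<lambda>c c'. X c c' + a * Y c c') = (\<lambda>c c'. \<Phi> X c c' + a * \<Phi> Y c c')) \<and>
     (\<forall>X. op_on A X \<longrightarrow> tr B (\<Phi> X) = tr A X) \<and>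
     (\<forall>R X. finite R \<longrightarrow> R \<inter> (A \<union> B) = {} \<longrightarrow> psd (A \<union> R) X \<longrightarrow>
         psd (B \<union> R) (ext A B R \<Phi> X))"

text \<open>Channel fidelity F and purified distance P = sqrt(1 - F^2) for two channels on A.\<close>
definition chan_fid :: "label set \<Rightarrow> (op \<Rightarrow> op) \<Rightarrow> (op \<Rightarrow> op) \<Rightarrow> real" where
  "chan_fid A \<Phi>1 \<Phi>2 = Inf {fid (A \<union> R) (ext A A R \<Phi>1 \<rho>) (ext A A R \<Phi>2 \<rho>) | R \<rho>.
       finite R \<and> R \<inter> A = {} \<and> density (A \<union> R) \<rho>}"

definition pdist :: "label set \<Rightarrow> (op \<Rightarrow> op) \<Rightarrow> (op \<Rightarrow> op) \<Rightarrow> real" where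
  "pdist A \<Phi>1 \<Phi>2 = sqrt (1 - (chan_fid A \<Phi>1 \<Phi>2)\<^sup>2)"

text \<open>Replacement channel on S inside register P: sigma \<mapsto> Tr_S sigma \<otimes> gamma.\<close>
definition replacement :: "label set \<Rightarrow> label set \<Rightarrow> op \<Rightarrow> op \<Rightarrow> op" where
  "replacement P S \<gamma> = (\<lambda>\<sigma>. tensor (P - S) S (ptrace (P - S) S \<sigma>) \<gamma>)"

definition is_replacement :: "label set \<Rightarrow> label set \<Rightarrow> (op \<Rightarrow> op) \<Rightarrow> bool" where
  "is_replacement P S N \<longleftrightarrow> (\<exists>\<gamma>. density S \<gamma> \<and> N = replacement P S \<gamma>)"

section \<open>Lattice\<close>

text \<open>Lambda: a finite box in Z^D with side lengths Ls (D = length Ls).\<close>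
definition box :: "nat list \<Rightarrow> int list set" where
  "box Ls = {x. length x = length Ls \<and> (\<forall>i<length Ls. 0 \<le> x ! i \<and> x ! i < int (Ls ! i))}"

text \<open>Nearest-neighbour adjacency of G_D.\<close>
definition ladj :: "int list \<Rightarrow> int list \<Rightarrow> bool" where
  "ladj x y \<longleftrightarrow> length x = length y \<and> (\<Sum>i<length x. \<bar>x ! i - y ! i\<bar>) = 1"

definition lconnected :: "int list set \<Rightarrow> bool" where
  "lconnected S \<longleftrightarrow> S \<noteq> {} \<and>
     (\<forall>x\<in>S. \<forall>y\<in>S. (x, y) \<in> {(a, b). a \<in> S \<and> b \<in> S \<and> ladj a b}\<^sup>*)"

text \<open>Hypercube with corner a and side length s (s^D sites).\<close>
definition cube :: "nat \<Rightarrow> int list \<Rightarrow> nat \<Rightarrow> int list set" where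
  "cube D a s = {x. length x = D \<and> (\<forall>i<D. a ! i \<le> x ! i \<and> x ! i < a ! i + int s)}"

text \<open>C(G_D, dt): minimum number of hypercubes with dt sites covering Lambda.\<close>
definition cover_num :: "nat list \<Rightarrow> nat \<Rightarrow> nat" where
  "cover_num Ls dt = Inf {m. \<exists>cs s. s ^ length Ls = dt \<and> length cs = m \<and>
      (\<forall>a\<in>set cs. length a = length Ls) \<and> box Ls \<subseteq> (\<Union>a\<in>set cs. cube (length Ls) a s)}"

section \<open>Codes\<close>

definition phys :: "nat list \<Rightarrow> label set" where
  "phys Ls = Site ` box Ls"

definition logi :: "nat \<Rightarrow> label set" where
  "logi k = Log ` {..<k}"

text \<open>V: an isometry from the k logical qubits into the physical qubits (V p l).\<close>
definition isometry :: "label set \<Rightarrow> label set \<Rightarrow> op \<Rightarrow> bool" where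
  "isometry L P V \<longleftrightarrow> (\<forall>p l. p \<notin> cfgs P \<or> l \<notin> cfgs L \<longrightarrow> V p l = 0) \<and>
     (\<forall>l\<in>cfgs L. \<forall>l'\<in>cfgs L. (\<Sum>p\<in>cfgs P. cnj (V p l) * V p l') = (if l = l' then 1 else 0))"

text \<open>Isometric encoding channel E(rho) = V rho V^*.\<close>
definition encode :: "label set \<Rightarrow> op \<Rightarrow> op \<Rightarrow> op" where
  "encode L V \<rho> = (\<lambda>p p'. \<Sum>l\<in>cfgs L. \<Sum>l'\<in>cfgs L. V p l * \<rho> l l' * cnj (V p' l'))"

text \<open>Normalised code states |psi> in the code space C = range V.\<close>
definition code_state :: "nat list \<Rightarrow> nat \<Rightarrow> op \<Rightarrow> vec \<Rightarrow> bool" where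
  "code_state Ls k V \<psi> \<longleftrightarrow> (\<exists>\<phi>. vec_on (logi k) \<phi> \<and>
       \<psi> = (\<lambda>p. \<Sum>l\<in>cfgs (logi k). V p l * \<phi> l)) \<and> vnorm (phys Ls) \<psi> = 1"

text \<open>Gamma = Pi / 2^k, Pi = V V^* the code projector.\<close>
definition Gamma :: "nat list \<Rightarrow> nat \<Rightarrow> op \<Rightarrow> op" where
  "Gamma Ls k V = (\<lambda>p p'. (\<Sum>l\<in>cfgs (logi k). V p l * cnj (V p' l)) / 2 ^ k)"

text \<open>Reduced state on a set S of sites.\<close>
definition reduced :: "nat list \<Rightarrow> int list set \<Rightarrow> op \<Rightarrow> op" where
  "reduced Ls S \<rho> = ptrace (Site ` S) (Site ` (box Ls - S)) \<rho>"

definition eps_code :: "nat list \<Rightarrow> nat \<Rightarrow> op \<Rightarrow> nat \<Rightarrow> real" where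
  "eps_code Ls k V d = Sup {tnorm (Site ` S) (opdiff (reduced Ls S (proj \<psi>)) (reduced Ls S (Gamma Ls k V))) | \<psi> S.
       code_state Ls k V \<psi> \<and> S \<subseteq> box Ls \<and> lconnected S \<and> card S \<le> d}"

text \<open>eps~(N, E) = min over recovery channels R of P(R o N o E, id_L).\<close>
definition eps_tilde :: "nat list \<Rightarrow> nat \<Rightarrow> op \<Rightarrow> (op \<Rightarrow> op) \<Rightarrow> real" where
  "eps_tilde Ls k V N = Inf {pdist (logi k) (\<R> \<circ> N \<circ> encode (logi k) V) id | \<R>.
       channel (phys Ls) (logi k) \<R>}"

text \<open>max over replacement channels on G_D-connected regions of d qubits.\<close>
definition max_eps_tilde :: "nat list \<Rightarrow> nat \<Rightarrow> op \<Rightarrow> nat \<Rightarrow> real" where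
  "max_eps_tilde Ls k V d = Sup {eps_tilde Ls k V N | N S.
       S \<subseteq> box Ls \<and> lconnected S \<and> card S = d \<and> is_replacement (phys Ls) (Site ` S) N}"

definition H2 :: "real \<Rightarrow> real" where
  "H2 p = - p * log 2 p - (1 - p) * log 2 (1 - p)"

section \<open>Circuits\<close>

text \<open>A gate: two sites and a unitary on those two qubits.\<close>
type_synonym gate = "int list \<times> int list \<times> op"

definition unitary :: "label set \<Rightarrow> op \<Rightarrow> bool" where
  "unitary S U \<longleftrightarrow> op_on S U \<and> mmult S (adj U) U = ident S"

definition gate_sites :: "gate \<Rightarrow> int list set" where
  "gate_sites g = {fst g, fst (snd g)}"

definition valid_gate :: "nat list \<Rightarrow> gate \<Rightarrow> bool" where
  "valid_gate Ls g \<longleftrightarrow> fst g \<in> box Ls \<and> fst (snd g) \<in> box Ls \<and> ladj (fst g) (fst (snd g)) \<and>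
     unitary (Site ` gate_sites g) (snd (snd g))"

definition valid_layer :: "nat list \<Rightarrow> gate list \<Rightarrow> bool" where
  "valid_layer Ls gs \<longleftrightarrow> (\<forall>g\<in>set gs. valid_gate Ls g) \<and>
     (\<forall>i j. i < j \<and> j < length gs \<longrightarrow> gate_sites (gs ! i) \<inter> gate_sites (gs ! j) = {})"

text \<open>The gate acting on the register P (identity on the other qubits).\<close>
definition gate_op :: "label set \<Rightarrow> gate \<Rightarrow> op" where
  "gate_op P g = (let Q = Site ` gate_sites g in
     (\<lambda>c c'. if c \<in> cfgs P \<and> c' \<in> cfgs P then
        snd (snd g) (restr c Q) (restr c' Q) * (if restr c (P - Q) = restr c' (P - Q) then 1 else 0)
      else 0))"

definition layer_op :: "label set \<Rightarrow> gate list \<Rightarrow> op" where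
  "layer_op P gs = foldr (\<lambda>g M. mmult P (gate_op P g) M) gs (ident P)"

definition zero_state :: vec where
  "zero_state = (\<lambda>c. if c = (\<lambda>_. False) then 1 else 0)"

definition run_circuit :: "label set \<Rightarrow> gate list list \<Rightarrow> vec" where
  "run_circuit P cs = fold (\<lambda>gs w. app P (layer_op P gs) w) cs zero_state"

text \<open>delta-approximate circuit complexity: minimal depth of a geometrically local circuit
preparing a pure state psi' (from |0...0>) with ||psi' - psi||_1 \<le> delta.\<close>
definition circ_complexity :: "nat list \<Rightarrow> real \<Rightarrow> vec \<Rightarrow> nat" where
  "circ_complexity Ls \<delta> \<psi> = Inf {length cs | cs. (\<forall>gs\<in>set cs. valid_layer Ls gs) \<and>
       tnorm (phys Ls) (opdiff (proj (run_circuit (phys Ls) cs)) (proj \<psi>)) \<le> \<delta>}"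

end

theory Submission
  imports Defs "HOL-Computational_Algebra.Fundamental_Theorem_Algebra"
begin

text \<open>
  Suppose a circuit \<open>U\<close> of depth \<open>t\<close> prepares a state close to \<open>\<psi>\<close> and \<open>(s + 2t)^D \<le> d\<close>, where
  \<open>s^D = dt\<close>. Partition the lattice into cells contained in \<open>C\<close> cubes of side \<open>s\<close>. For a cell \<open>B\<close>
  let \<open>W = U R U*\<close>, where the reflection \<open>R\<close> has the sign \<open>+1\<close> exactly when all qubits of \<open>B\<close> are zero.
  \<open>W\<close> lives in the light cone of \<open>B\<close>, a connected region of at most \<open>d\<close> sites, and it fixes
  \<open>U|0>\<close>. Hence \<open>W\<close> has nearly the expectation \<open>1\<close> in the maximally mixed code state \<open>\<Gamma>\<close>: this
  is trace-norm duality for the first hypothesis. For the second, an erasure of the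
  region absorbs \<open>W\<close>, so recovery sends \<open>W v\<close> and \<open>v\<close> to the same logical state, which forces
  \<open>W v\<close> to be nearly orthogonal to every code state orthogonal to \<open>v\<close>.

  Now measure \<open>U* \<Gamma> U\<close> in the computational basis. No outcome has probability above \<open>2^-k\<close>, so
  the entropy is at least \<open>k\<close>. But every cell is nonzero with probability at most \<open>p\<close>, and
  comparing with a product distribution (Gibbs) bounds the entropy by
  \<open>C (H2 p + p log (2^dt - 1))\<close>.

  The complexity is an infimum of natural numbers, so that one also needs that some circuit prepares
  \<open>\<psi>\<close> exactly. Group commutators turn controlled rotations into multiply controlled ones, and these
  clear the amplitudes of \<open>\<psi>\<close> one by one.
\<close>

section \<open>Linear algebra over a register\<close>

text \<open>Constants: a reflection takes the values 1 and -1, so its expectation is 1 minus twice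
  the probability of a nonzero cell, and every expectation gap counts half. The prepared state
  contributes \<open>\<delta> / 2\<close>, trace-norm duality contributes
  \<open>eps_code / 2\<close>. In the second case a recovery within purified distance e bounds
  matrix elements between orthogonal code states by 2 e; a difference of diagonal elements is a sum
  of two such elements in a rotated basis, hence 4 e, halved to 2 e. The comparison is with the
  maximally mixed code state because its flat spectrum is what brings \<open>k\<close> into the
  entropy. Obstacles: \<open>msqrt\<close> is a definite description, so trace norm and fidelity
  yield nothing until square roots are known to exist uniquely; this rests on the spectral theorem.
  A lattice with a single site has no gates, so exact preparation is available only from two sites
  on, and each alternative of the hypothesis has to be shown to exclude the one-site case. Suprema
  and infima of reals need bounded, nonempty sets: a crude trace-norm bound and a trivial recovery
  channel supply them.\<close>

lemma cfgs_eq_image: "cfgs S = (\<lambda>A x. x \<in> A) ` Pow S"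
proof
  show "cfgs S \<subseteq> (\<lambda>A x. x \<in> A) ` Pow S"
  proof
    fix c assume "c \<in> cfgs S"
    then have "c = (\<lambda>x. x \<in> {x. c x})" "{x. c x} \<in> Pow S"
      by (auto simp: cfgs_def)
    then show "c \<in> (\<lambda>A x. x \<in> A) ` Pow S" by blast
  qed
qed (auto simp: cfgs_def)

lemma finite_cfgs [simp]: "finite S \<Longrightarrow> finite (cfgs S)"
  by (simp add: cfgs_eq_image)

lemma card_cfgs:
  assumes "finite S"
  shows "card (cfgs S) = 2 ^ card S"
proof -
  have "inj_on (\<lambda>A x. x \<in> A) (Pow S)"
    by (auto simp: inj_on_def fun_eq_iff)
  then show ?thesis
    using assms by (simp add: cfgs_eq_image card_image card_Pow)
qed

lemma cfgs_mono: "S \<subseteq> T \<Longrightarrow> cfgs S \<subseteq> cfgs T"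
  by (auto simp: cfgs_def)

lemma zero_in_cfgs [simp]: "(\<lambda>_. False) \<in> cfgs S"
  by (simp add: cfgs_def)

lemma restr_in_cfgs [simp]: "restr c S \<in> cfgs S"
  by (simp add: cfgs_def restr_def)

lemma vec_on_eqI:
  assumes "vec_on S u" "vec_on S v" "\<And>c. c \<in> cfgs S \<Longrightarrow> u c = v c"
  shows "u = v"
  using assms unfolding vec_on_def by (metis ext)

lemma op_on_eqI:
  assumes "op_on S A" "op_on S B" "\<And>c c'. c \<in> cfgs S \<Longrightarrow> c' \<in> cfgs S \<Longrightarrow> A c c' = B c c'"
  shows "A = B"
  using assms unfolding op_on_def by (metis ext)

lemma vec_on_app [simp]: "vec_on S (app S A v)"
  by (simp add: vec_on_def app_def)

lemma op_on_mmult [simp]: "op_on S (mmult S A B)"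
  by (auto simp: op_on_def mmult_def)

lemma op_on_ident [simp]: "op_on S (ident S)"
  by (auto simp: op_on_def ident_def)

lemma op_on_adj [simp]: "op_on S (adj A) \<longleftrightarrow> op_on S A"
  by (auto simp: op_on_def adj_def)

lemma op_on_proj: "vec_on S v \<Longrightarrow> op_on S (proj v)"
  by (auto simp: op_on_def vec_on_def proj_def)

lemma vec_on_lincomb:
  assumes "vec_on S u" "vec_on S v"
  shows "vec_on S (\<lambda>c. a * u c + b * v c)"
  using assms by (simp add: vec_on_def)

lemma adj_adj [simp]: "adj (adj A) = A"
  by (simp add: adj_def)

lemma inner_add_right: "inner S u (\<lambda>c. v c + w c) = inner S u v + inner S u w"
  by (simp add: inner_def ring_distribs sum.distrib)

lemma inner_diff_right: "inner S u (\<lambda>c. v c - w c) = inner S u v - inner S u w"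
  by (simp add: inner_def ring_distribs sum_subtractf)

lemma inner_scale_right: "inner S u (\<lambda>c. a * v c) = a * inner S u v"
  by (simp add: inner_def sum_distrib_left mult_ac)

lemma inner_sum_right:
  "inner S u (\<lambda>c. \<Sum>j\<in>J. f j c) = (\<Sum>j\<in>J. inner S u (f j))"
  unfolding inner_def by (simp add: sum_distrib_left, rule sum.swap)

lemma cnj_inner: "cnj (inner S u v) = inner S v u"
  by (simp add: inner_def mult.commute)

lemma inner_add_left: "inner S (\<lambda>c. v c + w c) u = inner S v u + inner S w u"
  by (simp add: inner_def ring_distribs sum.distrib)

lemma inner_diff_left: "inner S (\<lambda>c. v c - w c) u = inner S v u - inner S w u"
  by (simp add: inner_def ring_distribs sum_subtractf)

lemma inner_scale_left: "inner S (\<lambda>c. a * v c) u = cnj a * inner S v u"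
  by (simp add: inner_def sum_distrib_left mult_ac)

lemma inner_self: "inner S v v = of_real (\<Sum>c\<in>cfgs S. (cmod (v c))\<^sup>2)"
  unfolding inner_def of_real_sum
  by (rule sum.cong) (simp_all add: complex_norm_square[symmetric] mult.commute del: of_real_power)

lemma Re_inner_self: "Re (inner S v v) = (\<Sum>c\<in>cfgs S. (cmod (v c))\<^sup>2)"
  by (simp add: inner_self del: of_real_sum)

lemma inner_self_nonneg [simp]: "0 \<le> Re (inner S v v)"
  by (simp add: Re_inner_self sum_nonneg)

lemma inner_self_eq_0:
  assumes "finite S" "vec_on S v" "Re (inner S v v) = 0"
  shows "v = (\<lambda>_. 0)"
proof (rule vec_on_eqI[OF assms(2)])
  show "vec_on S (\<lambda>_. 0)" by (simp add: vec_on_def)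
  fix c assume "c \<in> cfgs S"
  then have "(cmod (v c))\<^sup>2 = 0"
    using assms sum_nonneg_eq_0_iff[of "cfgs S" "\<lambda>c. (cmod (v c))\<^sup>2"]
    by (simp add: Re_inner_self)
  then show "v c = 0" by simp
qed

lemma vnorm_eq_1_iff: "vnorm S v = 1 \<longleftrightarrow> inner S v v = 1"
  by (simp add: vnorm_def inner_self del: of_real_sum)

lemma Cauchy_Schwarz_inner:
  assumes "finite S"
  shows "(cmod (inner S u v))\<^sup>2 \<le> Re (inner S u u) * Re (inner S v v)"
proof (cases "Re (inner S u u) = 0")
  case True
  then have "\<forall>c\<in>cfgs S. u c = 0"
    using assms sum_nonneg_eq_0_iff[of "cfgs S" "\<lambda>c. (cmod (u c))\<^sup>2"]
    by (simp add: Re_inner_self)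
  then have "inner S u v = 0" by (simp add: inner_def)
  then show ?thesis by (simp add: True)
next
  case False
  define a where "a = Re (inner S u u)"
  define z where "z = inner S u v"
  have a: "a > 0" using False inner_self_nonneg[of S u] unfolding a_def by linarith
  have iu: "inner S u u = of_real a" by (simp add: a_def inner_self del: of_real_sum)
  have iz: "inner S v u = cnj z" by (simp add: z_def cnj_inner)
  define w where "w = (\<lambda>c. v c - (z / of_real a) * u c)"
  have "inner S w w = inner S v v - z / of_real a * cnj z - cnj z / of_real a * (z - z / of_real a * of_real a)"
    by (simp only: w_def inner_diff_left inner_diff_right inner_scale_left inner_scale_right iu iz
        z_def[symmetric]) (simp add: right_diff_distrib)
  also have "\<dots> = inner S v v - of_real ((cmod z)\<^sup>2 / a)"
    using a complex_norm_square[of z] by simp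
  finally have "Re (inner S w w) = Re (inner S v v) - (cmod z)\<^sup>2 / a" by simp
  then have "(cmod z)\<^sup>2 / a \<le> Re (inner S v v)" using inner_self_nonneg[of S w] by linarith
  then show ?thesis using a by (simp add: divide_le_eq mult.commute a_def[symmetric] z_def)
qed

lemma app_sum:
  "app S A (\<lambda>c. \<Sum>j\<in>J. f j c) = (\<lambda>c. \<Sum>j\<in>J. app S A (f j) c)"
  unfolding app_def by (rule ext) (simp add: sum_distrib_left sum.swap[of _ "cfgs S"])

lemma app_scale: "app S A (\<lambda>c. a * v c) = (\<lambda>c. a * app S A v c)"
  unfolding app_def by (rule ext) (simp add: sum_distrib_left mult_ac)

lemma app_add: "app S A (\<lambda>c. u c + v c) = (\<lambda>c. app S A u c + app S A v c)"
  unfolding app_def by (rule ext) (simp add: ring_distribs sum.distrib)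

lemma app_mmult: "app S (mmult S A B) v = app S A (app S B v)"
proof (rule ext)
  fix c
  show "app S (mmult S A B) v c = app S A (app S B v) c"
  proof (cases "c \<in> cfgs S")
    case True
    then have "app S (mmult S A B) v c = (\<Sum>e\<in>cfgs S. \<Sum>x\<in>cfgs S. A c x * (B x e * v e))"
      by (simp add: app_def mmult_def sum_distrib_right mult.assoc)
    also have "\<dots> = (\<Sum>x\<in>cfgs S. \<Sum>e\<in>cfgs S. A c x * (B x e * v e))" by (rule sum.swap)
    finally show ?thesis using True by (simp add: app_def sum_distrib_left)
  qed (simp add: app_def)
qed

lemma app_ident:
  assumes "finite S" "vec_on S v"
  shows "app S (ident S) v = v"
proof (rule vec_on_eqI[OF _ assms(2)])
  fix c assume c: "c \<in> cfgs S"
  have "(\<Sum>e\<in>cfgs S. ident S c e * v e) = (\<Sum>e\<in>cfgs S. if e = c then v c else 0)"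
    using c by (intro sum.cong) (auto simp: ident_def)
  then show "app S (ident S) v c = v c"
    using c assms by (simp add: app_def)
qed simp

lemma mmult_assoc: "mmult S (mmult S A B) C = mmult S A (mmult S B C)"
proof (intro ext)
  fix c c'
  show "mmult S (mmult S A B) C c c' = mmult S A (mmult S B C) c c'"
  proof (cases "c \<in> cfgs S \<and> c' \<in> cfgs S")
    case True
    then have "mmult S (mmult S A B) C c c' = (\<Sum>e\<in>cfgs S. \<Sum>x\<in>cfgs S. A c x * (B x e * C e c'))"
      by (simp add: mmult_def sum_distrib_right mult.assoc)
    also have "\<dots> = (\<Sum>x\<in>cfgs S. \<Sum>e\<in>cfgs S. A c x * (B x e * C e c'))" by (rule sum.swap)
    finally show ?thesis using True by (simp add: mmult_def sum_distrib_left)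
  qed (auto simp: mmult_def)
qed

lemma mmult_ident_left:
  assumes "finite S" "op_on S A"
  shows "mmult S (ident S) A = A"
proof (rule op_on_eqI[OF _ assms(2)])
  fix c c' assume c: "c \<in> cfgs S" "c' \<in> cfgs S"
  have "(\<Sum>e\<in>cfgs S. ident S c e * A e c') = (\<Sum>e\<in>cfgs S. if e = c then A c c' else 0)"
    using c by (intro sum.cong) (auto simp: ident_def)
  then show "mmult S (ident S) A c c' = A c c'"
    using c assms by (simp add: mmult_def)
qed simp

lemma adj_mmult: "adj (mmult S A B) = mmult S (adj B) (adj A)"
  by (intro ext) (auto simp: adj_def mmult_def mult.commute)

lemma adj_ident [simp]: "adj (ident S) = ident S"
  by (intro ext) (auto simp: adj_def ident_def)

lemma mmult_ident_right:
  assumes "finite S" "op_on S A"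
  shows "mmult S A (ident S) = A"
proof -
  have "adj (mmult S A (ident S)) = adj A"
    using assms by (simp add: adj_mmult mmult_ident_left)
  then show ?thesis by (metis adj_adj)
qed

lemma inner_app_adj: "inner S u (app S A v) = inner S (app S (adj A) u) v"
proof -
  have "inner S u (app S A v) = (\<Sum>c\<in>cfgs S. \<Sum>e\<in>cfgs S. cnj (u c) * (A c e * v e))"
    by (simp add: inner_def app_def sum_distrib_left)
  also have "\<dots> = (\<Sum>e\<in>cfgs S. \<Sum>c\<in>cfgs S. cnj (u c) * (A c e * v e))"
    by (rule sum.swap)
  also have "\<dots> = inner S (app S (adj A) u) v"
    by (simp add: inner_def app_def adj_def sum_distrib_right sum_distrib_left mult_ac)
  finally show ?thesis .
qed

lemma app_proj:
  assumes "vec_on S u"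
  shows "app S (proj u) v = (\<lambda>c. inner S u v * u c)"
proof (rule ext)
  fix c
  show "app S (proj u) v c = inner S u v * u c"
    using assms
    by (cases "c \<in> cfgs S")
      (auto simp: app_def proj_def inner_def vec_on_def sum_distrib_left sum_distrib_right mult_ac)
qed

lemma tr_mmult_proj:
  assumes "vec_on S v"
  shows "tr S (mmult S A (proj v)) = inner S v (app S A v)"
  by (simp add: tr_def mmult_def proj_def inner_def app_def sum_distrib_left mult_ac)

subsection \<open>Orthonormal families and the spectral theorem\<close>

definition orthonormal :: "label set \<Rightarrow> nat \<Rightarrow> (nat \<Rightarrow> vec) \<Rightarrow> bool" where
  "orthonormal S r e \<longleftrightarrow> (\<forall>i<r. vec_on S (e i)) \<and>
     (\<forall>i<r. \<forall>j<r. inner S (e i) (e j) = (if i = j then 1 else 0))"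

text \<open>For an orthonormal family this is the standard basis vector at \<open>c\<close> minus
  its orthogonal projection onto the span of the family.\<close>

definition unit_residual :: "nat \<Rightarrow> (nat \<Rightarrow> vec) \<Rightarrow> cfg \<Rightarrow> vec" where
  "unit_residual r e c = (\<lambda>x. (if x = c then 1 else 0) - (\<Sum>i<r. cnj (e i c) * e i x))"

lemma inner_unit_vec:
  assumes "finite S" "c \<in> cfgs S"
  shows "inner S u (\<lambda>x. if x = c then 1 else 0) = cnj (u c)"
proof -
  have "inner S u (\<lambda>x. if x = c then 1 else 0) = (\<Sum>x\<in>cfgs S. if x = c then cnj (u c) else 0)"
    unfolding inner_def by (intro sum.cong) auto
  then show ?thesis using assms by simp
qed

lemma vec_on_unit_residual:
  assumes "orthonormal S r e" "c \<in> cfgs S"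
  shows "vec_on S (unit_residual r e c)"
  using assms by (auto simp: orthonormal_def vec_on_def unit_residual_def)

lemma inner_unit_residual:
  assumes "finite S" "orthonormal S r e" "c \<in> cfgs S" "j < r"
  shows "inner S (e j) (unit_residual r e c) = 0"
proof -
  have "inner S (e j) (unit_residual r e c)
      = cnj (e j c) - (\<Sum>i<r. cnj (e i c) * inner S (e j) (e i))"
    unfolding unit_residual_def
    by (simp add: inner_diff_right inner_sum_right inner_scale_right inner_unit_vec assms)
  also have "(\<Sum>i<r. cnj (e i c) * inner S (e j) (e i)) = (\<Sum>i<r. if i = j then cnj (e j c) else 0)"
    using assms by (intro sum.cong) (auto simp: orthonormal_def)
  finally show ?thesis using assms by simp
qed

text \<open>The subtracted part is orthogonal to the residual, so pairing the residual with itself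
  is pairing it with the basis vector: the squared norm is the entry at \<open>c\<close>.\<close>

lemma inner_unit_residual_self:
  assumes "finite S" "orthonormal S r e" "c \<in> cfgs S"
  shows "inner S (unit_residual r e c) (unit_residual r e c)
       = of_real (1 - (\<Sum>i<r. (cmod (e i c))\<^sup>2))"
proof -
  let ?v = "unit_residual r e c"
  have z: "inner S ?v (e i) = 0" if "i < r" for i
    using inner_unit_residual[OF assms that] cnj_inner[of S "e i" ?v] by simp
  have "inner S ?v ?v = inner S ?v (\<lambda>x. (if x = c then 1 else 0) - (\<Sum>i<r. cnj (e i c) * e i x))"
    by (simp add: unit_residual_def)
  also have "\<dots> = cnj (?v c) - (\<Sum>i<r. cnj (e i c) * inner S ?v (e i))"
    by (simp add: inner_diff_right inner_sum_right inner_scale_right inner_unit_vec assms)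
  also have "\<dots> = cnj (?v c)" using z by simp
  also have "\<dots> = of_real (1 - (\<Sum>i<r. (cmod (e i c))\<^sup>2))"
    by (simp add: unit_residual_def complex_norm_square mult.commute del: of_real_power)
  finally show ?thesis .
qed

lemma sum_orthonormal_weights:
  assumes "orthonormal S r e"
  shows "(\<Sum>c\<in>cfgs S. \<Sum>i<r. (cmod (e i c))\<^sup>2) = real r"
proof -
  have "(\<Sum>c\<in>cfgs S. \<Sum>i<r. (cmod (e i c))\<^sup>2) = (\<Sum>i<r. Re (inner S (e i) (e i)))"
    unfolding Re_inner_self by (rule sum.swap)
  also have "\<dots> = real r" using assms by (simp add: orthonormal_def)
  finally show ?thesis .
qed

text \<open>The squared norms of the residuals of the standard basis vectors add up to
  the codimension.\<close>

lemma orthonormal_complement_nontrivial: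
  assumes S: "finite S" and e: "orthonormal S r e" and r: "r < card (cfgs S)"
  obtains v where "vec_on S v" "inner S v v = 1" "\<And>j. j < r \<Longrightarrow> inner S (e j) v = 0"
proof -
  have "(\<Sum>c\<in>cfgs S. \<Sum>i<r. (cmod (e i c))\<^sup>2) < (\<Sum>c\<in>cfgs S. 1)"
    using sum_orthonormal_weights[OF e] r by simp
  then obtain c where c: "c \<in> cfgs S" "(\<Sum>i<r. (cmod (e i c))\<^sup>2) < 1"
    by (meson not_le sum_mono)
  define w where "w = unit_residual r e c"
  define n where "n = 1 - (\<Sum>i<r. (cmod (e i c))\<^sup>2)"
  have n: "n > 0" using c by (simp add: n_def)
  define v where "v = (\<lambda>x. of_real (1 / sqrt n) * w x)"
  have "inner S v v = of_real (1 / sqrt n) * (of_real (1 / sqrt n) * of_real n)"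
    using inner_unit_residual_self[OF S e c(1)]
    by (simp only: v_def inner_scale_left inner_scale_right w_def n_def complex_cnj_complex_of_real)
  also have "\<dots> = of_real (1 / sqrt n * (1 / sqrt n * n))" by (simp only: of_real_mult)
  also have "\<dots> = 1" using n by simp
  finally have 1: "inner S v v = 1" .
  have 2: "vec_on S v"
    using vec_on_unit_residual[OF e c(1)] by (simp add: v_def w_def vec_on_def)
  have 3: "inner S (e j) v = 0" if "j < r" for j
    using inner_unit_residual[OF S e c(1) that] by (simp only: v_def w_def inner_scale_right) simp
  show ?thesis using that 1 2 3 by blast
qed

lemma orthonormal_Suc:
  assumes "orthonormal S r e" "vec_on S v" "inner S v v = 1" "\<And>j. j < r \<Longrightarrow> inner S (e j) v = 0"
  shows "orthonormal S (Suc r) (e(r := v))"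
proof -
  have "inner S v (e j) = 0" if "j < r" for j
    using assms(4)[OF that] cnj_inner[of S "e j" v] by simp
  then show ?thesis
    using assms by (auto simp: orthonormal_def less_Suc_eq)
qed

lemma orthonormal_extend:
  assumes S: "finite S" and e: "orthonormal S r e"
  shows "m \<ge> r \<Longrightarrow> m \<le> card (cfgs S) \<Longrightarrow> \<exists>f. orthonormal S m f \<and> (\<forall>i<r. f i = e i)"
proof (induction m)
  case 0
  then show ?case using e by auto
next
  case (Suc m)
  show ?case
  proof (cases "r = Suc m")
    case True
    then show ?thesis using e by auto
  next
    case False
    then obtain f where f: "orthonormal S m f" "\<forall>i<r. f i = e i" using Suc by auto
    obtain v where "vec_on S v" "inner S v v = 1" "\<And>j. j < m \<Longrightarrow> inner S (f j) v = 0"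
      using orthonormal_complement_nontrivial[OF S f(1)] Suc.prems by auto
    then have "orthonormal S (Suc m) (f(m := v))" by (rule orthonormal_Suc[OF f(1)])
    moreover have "\<forall>i<r. (f(m := v)) i = e i" using f Suc.prems False by auto
    ultimately show ?thesis by blast
  qed
qed

text \<open>A full family leaves residuals whose nonnegative squared norms sum to zero, so each
  residual vanishes; entry by entry this is the resolution of the identity.\<close>

lemma orthonormal_complete:
  assumes S: "finite S" and e: "orthonormal S (card (cfgs S)) e"
    and c: "c \<in> cfgs S"
  shows "(\<Sum>i<card (cfgs S). e i x * cnj (e i c)) = (if x = c then 1 else 0)"
proof -
  let ?N = "card (cfgs S)"
  have nn: "1 - (\<Sum>i<?N. (cmod (e i c))\<^sup>2) \<ge> 0" if "c \<in> cfgs S" for c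
    using inner_unit_residual_self[OF S e that] inner_self_nonneg[of S "unit_residual ?N e c"]
    by simp
  have "(\<Sum>c\<in>cfgs S. 1 - (\<Sum>i<?N. (cmod (e i c))\<^sup>2)) = 0"
    using sum_orthonormal_weights[OF e] by (simp add: sum_subtractf)
  then have "1 - (\<Sum>i<?N. (cmod (e i c))\<^sup>2) = 0"
    using nn c S sum_nonneg_eq_0_iff[of "cfgs S" "\<lambda>c. 1 - (\<Sum>i<?N. (cmod (e i c))\<^sup>2)"] by simp
  then have "Re (inner S (unit_residual ?N e c) (unit_residual ?N e c)) = 0"
    using inner_unit_residual_self[OF S e c] by simp
  then have "unit_residual ?N e c = (\<lambda>_. 0)"
    using inner_self_eq_0[OF S] vec_on_unit_residual[OF e c] by blast
  then have "unit_residual ?N e c x = 0" by simp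
  then show ?thesis by (simp add: unit_residual_def mult.commute)
qed

lemma tr_orthonormal:
  assumes S: "finite S" and e: "orthonormal S (card (cfgs S)) e"
  shows "tr S A = (\<Sum>i<card (cfgs S). inner S (e i) (app S A (e i)))"
proof -
  have "(\<Sum>i<card (cfgs S). inner S (e i) (app S A (e i)))
      = (\<Sum>i<card (cfgs S). \<Sum>c\<in>cfgs S. \<Sum>x\<in>cfgs S. A c x * (e i x * cnj (e i c)))"
    by (simp add: inner_def app_def sum_distrib_left mult_ac)
  also have "\<dots> = (\<Sum>c\<in>cfgs S. \<Sum>i<card (cfgs S). \<Sum>x\<in>cfgs S. A c x * (e i x * cnj (e i c)))"
    by (rule sum.swap)
  also have "\<dots> = (\<Sum>c\<in>cfgs S. \<Sum>x\<in>cfgs S. \<Sum>i<card (cfgs S). A c x * (e i x * cnj (e i c)))"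
    by (intro sum.cong refl sum.swap)
  also have "\<dots> = (\<Sum>c\<in>cfgs S. \<Sum>x\<in>cfgs S. A c x * (if x = c then 1 else 0))"
    by (intro sum.cong refl) (simp add: sum_distrib_left[symmetric] orthonormal_complete[OF S e])
  also have "\<dots> = tr S A"
    using S by (simp add: tr_def if_distrib[of "\<lambda>x. _ * x"] cong: if_cong)
  finally show ?thesis by simp
qed

text \<open>\<open>unitary\<close> asks only for one of the two identities. It makes the columns of
  \<open>U\<close> an orthonormal family of full size, and completeness of that family is the other
  identity.\<close>

lemma unitary_adj_right:
  assumes S: "finite S" and U: "unitary S U"
  shows "mmult S U (adj U) = ident S"
proof (rule op_on_eqI)
  fix c c' assume c: "c \<in> cfgs S" "c' \<in> cfgs S"
  let ?N = "card (cfgs S)"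
  obtain h where h: "bij_betw h {0..<?N} (cfgs S)"
    using ex_bij_betw_nat_finite[of "cfgs S"] S by auto
  define e where "e = (\<lambda>i x. U x (h i))"
  have inS: "h i \<in> cfgs S" if "i < ?N" for i using h that by (auto simp: bij_betw_def)
  have inj: "h i = h j \<longleftrightarrow> i = j" if "i < ?N" "j < ?N" for i j
    using h that by (auto simp: bij_betw_def inj_on_def)
  have "inner S (e i) (e j) = (if i = j then 1 else 0)" if "i < ?N" "j < ?N" for i j
  proof -
    have "mmult S (adj U) U (h i) (h j) = ident S (h i) (h j)"
      using U by (simp add: unitary_def)
    then show ?thesis
      using inS[OF that(1)] inS[OF that(2)] inj[OF that]
      by (simp add: mmult_def adj_def inner_def e_def ident_def split: if_splits)
  qed
  then have e: "orthonormal S ?N e"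
    using U by (auto simp: orthonormal_def e_def vec_on_def unitary_def op_on_def)
  have "mmult S U (adj U) c c' = (\<Sum>y\<in>cfgs S. U c y * cnj (U c' y))"
    using c by (simp add: mmult_def adj_def)
  also have "\<dots> = (\<Sum>i\<in>{0..<?N}. U c (h i) * cnj (U c' (h i)))"
    using sum.reindex_bij_betw[OF h, of "\<lambda>y. U c y * cnj (U c' y)"] by simp
  also have "\<dots> = (if c = c' then 1 else 0)"
    using orthonormal_complete[OF S e c(2), of c] by (simp add: e_def lessThan_atLeast0)
  finally show "mmult S U (adj U) c c' = ident S c c'" using c by (simp add: ident_def)
qed simp_all

section \<open>Linear dependence, annihilating polynomials and eigenvectors\<close>

lemma linear_dependence:
  assumes "finite I"
  shows "finite J \<Longrightarrow> card I < card J \<Longrightarrow>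
    \<exists>a. (\<exists>j\<in>J. a j \<noteq> 0) \<and> (\<forall>i\<in>I. (\<Sum>j\<in>J. a j * w j i) = (0::complex))"
  using assms
proof (induction I arbitrary: J w rule: finite_induct)
  case empty
  then have "J \<noteq> {}" by auto
  then show ?case by (intro exI[of _ "\<lambda>_. 1"]) auto
next
  case (insert x F)
  show ?case
  proof (cases "\<forall>j\<in>J. w j x = 0")
    case True
    moreover obtain a where "\<exists>j\<in>J. a j \<noteq> 0" "\<forall>i\<in>F. (\<Sum>j\<in>J. a j * w j i) = 0"
      using insert.IH[of J w] insert.prems insert.hyps by (auto simp del: ex_simps)
    ultimately show ?thesis by (intro exI[of _ a]) auto
  next
    case False
    then obtain j0 where j0: "j0 \<in> J" "w j0 x \<noteq> 0" by auto
    \<comment> \<open>Elimination with pivot \<open>w j0\<close>: coordinate \<open>x\<close> of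
      every \<open>w' j\<close> is zero, so the induction hypothesis applies to the remaining
      coordinates with one vector fewer.\<close>
    define w' where "w' = (\<lambda>j i. w j i - w j x / w j0 x * w j0 i)"
    have "card F < card (J - {j0})" using insert j0 by simp
    then obtain a where a: "\<exists>j\<in>J - {j0}. a j \<noteq> 0"
      "\<forall>i\<in>F. (\<Sum>j\<in>J - {j0}. a j * w' j i) = 0"
      using insert.IH[of "J - {j0}" w'] insert.prems by auto
    \<comment> \<open>The coefficient of the pivot cancels coordinate \<open>x\<close>; on the other
      coordinates it accounts for the multiples of \<open>w j0\<close> subtracted in
      \<open>w'\<close>.\<close>
    define s where "s = (\<Sum>j\<in>J - {j0}. a j * w j x) / w j0 x"
    define b where "b = a(j0 := - s)"
    have split: "(\<Sum>j\<in>J. b j * w j i) = (\<Sum>j\<in>J - {j0}. a j * w j i) - s * w j0 i" for i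
    proof -
      have "(\<Sum>j\<in>J. b j * w j i) = b j0 * w j0 i + (\<Sum>j\<in>J - {j0}. b j * w j i)"
        using j0 insert.prems by (simp add: sum.remove)
      also have "(\<Sum>j\<in>J - {j0}. b j * w j i) = (\<Sum>j\<in>J - {j0}. a j * w j i)"
        by (intro sum.cong) (auto simp: b_def)
      finally show ?thesis by (simp add: b_def)
    qed
    have "(\<Sum>j\<in>J. b j * w j x) = 0"
      using j0 by (simp add: split s_def)
    moreover have "(\<Sum>j\<in>J. b j * w j i) = 0" if "i \<in> F" for i
    proof -
      have "0 = (\<Sum>j\<in>J - {j0}. a j * w' j i)" using a that by simp
      also have "\<dots> = (\<Sum>j\<in>J - {j0}. a j * w j i) - s * w j0 i"
        by (simp add: w'_def s_def ring_distribs sum_subtractf sum_divide_distrib sum_distrib_left sum_distrib_right mult_ac)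
      finally show ?thesis using split by simp
    qed
    moreover have "\<exists>j\<in>J. b j \<noteq> 0" using a by (auto simp: b_def)
    ultimately show ?thesis by blast
  qed
qed

text \<open>The sequence \<open>h\<close> is a Krylov sequence, and the assumption on
  \<open>p\<close> says p(H) h0 = 0. Splitting off a root, p = (X - z) q: if q(H) h0 = 0 then
  \<open>q\<close> takes over from \<open>p\<close>, otherwise q(H) h0 is an eigenvector for
  \<open>z\<close>. Degree zero would make h0 vanish. The subspace is represented by a predicate
  \<open>W\<close> closed under linear combinations.\<close>

lemma eigenvector_from_annihilator:
  assumes W: "\<And>u v a b. W u \<Longrightarrow> W v \<Longrightarrow> W (\<lambda>c. a * u c + b * v c)"
    and h: "\<And>j. h (Suc j) = app S H (h j)" and Wh: "\<And>j. W (h j)"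
    and h0: "h 0 \<noteq> (\<lambda>_. 0)"
  shows "p \<noteq> 0 \<Longrightarrow> (\<lambda>c. \<Sum>j\<le>degree p. coeff p j * h j c) = (\<lambda>_. 0) \<Longrightarrow>
    \<exists>u z. W u \<and> u \<noteq> (\<lambda>_. 0) \<and> app S H u = (\<lambda>c. z * u c)"
proof (induction "degree p" arbitrary: p)
  case 0
  then have "coeff p 0 \<noteq> 0" by (metis leading_coeff_0_iff)
  with 0 have "h 0 = (\<lambda>_. 0)" by (simp add: fun_eq_iff)
  with h0 show ?case by simp
next
  case (Suc n)
  then have "\<not> constant (poly p)" by (simp add: constant_degree)
  then obtain z where "poly p z = 0" using fundamental_theorem_of_algebra by blast
  then obtain q where q: "p = [:- z, 1:] * q" by (auto simp: poly_eq_0_iff_dvd)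
  have q0: "q \<noteq> 0" using q Suc.prems by auto
  have dq: "degree p = Suc (degree q)" unfolding q using q0 by (subst degree_mult_eq) auto
  define u where "u = (\<lambda>c. \<Sum>j\<le>degree q. coeff q j * h j c)"
  have Wsum: "W (\<lambda>c. \<Sum>j<m. a j * h j c)" for m a
  proof (induction m)
    case 0
    show ?case using W[OF Wh Wh, of 0 0 0 0] by simp
  next
    case (Suc m)
    show ?case using W[OF Suc Wh, of 1 "a m" m] by simp
  qed
  have Wu: "W u" unfolding u_def using Wsum[of "coeff q" "Suc (degree q)"]
    by (simp only: lessThan_Suc_atMost)
  show ?case
  proof (cases "u = (\<lambda>_. 0)")
    case True
    then show ?thesis using Suc.hyps(1)[of q] Suc.hyps(2) dq q0 by (simp add: u_def)
  next
    case False
    have "app S H u c = z * u c" for c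
    proof -
      have "0 = (\<Sum>j\<le>Suc (degree q). coeff p j * h j c)"
        using Suc.prems(2) dq by (simp add: fun_eq_iff)
      also have "\<dots> = (\<Sum>j\<le>Suc (degree q). coeff (pCons 0 q) j * h j c)
           - (\<Sum>j\<le>Suc (degree q). z * (coeff q j * h j c))"
        unfolding sum_subtractf[symmetric] q
        by (intro sum.cong) (simp_all add: algebra_simps)
      \<comment> \<open>Multiplication by X shifts the coefficients, which amounts to one
        application of \<open>H\<close> along the sequence.\<close>
      also have "(\<Sum>j\<le>Suc (degree q). coeff (pCons 0 q) j * h j c)
          = (\<Sum>j\<le>degree q. coeff q j * h (Suc j) c)"
        by (subst sum.atMost_Suc_shift) simp
      also have "\<dots> = app S H u c"
        unfolding u_def app_sum app_scale h ..
      also have "(\<Sum>j\<le>Suc (degree q). z * (coeff q j * h j c)) = z * u c"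
        by (simp add: u_def sum_distrib_left coeff_eq_0)
      finally show ?thesis by simp
    qed
    then show ?thesis using Wu False by blast
  qed
qed

text \<open>One more Krylov vector than \<open>card (cfgs S)\<close> must give a dependent system;
  the coefficients of the dependence form the annihilating polynomial.\<close>

lemma eigenvector_in_subspace:
  assumes S: "finite S" and W: "\<And>u v a b. W u \<Longrightarrow> W v \<Longrightarrow> W (\<lambda>c. a * u c + b * v c)"
    and WH: "\<And>u. W u \<Longrightarrow> W (app S H u)" and WS: "\<And>u. W u \<Longrightarrow> vec_on S u"
    and v: "W v" "v \<noteq> (\<lambda>_. 0)"
  shows "\<exists>u z. W u \<and> u \<noteq> (\<lambda>_. 0) \<and> app S H u = (\<lambda>c. z * u c)"
proof -
  let ?N = "card (cfgs S)"
  define h where "h = (\<lambda>j. (app S H ^^ j) v)"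
  have hS: "h (Suc j) = app S H (h j)" for j by (simp add: h_def)
  have Wh: "W (h j)" for j by (induction j) (use v WH hS in \<open>auto simp: h_def\<close>)
  obtain a where a: "\<exists>j\<in>{..?N}. a j \<noteq> 0"
    "\<forall>c\<in>cfgs S. (\<Sum>j\<in>{..?N}. a j * h j c) = 0"
    using linear_dependence[of "cfgs S" "{..?N}" h] S by auto
  define p where "p = (\<Sum>j\<le>?N. monom (a j) j)"
  have cp: "coeff p j = (if j \<le> ?N then a j else 0)" for j
    by (simp add: p_def coeff_sum)
  have p0: "p \<noteq> 0" using a(1) cp by (metis atMost_iff coeff_0)
  have dp: "degree p \<le> ?N" by (rule degree_le) (simp add: cp)
  have "(\<Sum>j\<le>degree p. coeff p j * h j c) = 0" for c
  proof -
    have "(\<Sum>j\<le>degree p. coeff p j * h j c) = (\<Sum>j\<le>?N. coeff p j * h j c)"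
      by (intro sum.mono_neutral_left) (use dp in \<open>auto simp: coeff_eq_0\<close>)
    also have "\<dots> = (\<Sum>j\<le>?N. a j * h j c)" by (intro sum.cong) (auto simp: cp)
    also have "\<dots> = 0"
    proof (cases "c \<in> cfgs S")
      case True
      then show ?thesis using a(2) by simp
    next
      case False
      then have "h j c = 0" for j using WS[OF Wh] by (simp add: vec_on_def)
      then show ?thesis by simp
    qed
    finally show ?thesis .
  qed
  moreover have "h 0 \<noteq> (\<lambda>_. 0)" using v by (simp add: h_def)
  ultimately show ?thesis
    using eigenvector_from_annihilator[of W h S H p, OF W hS Wh] p0 by blast
qed

definition hermitian :: "label set \<Rightarrow> op \<Rightarrow> bool" where
  "hermitian S H \<longleftrightarrow> (\<forall>c\<in>cfgs S. \<forall>c'\<in>cfgs S. H c' c = cnj (H c c'))"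

lemma app_hermitian: "hermitian S H \<Longrightarrow> app S (adj H) v = app S H v"
  unfolding app_def adj_def hermitian_def by (intro ext if_cong sum.cong refl) metis

lemma inner_hermitian:
  "hermitian S H \<Longrightarrow> inner S u (app S H v) = inner S (app S H u) v"
  by (simp add: inner_app_adj app_hermitian)

text \<open>One eigenvector at a time: the orthogonal complement of those already found is invariant
  because \<open>H\<close> is hermitian, and it is nonzero as long as the family is not
  full.\<close>

theorem spectral_theorem:
  assumes S: "finite S" and H: "hermitian S H"
  obtains e l where "orthonormal S (card (cfgs S)) e"
    "\<And>i. i < card (cfgs S) \<Longrightarrow> app S H (e i) = (\<lambda>c. of_real (l i) * e i c)"
proof -
  have "r \<le> card (cfgs S) \<Longrightarrow>
     \<exists>e l. orthonormal S r e \<and> (\<forall>i<r. app S H (e i) = (\<lambda>c. of_real (l i) * e i c))" for r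
  proof (induction r)
    case 0
    then show ?case by (auto simp: orthonormal_def)
  next
    case (Suc r)
    then obtain e l where e: "orthonormal S r e"
      and l: "\<forall>i<r. app S H (e i) = (\<lambda>c. of_real (l i) * e i c)" by auto
    define W where "W = (\<lambda>u. vec_on S u \<and> (\<forall>j<r. inner S (e j) u = 0))"
    obtain v where v: "vec_on S v" "inner S v v = 1" "\<And>j. j < r \<Longrightarrow> inner S (e j) v = 0"
      using orthonormal_complement_nontrivial[OF S e] Suc.prems by auto
    have "\<exists>u z. W u \<and> u \<noteq> (\<lambda>_. 0) \<and> app S H u = (\<lambda>c. z * u c)"
    proof (rule eigenvector_in_subspace[OF S])
      show "W (\<lambda>c. a * u c + b * v c)" if "W u" "W v" for u v a b
        using that by (simp add: W_def vec_on_lincomb inner_add_right inner_scale_right)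
      show "W (app S H u)" if "W u" for u
        using that l by (simp add: W_def inner_hermitian[OF H] inner_scale_left)
      show "vec_on S u" if "W u" for u using that by (simp add: W_def)
      show "W v" using v by (simp add: W_def)
      show "v \<noteq> (\<lambda>_. 0)" using v(2) by (auto simp: inner_def)
    qed
    then obtain u z where u: "W u" "u \<noteq> (\<lambda>_. 0)" "app S H u = (\<lambda>c. z * u c)" by blast
    define n where "n = Re (inner S u u)"
    have iu: "inner S u u = of_real n" by (simp add: n_def inner_self del: of_real_sum)
    have "n \<noteq> 0" using inner_self_eq_0[OF S] u by (auto simp: n_def W_def)
    then have n: "n > 0" using inner_self_nonneg[of S u] unfolding n_def by linarith
    have "z * of_real n = cnj z * of_real n"
      using inner_hermitian[OF H, of u u] u(3) iu by (simp add: inner_scale_left inner_scale_right)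
    then have "z = cnj z" using n by simp
    then have z: "z = of_real (Re z)" by (simp add: complex_eq_iff)
    define w where "w = (\<lambda>c. of_real (1 / sqrt n) * u c)"
    have "inner S w w = of_real (1 / sqrt n) * (of_real (1 / sqrt n) * of_real n)"
      by (simp only: w_def inner_scale_left inner_scale_right iu complex_cnj_complex_of_real)
    also have "\<dots> = of_real (1 / sqrt n * (1 / sqrt n * n))" by (simp only: of_real_mult)
    also have "\<dots> = 1" using n by simp
    finally have w1: "inner S w w = 1" .
    have w2: "vec_on S w" using u(1) by (simp add: W_def w_def vec_on_def)
    have w3: "inner S (e j) w = 0" if "j < r" for j
      using u(1) that by (simp only: w_def inner_scale_right) (simp add: W_def)
    have w4: "app S H w = (\<lambda>c. of_real (Re z) * w c)"
      unfolding w_def app_scale u(3) z[symmetric] by (simp add: mult_ac)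
    have "orthonormal S (Suc r) (e(r := w))"
      by (rule orthonormal_Suc[OF e w2 w1 w3])
    moreover have "\<forall>i<Suc r. app S H ((e(r := w)) i) = (\<lambda>c. of_real ((l(r := Re z)) i) * (e(r := w)) i c)"
      using l w4 by (auto simp: less_Suc_eq)
    ultimately show ?case by blast
  qed
  from this[of "card (cfgs S)"] that show ?thesis by auto
qed

text \<open>By completeness a matrix entry is a sum over the basis of an entry of the image times a
  conjugate entry of the basis vector, so the images determine the matrix.\<close>

lemma op_eq_on_basis:
  assumes S: "finite S" and e: "orthonormal S (card (cfgs S)) e"
    and "op_on S A" "op_on S B"
    and eq: "\<And>i. i < card (cfgs S) \<Longrightarrow> app S A (e i) = app S B (e i)"
  shows "A = B"
proof (rule op_on_eqI[OF assms(3,4)])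
  have *: "A c c' = (\<Sum>i<card (cfgs S). app S A (e i) c * cnj (e i c'))"
    if "c \<in> cfgs S" "c' \<in> cfgs S" for A c c'
  proof -
    have "(\<Sum>i<card (cfgs S). app S A (e i) c * cnj (e i c'))
        = (\<Sum>i<card (cfgs S). \<Sum>x\<in>cfgs S. A c x * (e i x * cnj (e i c')))"
      using that by (simp add: app_def sum_distrib_right mult.assoc)
    also have "\<dots> = (\<Sum>x\<in>cfgs S. \<Sum>i<card (cfgs S). A c x * (e i x * cnj (e i c')))"
      by (rule sum.swap)
    also have "\<dots> = (\<Sum>x\<in>cfgs S. A c x * (if x = c' then 1 else 0))"
      using that
      by (intro sum.cong refl) (simp add: sum_distrib_left[symmetric] orthonormal_complete[OF S e])
    also have "\<dots> = A c c'" using that S by (simp add: if_distrib[of "\<lambda>x. _ * x"] cong: if_cong)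
    finally show ?thesis by simp
  qed
  fix c c' assume "c \<in> cfgs S" "c' \<in> cfgs S"
  then show "A c c' = B c c'" by (simp add: * eq)
qed

subsection \<open>Unitary operators\<close>

lemma unitary_ident [simp]: "finite S \<Longrightarrow> unitary S (ident S)"
  by (simp add: unitary_def mmult_ident_left)

lemma unitary_adj: "finite S \<Longrightarrow> unitary S U \<Longrightarrow> unitary S (adj U)"
  by (simp add: unitary_adj_right unitary_def[of _ "adj U"]) (simp add: unitary_def)

lemma unitary_mmult:
  assumes "finite S" "unitary S U" "unitary S V"
  shows "unitary S (mmult S U V)"
proof -
  have "mmult S (adj (mmult S U V)) (mmult S U V)
      = mmult S (adj V) (mmult S (mmult S (adj U) U) V)"
    by (simp add: adj_mmult mmult_assoc)
  also have "\<dots> = ident S"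
    using assms by (simp add: unitary_def mmult_ident_left)
  finally show ?thesis by (simp add: unitary_def)
qed

lemma unitary_cancel:
  assumes "finite S" "unitary S U" "vec_on S v"
  shows "app S (adj U) (app S U v) = v" "app S U (app S (adj U) v) = v"
  using assms by (simp_all add: app_mmult[symmetric] unitary_adj_right app_ident)
    (simp add: unitary_def app_ident)

lemma inner_unitary:
  assumes "finite S" "unitary S U" "vec_on S v"
  shows "inner S (app S U u) (app S U v) = inner S u v"
  using assms inner_app_adj[of S "u" "adj U" "app S U v"] by (simp add: unitary_cancel)

subsection \<open>Positive operators and their square roots\<close>

lemma app_unit_vec:
  assumes "finite S" "c' \<in> cfgs S" "c \<in> cfgs S"
  shows "app S A (\<lambda>x. if x = c' then 1 else 0) c = A c c'"
  using assms by (simp add: app_def if_distrib[of "\<lambda>x. _ * x"] cong: if_cong)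

lemma inner_unit_vec_app:
  assumes "finite S" "c \<in> cfgs S" "c' \<in> cfgs S"
  shows "inner S (\<lambda>x. if x = c then 1 else 0) (app S A (\<lambda>x. if x = c' then 1 else 0)) = A c c'"
  using inner_unit_vec[OF assms(1,2), of "app S A (\<lambda>x. if x = c' then 1 else 0)"]
    cnj_inner[of S "app S A (\<lambda>x. if x = c' then 1 else 0)" "\<lambda>x. if x = c then 1 else 0"]
    app_unit_vec[OF assms(1,3,2), of A] by simp

lemma psd_op_on: "psd S A \<Longrightarrow> op_on S A"
  by (simp add: psd_def)

text \<open>\<open>psd\<close> demands real nonnegative expectations and no symmetry of the matrix.
  The expectation in e_c + z e_c' is real for every z; z = 1 settles the imaginary parts and z = i
  the real parts of the off-diagonal entries.\<close>

lemma psd_hermitian: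
  assumes S: "finite S" and A: "psd S A"
  shows "hermitian S A"
  unfolding hermitian_def
proof (intro ballI)
  fix c c' assume c: "c \<in> cfgs S" "c' \<in> cfgs S"
  let ?u = "\<lambda>c x. if x = (c::cfg) then 1 else (0::complex)"
  have Im0: "Im (A c c + z * A c c' + cnj z * (A c' c + z * A c' c')) = 0" for z
  proof -
    define v where "v = (\<lambda>x. ?u c x + z * ?u c' x)"
    have "vec_on S v" using c by (auto simp: v_def vec_on_def)
    then have "Im (inner S v (app S A v)) = 0" using A by (simp add: psd_def)
    also have "inner S v (app S A v) = A c c + z * A c c' + cnj z * (A c' c + z * A c' c')"
      by (simp only: v_def app_add app_scale inner_add_left inner_add_right inner_scale_left
          inner_scale_right inner_unit_vec_app[OF S] c)
        (simp add: ring_distribs)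
    finally show ?thesis .
  qed
  have d: "Im (A c c) = 0" using Im0[of 0] by simp
  have d': "Im (A c' c') = 0"
  proof -
    have "vec_on S (?u c')" using c by (auto simp: vec_on_def)
    then have "Im (inner S (?u c') (app S A (?u c'))) = 0" using A by (simp add: psd_def)
    then show ?thesis by (simp only: inner_unit_vec_app[OF S c(2) c(2)])
  qed
  show "A c' c = cnj (A c c')"
    using Im0[of 1] Im0[of \<i>] d d' by (simp add: complex_eq_iff)
qed

lemma psd_proj: "vec_on S v \<Longrightarrow> psd S (proj v)"
  unfolding psd_def
proof (intro conjI allI impI)
  fix w assume "vec_on S v" "vec_on S w"
  then have "inner S w (app S (proj v) w) = inner S v w * cnj (inner S v w)"
    by (simp add: app_proj inner_scale_right cnj_inner)
  then have "inner S w (app S (proj v) w) = of_real ((cmod (inner S v w))\<^sup>2)"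
    by (simp add: complex_norm_square del: of_real_power)
  then show "Im (inner S w (app S (proj v) w)) = 0" "0 \<le> Re (inner S w (app S (proj v) w))"
    by (simp_all del: of_real_power)
qed (simp add: op_on_proj)

lemma psd_adj_mmult: "psd S (mmult S (adj A) A)"
  unfolding psd_def
proof (intro conjI allI impI)
  fix v
  have "inner S v (app S (mmult S (adj A) A) v) = inner S (app S A v) (app S A v)"
    by (simp add: app_mmult inner_app_adj)
  then show "Im (inner S v (app S (mmult S (adj A) A) v)) = 0"
    "0 \<le> Re (inner S v (app S (mmult S (adj A) A) v))"
    by (simp_all add: inner_self del: of_real_sum) (simp add: sum_nonneg)
qed simp

lemma app_opsum:
  "app S (\<lambda>c c'. \<Sum>j\<in>J. A j c c') v = (\<lambda>c. \<Sum>j\<in>J. app S (A j) v c)"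
  unfolding app_def by (rule ext) (simp add: sum_distrib_right sum.swap[of _ J])

lemma app_opscale: "app S (\<lambda>c c'. a * A c c') v = (\<lambda>c. a * app S A v c)"
  unfolding app_def by (rule ext) (simp add: sum_distrib_left mult_ac)

lemma app_opdiff: "app S (opdiff A B) v = (\<lambda>c. app S A v c - app S B v c)"
  unfolding app_def opdiff_def by (rule ext) (simp add: left_diff_distrib sum_subtractf)

lemma psd_scale: "psd S A \<Longrightarrow> 0 \<le> a \<Longrightarrow> psd S (\<lambda>c c'. of_real a * A c c')"
  by (auto simp: psd_def op_on_def app_opscale inner_scale_right)

lemma psd_sum:
  assumes "\<And>j. j \<in> J \<Longrightarrow> psd S (A j)"
  shows "psd S (\<lambda>c c'. \<Sum>j\<in>J. A j c c')"
  unfolding psd_def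
proof (intro conjI allI impI)
  show "op_on S (\<lambda>c c'. \<Sum>j\<in>J. A j c c')"
    unfolding op_on_def
  proof (intro allI impI)
    fix c c' assume "c \<notin> cfgs S \<or> c' \<notin> cfgs S"
    then have "A j c c' = 0" if "j \<in> J" for j
      using assms[OF that] by (auto simp: psd_def op_on_def)
    then show "(\<Sum>j\<in>J. A j c c') = 0" by simp
  qed
  fix v assume "vec_on S v"
  then have "Im (inner S v (app S (A j) v)) = 0 \<and> 0 \<le> Re (inner S v (app S (A j) v))" if "j \<in> J" for j
    using assms[OF that] by (simp add: psd_def)
  then show "Im (inner S v (app S (\<lambda>c c'. \<Sum>j\<in>J. A j c c') v)) = 0"
    "0 \<le> Re (inner S v (app S (\<lambda>c c'. \<Sum>j\<in>J. A j c c') v))"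
    by (simp_all add: app_opsum inner_sum_right sum_nonneg)
qed

lemma psd_eigenbasis:
  assumes S: "finite S" and A: "psd S A"
  obtains e l where "orthonormal S (card (cfgs S)) e"
    "\<And>i. i < card (cfgs S) \<Longrightarrow> app S A (e i) = (\<lambda>c. of_real (l i) * e i c)"
    "\<And>i. i < card (cfgs S) \<Longrightarrow> 0 \<le> l i"
proof -
  obtain e l where e: "orthonormal S (card (cfgs S)) e"
    and l: "\<And>i. i < card (cfgs S) \<Longrightarrow> app S A (e i) = (\<lambda>c. of_real (l i) * e i c)"
    using spectral_theorem[OF S psd_hermitian[OF S A]] by metis
  have "0 \<le> l i" if i: "i < card (cfgs S)" for i
  proof -
    have "Re (inner S (e i) (app S A (e i))) \<ge> 0"
      using A e i by (simp add: psd_def orthonormal_def)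
    moreover have "inner S (e i) (app S A (e i)) = of_real (l i)"
      using e i by (simp add: l inner_scale_right orthonormal_def)
    ultimately show ?thesis by simp
  qed
  then show ?thesis using that e l by blast
qed

lemma psd_sqrt_exists:
  assumes S: "finite S" and A: "psd S A"
  shows "\<exists>B. psd S B \<and> mmult S B B = A"
proof -
  let ?N = "card (cfgs S)"
  obtain e l where e: "orthonormal S ?N e"
    and l: "\<And>i. i < ?N \<Longrightarrow> app S A (e i) = (\<lambda>c. of_real (l i) * e i c)"
    and l0: "\<And>i. i < ?N \<Longrightarrow> 0 \<le> l i"
    using psd_eigenbasis[OF S A] by metis
  have ve: "vec_on S (e i)" if "i < ?N" for i using e that by (simp add: orthonormal_def)
  define B where "B = (\<lambda>c c'. \<Sum>i<?N. of_real (sqrt (l i)) * proj (e i) c c')"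
  have B: "psd S B"
    unfolding B_def using l0 ve by (intro psd_sum psd_scale psd_proj) auto
  have Be: "app S B (e j) = (\<lambda>c. of_real (sqrt (l j)) * e j c)" if j: "j < ?N" for j
  proof (rule ext)
    fix c
    have "app S B (e j) c = (\<Sum>i<?N. of_real (sqrt (l i)) * (inner S (e i) (e j) * e i c))"
      using ve by (simp add: B_def app_opsum app_opscale app_proj)
    also have "\<dots> = (\<Sum>i<?N. if i = j then of_real (sqrt (l j)) * e j c else 0)"
      using e j by (intro sum.cong) (auto simp: orthonormal_def)
    finally show "app S B (e j) c = of_real (sqrt (l j)) * e j c" using j by simp
  qed
  have "mmult S B B = A"
  proof (rule op_eq_on_basis[OF S e])
    show "op_on S A" using A by (rule psd_op_on)
    fix j assume j: "j < ?N"
    then show "app S (mmult S B B) (e j) = app S A (e j)"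
      using l0[OF j]
      by (simp add: app_mmult Be app_scale[of S B _ "e j"] l mult.assoc[symmetric]
          of_real_mult[symmetric] del: of_real_mult)
  qed simp
  then show ?thesis using B by blast
qed

text \<open>Let v be an eigenvector of B - C with eigenvalue l. Equal squares give equal norms of B
  v = C v + l v and C v, that is l (2 \<gamma> + l) = 0, where \<gamma> and \<gamma> + l are the
  expectations of C and B in v. Both are nonnegative, which leaves l = 0.\<close>

lemma psd_sqrt_unique:
  assumes S: "finite S" and B: "psd S B" and C: "psd S C" and eq: "mmult S B B = mmult S C C"
  shows "B = C"
proof -
  let ?N = "card (cfgs S)"
  have hB: "hermitian S B" and hC: "hermitian S C" using psd_hermitian[OF S] B C by auto
  have "hermitian S (opdiff B C)"
    unfolding hermitian_def opdiff_def
  proof (intro ballI)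
    fix c c' assume "c \<in> cfgs S" "c' \<in> cfgs S"
    then have "B c' c = cnj (B c c')" "C c' c = cnj (C c c')"
      using hB hC unfolding hermitian_def by blast+
    then show "B c' c - C c' c = cnj (B c c' - C c c')" by simp
  qed
  then obtain e l where e: "orthonormal S ?N e"
    and l: "\<And>i. i < ?N \<Longrightarrow> app S (opdiff B C) (e i) = (\<lambda>c. of_real (l i) * e i c)"
    using spectral_theorem[OF S] by metis
  show ?thesis
  proof (rule op_eq_on_basis[OF S e psd_op_on[OF B] psd_op_on[OF C]])
    fix i assume i: "i < ?N"
    let ?v = "e i"
    have v: "vec_on S ?v" "inner S ?v ?v = 1" using e i by (auto simp: orthonormal_def)
    have Bv: "app S B ?v = (\<lambda>c. app S C ?v c + of_real (l i) * ?v c)"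
      using l[OF i] by (simp add: app_opdiff fun_eq_iff algebra_simps)
    define \<beta> \<gamma> where "\<beta> = Re (inner S ?v (app S B ?v))" and "\<gamma> = Re (inner S ?v (app S C ?v))"
    have pos: "\<beta> \<ge> 0" "\<gamma> \<ge> 0" using B C v by (auto simp: psd_def \<beta>_def \<gamma>_def)
    have bg: "\<beta> = \<gamma> + l i"
      by (simp add: \<beta>_def \<gamma>_def Bv inner_add_right inner_scale_right v)
    have "inner S (app S B ?v) (app S B ?v) = inner S ?v (app S (mmult S B B) ?v)"
      by (simp add: app_mmult inner_hermitian[OF hB, symmetric])
    also have "\<dots> = inner S (app S C ?v) (app S C ?v)"
      by (simp add: eq app_mmult inner_hermitian[OF hC])
    finally have "Re (inner S (app S B ?v) (app S B ?v)) = Re (inner S (app S C ?v) (app S C ?v))"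
      by simp
    moreover have "Re (inner S (app S C ?v) ?v) = \<gamma>"
      using cnj_inner[of S "app S C ?v" ?v] by (metis \<gamma>_def cnj.simps(1))
    ultimately have "l i * (2 * \<gamma> + l i) = 0"
      by (simp add: Bv inner_add_left inner_add_right inner_scale_left inner_scale_right v
          \<gamma>_def[symmetric] algebra_simps)
    then have "l i = 0" using pos bg by (auto simp: mult_eq_0_iff)
    then show "app S B ?v = app S C ?v" by (simp add: Bv)
  qed
qed

lemma msqrt_eqI:
  assumes "finite S" "psd S B" "mmult S B B = A"
  shows "msqrt S A = B"
  unfolding msqrt_def using assms psd_sqrt_unique[OF assms(1)] by (intro the_equality) auto

lemma
  assumes "finite S" "psd S A"
  shows psd_msqrt: "psd S (msqrt S A)" and msqrt_square: "mmult S (msqrt S A) (msqrt S A) = A"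
  using psd_sqrt_exists[OF assms] msqrt_eqI[OF assms(1)] by auto

lemma tr_psd_nonneg:
  assumes S: "finite S" and A: "psd S A"
  shows "0 \<le> Re (tr S A)"
proof -
  obtain e where e: "orthonormal S (card (cfgs S)) e"
    using psd_eigenbasis[OF S A] by metis
  show ?thesis
    unfolding tr_orthonormal[OF S e] Re_sum
    using A e by (intro sum_nonneg) (auto simp: psd_def orthonormal_def)
qed

lemma psd_expectations_le_tr:
  assumes S: "finite S" and A: "psd S A" and e: "orthonormal S r e" and r: "r \<le> card (cfgs S)"
  shows "(\<Sum>i<r. Re (inner S (e i) (app S A (e i)))) \<le> Re (tr S A)"
proof -
  let ?N = "card (cfgs S)"
  obtain f where f: "orthonormal S ?N f" "\<forall>i<r. f i = e i"
    using orthonormal_extend[OF S e r] by auto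
  have "(\<Sum>i<r. Re (inner S (e i) (app S A (e i)))) = (\<Sum>i<r. Re (inner S (f i) (app S A (f i))))"
    using f by simp
  also have "\<dots> \<le> (\<Sum>i<?N. Re (inner S (f i) (app S A (f i))))"
    using A f(1) r by (intro sum_mono2) (auto simp: psd_def orthonormal_def)
  finally show ?thesis unfolding tr_orthonormal[OF S f(1)] Re_sum .
qed

lemma psd_expectation_le_tr:
  assumes S: "finite S" and A: "psd S A" and v: "vec_on S v" "inner S v v = 1"
  shows "Re (inner S v (app S A v)) \<le> Re (tr S A)"
  using psd_expectations_le_tr[OF S A, of 1 "\<lambda>_. v"] S v by (simp add: orthonormal_def card_cfgs)

subsection \<open>Trace norm and fidelity\<close>

lemma tnorm_nonneg: "finite S \<Longrightarrow> 0 \<le> tnorm S A"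
  unfolding tnorm_def by (intro tr_psd_nonneg psd_msqrt psd_adj_mmult)

text \<open>The eigenbasis of |A| with the singular values \<open>b\<close>. Both general bounds on
  \<open>tnorm\<close> go through this form instead of the square root itself.\<close>

lemma singular_basis:
  assumes S: "finite S"
  obtains e b where "orthonormal S (card (cfgs S)) e"
    "\<And>i. i < card (cfgs S) \<Longrightarrow> 0 \<le> b i"
    "\<And>i. i < card (cfgs S) \<Longrightarrow> Re (inner S (app S A (e i)) (app S A (e i))) = (b i)\<^sup>2"
    "tnorm S A = (\<Sum>i<card (cfgs S). b i)"
proof -
  let ?N = "card (cfgs S)" and ?B = "msqrt S (mmult S (adj A) A)"
  have B: "psd S ?B" "mmult S ?B ?B = mmult S (adj A) A"
    using psd_msqrt[OF S psd_adj_mmult] msqrt_square[OF S psd_adj_mmult] by auto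
  obtain e b where e: "orthonormal S ?N e"
    and b: "\<And>i. i < ?N \<Longrightarrow> app S ?B (e i) = (\<lambda>c. of_real (b i) * e i c)"
    and b0: "\<And>i. i < ?N \<Longrightarrow> 0 \<le> b i"
    using psd_eigenbasis[OF S B(1)] by metis
  have 1: "Re (inner S (app S A (e i)) (app S A (e i))) = (b i)\<^sup>2" if i: "i < ?N" for i
  proof -
    have "inner S (app S A (e i)) (app S A (e i)) = inner S (e i) (app S (mmult S (adj A) A) (e i))"
      by (simp add: app_mmult inner_app_adj)
    also have "\<dots> = inner S (e i) (app S ?B (app S ?B (e i)))"
      by (simp only: app_mmult[symmetric] B(2))
    also have "\<dots> = of_real (b i) * (of_real (b i) * inner S (e i) (e i))"
      by (simp only: b[OF i] app_scale inner_scale_right)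
    finally show ?thesis using e i by (simp add: orthonormal_def power2_eq_square)
  qed
  have 2: "tnorm S A = (\<Sum>i<?N. b i)"
    unfolding tnorm_def tr_orthonormal[OF S e] Re_sum
    using e by (intro sum.cong) (auto simp: b inner_scale_right orthonormal_def)
  show ?thesis using that e b0 1 2 by blast
qed

text \<open>One half of trace-norm duality: in the singular basis each diagonal element of W A is,
  by Cauchy-Schwarz and unitarity of \<open>W\<close>, at most the singular value.\<close>

lemma tnorm_ge_tr_unitary:
  assumes S: "finite S" and W: "unitary S W"
  shows "Re (tr S (mmult S W A)) \<le> tnorm S A"
proof -
  let ?N = "card (cfgs S)"
  obtain e b where e: "orthonormal S ?N e" and b0: "\<And>i. i < ?N \<Longrightarrow> 0 \<le> b i"
    and Ae: "\<And>i. i < ?N \<Longrightarrow> Re (inner S (app S A (e i)) (app S A (e i))) = (b i)\<^sup>2"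
    and tn: "tnorm S A = (\<Sum>i<?N. b i)"
    using singular_basis[OF S] by metis
  have "Re (inner S (e i) (app S (mmult S W A) (e i))) \<le> b i" if i: "i < ?N" for i
  proof -
    have ve: "vec_on S (e i)" "inner S (e i) (e i) = 1" using e i by (auto simp: orthonormal_def)
    have "(cmod (inner S (app S (adj W) (e i)) (app S A (e i))))\<^sup>2
        \<le> Re (inner S (app S (adj W) (e i)) (app S (adj W) (e i))) * (b i)\<^sup>2"
      using Cauchy_Schwarz_inner[OF S] Ae[OF i] by metis
    also have "\<dots> = (b i)\<^sup>2"
      using inner_unitary[OF S unitary_adj[OF S W] ve(1)] ve(2) by simp
    finally have "cmod (inner S (app S (adj W) (e i)) (app S A (e i))) \<le> b i"
      using b0[OF i] by (rule power2_le_imp_le)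
    then show ?thesis
      using complex_Re_le_cmod by (simp add: app_mmult inner_app_adj) (metis order_trans)
  qed
  then show ?thesis
    unfolding tr_orthonormal[OF S e] Re_sum tn by (intro sum_mono) simp
qed

text \<open>Deliberately crude: b is at most 1 + b^2, and the squares of the singular values add up
  to the squared entries. Its purpose is to show that the supremum in \<open>eps_code\<close> ranges
  over a bounded set.\<close>

lemma tnorm_upper_bound:
  assumes S: "finite S"
  shows "tnorm S A \<le> real (card (cfgs S)) + (\<Sum>c\<in>cfgs S. \<Sum>c'\<in>cfgs S. (cmod (A c' c))\<^sup>2)"
proof -
  let ?N = "card (cfgs S)"
  obtain e b where e: "orthonormal S ?N e" and b0: "\<And>i. i < ?N \<Longrightarrow> 0 \<le> b i"
    and Ae: "\<And>i. i < ?N \<Longrightarrow> Re (inner S (app S A (e i)) (app S A (e i))) = (b i)\<^sup>2"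
    and tn: "tnorm S A = (\<Sum>i<?N. b i)"
    using singular_basis[OF S] by metis
  have "b i \<le> 1 + (b i)\<^sup>2" for i
  proof -
    have "0 \<le> (b i - 1)\<^sup>2 + (b i)\<^sup>2 + 1" by simp
    then show ?thesis by (simp add: power2_eq_square algebra_simps)
  qed
  then have "tnorm S A \<le> (\<Sum>i<?N. 1 + (b i)\<^sup>2)" unfolding tn by (intro sum_mono)
  also have "\<dots> = real ?N + (\<Sum>i<?N. Re (inner S (app S A (e i)) (app S A (e i))))"
    by (simp add: sum.distrib Ae)
  also have "(\<Sum>i<?N. Re (inner S (app S A (e i)) (app S A (e i)))) = Re (tr S (mmult S (adj A) A))"
    unfolding tr_orthonormal[OF S e] Re_sum
    by (intro sum.cong refl) (simp add: app_mmult inner_app_adj)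
  also have "\<dots> = (\<Sum>c\<in>cfgs S. \<Sum>c'\<in>cfgs S. (cmod (A c' c))\<^sup>2)"
    unfolding tr_def mmult_def adj_def
    by (simp add: mult.commute[of "cnj _"] complex_norm_square[symmetric] del: of_real_power)
  finally show ?thesis .
qed

section \<open>Fidelity with a pure state\<close>

lemma fid_nonneg: "finite S \<Longrightarrow> 0 \<le> fid S \<rho> \<sigma>"
  unfolding fid_def by (rule tnorm_nonneg)

lemma mmult_scale_proj:
  assumes "vec_on S v" "inner S v v = 1"
  shows "mmult S (\<lambda>c c'. a * proj v c c') (\<lambda>c c'. b * proj v c c') = (\<lambda>c c'. a * b * proj v c c')"
proof (rule op_on_eqI)
  show "op_on S (\<lambda>c c'. a * b * proj v c c')"
    using op_on_proj[OF assms(1)] by (simp add: op_on_def)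
  fix c c' assume c: "c \<in> cfgs S" "c' \<in> cfgs S"
  then have "mmult S (\<lambda>c c'. a * proj v c c') (\<lambda>c c'. b * proj v c c') c c'
     = (\<Sum>e\<in>cfgs S. (a * b * (v c * cnj (v c'))) * (cnj (v e) * v e))"
    unfolding mmult_def proj_def by (simp add: mult_ac)
  also have "\<dots> = a * b * (v c * cnj (v c')) * inner S v v"
    by (simp only: sum_distrib_left[symmetric] inner_def)
  finally show "mmult S (\<lambda>c c'. a * proj v c c') (\<lambda>c c'. b * proj v c c') c c' = a * b * proj v c c'"
    using assms by (simp add: proj_def)
qed simp

text \<open>Let A be the root of \<tau> times |v><v|. The adjoint of A times A is |v><v| scaled by
  the expectation of \<tau> in \<open>v\<close>, so A has at most one nonzero singular
  value.\<close>

lemma fid_pure: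
  assumes S: "finite S" and T: "psd S \<tau>" and v: "vec_on S v" "inner S v v = 1"
  shows "fid S \<tau> (proj v) = sqrt (Re (inner S v (app S \<tau> v)))"
proof -
  define z where "z = Re (inner S v (app S \<tau> v))"
  have z: "z \<ge> 0" "inner S v (app S \<tau> v) = of_real z"
    using T v by (auto simp: psd_def z_def complex_eq_iff)
  let ?s = "msqrt S \<tau>"
  have sq: "mmult S ?s ?s = \<tau>" and ps: "psd S ?s" using msqrt_square[OF S T] psd_msqrt[OF S T] by auto
  have sa: "adj ?s = ?s"
  proof (rule op_on_eqI[of S])
    fix c c' assume "c \<in> cfgs S" "c' \<in> cfgs S"
    then have "?s c c' = cnj (?s c' c)"
      using psd_hermitian[OF S ps] unfolding hermitian_def by blast
    then show "adj ?s c c' = ?s c c'" by (simp add: adj_def)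
  qed (use psd_op_on[OF ps] in simp_all)
  have "msqrt S (proj v) = proj v"
    using mmult_scale_proj[OF v, of 1 1] by (intro msqrt_eqI[OF S psd_proj[OF v(1)]]) simp
  moreover have "adj (proj v) = proj v" by (simp add: adj_def proj_def mult.commute)
  ultimately have "mmult S (adj (mmult S ?s (msqrt S (proj v)))) (mmult S ?s (msqrt S (proj v)))
      = mmult S (proj v) (mmult S \<tau> (proj v))"
    by (simp add: adj_mmult sa mmult_assoc) (simp add: mmult_assoc[symmetric] sq)
  also have "\<dots> = (\<lambda>c c'. of_real z * proj v c c')"
  proof (rule op_on_eqI)
    show "op_on S (\<lambda>c c'. of_real z * proj v c c')"
      using op_on_proj[OF v(1)] by (simp add: op_on_def)
    fix c c' assume c: "c \<in> cfgs S" "c' \<in> cfgs S"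
    have X: "mmult S \<tau> (proj v) e c' = app S \<tau> v e * cnj (v c')" if "e \<in> cfgs S" for e
      using that c by (simp add: mmult_def app_def proj_def sum_distrib_right mult.assoc)
    have "mmult S (proj v) (mmult S \<tau> (proj v)) c c'
        = (\<Sum>e\<in>cfgs S. proj v c e * mmult S \<tau> (proj v) e c')"
      using c by (simp add: mmult_def[of S "proj v"])
    also have "\<dots> = (\<Sum>e\<in>cfgs S. (v c * cnj (v c')) * (cnj (v e) * app S \<tau> v e))"
      by (intro sum.cong refl, subst X) (simp_all add: proj_def)
    also have "\<dots> = v c * cnj (v c') * inner S v (app S \<tau> v)"
      by (simp only: sum_distrib_left[symmetric] inner_def)
    finally show "mmult S (proj v) (mmult S \<tau> (proj v)) c c' = of_real z * proj v c c'"
      by (simp add: z proj_def)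
  qed simp
  finally have A: "mmult S (adj (mmult S ?s (msqrt S (proj v)))) (mmult S ?s (msqrt S (proj v)))
      = (\<lambda>c c'. of_real z * proj v c c')" .
  have "msqrt S (\<lambda>c c'. of_real z * proj v c c') = (\<lambda>c c'. of_real (sqrt z) * proj v c c')"
    using z(1) by (intro msqrt_eqI[OF S psd_scale[OF psd_proj[OF v(1)]]])
      (simp_all add: mmult_scale_proj[OF v] of_real_mult[symmetric] del: of_real_mult)
  moreover have "tr S (proj v) = 1"
    using v(2) by (simp add: tr_def proj_def inner_def mult.commute)
  ultimately show ?thesis
    unfolding fid_def tnorm_def A by (simp add: tr_def sum_distrib_left[symmetric] z_def[symmetric])
qed

section \<open>Operators acting on a subregister\<close>

lemma join_in_cfgs: "s \<in> cfgs S \<Longrightarrow> t \<in> cfgs T \<Longrightarrow> join s t \<in> cfgs (S \<union> T)"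
  by (auto simp: cfgs_def join_def)

lemma restr_join:
  assumes "s \<in> cfgs S" "t \<in> cfgs T" "S \<inter> T = {}"
  shows "restr (join s t) S = s" "restr (join s t) T = t"
  using assms by (auto simp: cfgs_def join_def restr_def fun_eq_iff)

lemma join_restr: "c \<in> cfgs (S \<union> T) \<Longrightarrow> join (restr c S) (restr c T) = c"
  by (auto simp: cfgs_def join_def restr_def fun_eq_iff)

lemma restr_restr: "restr (restr c S) T = restr c (S \<inter> T)"
  by (auto simp: restr_def)

lemma restr_id: "c \<in> cfgs S \<Longrightarrow> restr c S = c"
  by (auto simp: restr_def cfgs_def fun_eq_iff)

lemma sum_cfgs_Un:
  assumes "S \<inter> T = {}"
  shows "(\<Sum>c\<in>cfgs (S \<union> T). f c) = (\<Sum>s\<in>cfgs S. \<Sum>t\<in>cfgs T. f (join s t))"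
proof -
  have "(\<Sum>c\<in>cfgs (S \<union> T). f c) = (\<Sum>(s, t)\<in>cfgs S \<times> cfgs T. f (join s t))"
    by (rule sum.reindex_bij_witness[of _ "\<lambda>(s, t). join s t" "\<lambda>c. (restr c S, restr c T)"])
      (use assms in \<open>auto simp: join_in_cfgs restr_join join_restr\<close>)
  then show ?thesis by (simp add: sum.cartesian_product)
qed

lemma sum_cfgs_split:
  assumes "S \<subseteq> P"
  shows "(\<Sum>c\<in>cfgs P. f c) = (\<Sum>s\<in>cfgs S. \<Sum>t\<in>cfgs (P - S). f (join s t))"
  using sum_cfgs_Un[of S "P - S" f] assms by (simp add: Un_absorb1)

lemma join_in_cfgs_Diff: "S \<subseteq> P \<Longrightarrow> s \<in> cfgs S \<Longrightarrow> r \<in> cfgs (P - S) \<Longrightarrow> join s r \<in> cfgs P"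
  using join_in_cfgs[of s S r "P - S"] by (simp add: Un_absorb1)

lemma join_restr_Diff: "S \<subseteq> P \<Longrightarrow> c \<in> cfgs P \<Longrightarrow> join (restr c S) (restr c (P - S)) = c"
  using join_restr[of c S "P - S"] by (simp add: Un_absorb1)

lemma restr_join_Diff:
  assumes "s \<in> cfgs S" "r \<in> cfgs (P - S)"
  shows "restr (join s r) S = s" "restr (join s r) (P - S) = r"
  using restr_join[OF assms] by auto

lemma join_eq_iff:
  assumes "s \<in> cfgs S" "s' \<in> cfgs S" "r \<in> cfgs (P - S)" "r' \<in> cfgs (P - S)"
  shows "join s r = join s' r' \<longleftrightarrow> s = s' \<and> r = r'"
  using restr_join_Diff[OF assms(1,3)] restr_join_Diff[OF assms(2,4)] by metis

text \<open>\<open>a\<close> tensored with the identity on the rest of \<open>P\<close>. It is the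
  formula of \<open>gate_op\<close> for an arbitrary region, so that gates and the observables
  conjugated by them obey one calculus.\<close>

definition lift :: "label set \<Rightarrow> label set \<Rightarrow> op \<Rightarrow> op" where
  "lift P S a = (\<lambda>c c'. if c \<in> cfgs P \<and> c' \<in> cfgs P then
     a (restr c S) (restr c' S) * (if restr c (P - S) = restr c' (P - S) then 1 else 0) else 0)"

lemma gate_op_lift: "gate_op P g = lift P (Site ` gate_sites g) (snd (snd g))"
  by (simp add: gate_op_def lift_def Let_def)

lemma op_on_lift [simp]: "op_on P (lift P S a)"
  by (auto simp: op_on_def lift_def)

lemma lift_join:
  assumes "S \<subseteq> P" "s \<in> cfgs S" "s' \<in> cfgs S" "r \<in> cfgs (P - S)" "r' \<in> cfgs (P - S)"
  shows "lift P S a (join s r) (join s' r') = a s s' * (if r = r' then 1 else 0)"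
  using assms by (simp add: lift_def join_in_cfgs_Diff restr_join_Diff)

lemma op_on_eqI_join:
  assumes "op_on P A" "op_on P B" "S \<subseteq> P"
    "\<And>s s' r r'. s \<in> cfgs S \<Longrightarrow> s' \<in> cfgs S \<Longrightarrow> r \<in> cfgs (P - S) \<Longrightarrow> r' \<in> cfgs (P - S) \<Longrightarrow>
       A (join s r) (join s' r') = B (join s r) (join s' r')"
  shows "A = B"
proof (rule op_on_eqI[OF assms(1,2)])
  fix c c' assume "c \<in> cfgs P" "c' \<in> cfgs P"
  then show "A c c' = B c c'"
    using assms(4)[of "restr c S" "restr c' S" "restr c (P - S)" "restr c' (P - S)"]
      join_restr_Diff[OF assms(3)] by simp
qed

lemma lift_mmult_left:
  assumes P: "finite P" "S \<subseteq> P" and c: "c \<in> cfgs P" "c' \<in> cfgs P"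
  shows "mmult P (lift P S a) X c c' = (\<Sum>t\<in>cfgs S. a (restr c S) t * X (join t (restr c (P - S))) c')"
proof -
  let ?s = "restr c S" and ?r = "restr c (P - S)"
  have cj: "c = join ?s ?r" using join_restr_Diff[OF P(2) c(1)] by simp
  have fin: "finite (cfgs (P - S))" using P by simp
  have "mmult P (lift P S a) X c c'
      = (\<Sum>t\<in>cfgs S. \<Sum>q\<in>cfgs (P - S). lift P S a (join ?s ?r) (join t q) * X (join t q) c')"
    using c by (simp add: mmult_def sum_cfgs_split[OF P(2)] cj[symmetric])
  also have "\<dots> = (\<Sum>t\<in>cfgs S. \<Sum>q\<in>cfgs (P - S). if q = ?r then a ?s t * X (join t q) c' else 0)"
    using P(2) by (intro sum.cong refl) (simp add: lift_join)
  also have "\<dots> = (\<Sum>t\<in>cfgs S. a ?s t * X (join t ?r) c')"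
    using fin by simp
  finally show ?thesis .
qed

lemma app_lift:
  assumes P: "finite P" "S \<subseteq> P" and c: "c \<in> cfgs P"
  shows "app P (lift P S a) v c = (\<Sum>t\<in>cfgs S. a (restr c S) t * v (join t (restr c (P - S))))"
  using lift_mmult_left[OF P c zero_in_cfgs, of a "\<lambda>x _. v x"] c
  by (simp add: mmult_def app_def)

lemma lift_mmult:
  assumes P: "finite P" "S \<subseteq> P"
  shows "mmult P (lift P S a) (lift P S b) = lift P S (mmult S a b)"
proof (rule op_on_eqI_join[OF _ _ P(2)])
  fix s s' r r' assume *: "s \<in> cfgs S" "s' \<in> cfgs S" "r \<in> cfgs (P - S)" "r' \<in> cfgs (P - S)"
  then show "mmult P (lift P S a) (lift P S b) (join s r) (join s' r')
      = lift P S (mmult S a b) (join s r) (join s' r')"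
    using P by (simp add: lift_mmult_left join_in_cfgs_Diff restr_join_Diff lift_join mmult_def[of S a b])
qed simp_all

lemma lift_ident:
  assumes "S \<subseteq> P"
  shows "lift P S (ident S) = ident P"
proof (rule op_on_eqI_join[OF _ _ assms])
  fix s s' r r' assume *: "s \<in> cfgs S" "s' \<in> cfgs S" "r \<in> cfgs (P - S)" "r' \<in> cfgs (P - S)"
  then show "lift P S (ident S) (join s r) (join s' r') = ident P (join s r) (join s' r')"
    using assms join_eq_iff[OF *(2,1,4,3)] by (auto simp: lift_join ident_def join_in_cfgs_Diff)
qed simp_all

lemma lift_adj: "lift P S (adj a) = adj (lift P S a)"
  by (intro ext) (auto simp: lift_def adj_def)

lemma unitary_lift:
  assumes "finite P" "S \<subseteq> P" "unitary S u"
  shows "unitary P (lift P S u)"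
  using assms by (simp add: unitary_def lift_adj[symmetric] lift_mmult lift_ident)

lemma lift_lift:
  assumes "S \<subseteq> S'" "S' \<subseteq> P"
  shows "lift P S' (lift S' S a) = lift P S a"
proof (intro ext)
  fix c c'
  have i: "S' \<inter> S = S" "S' \<inter> (S' - S) = S' - S" using assms by auto
  have "restr c (P - S) = restr c' (P - S) \<longleftrightarrow>
      restr c (S' - S) = restr c' (S' - S) \<and> restr c (P - S') = restr c' (P - S')"
    using assms by (auto simp: restr_def fun_eq_iff)
  then show "lift P S' (lift S' S a) c c' = lift P S a c c'"
    by (simp add: lift_def restr_restr i)
qed

text \<open>The entry is symmetric in the two regions, so commutation of operators with disjoint
  supports can be read off.\<close>

lemma lift_disjoint_product:
  assumes P: "finite P" "S \<subseteq> P" "T \<subseteq> P" "S \<inter> T = {}" and c: "c \<in> cfgs P" "c' \<in> cfgs P"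
  shows "mmult P (lift P S a) (lift P T b) c c' = a (restr c S) (restr c' S) * b (restr c T) (restr c' T)
    * (if restr c (P - S - T) = restr c' (P - S - T) then 1 else 0)"
proof -
  let ?Q = "restr c (P - S - T) = restr c' (P - S - T)"
  have "mmult P (lift P S a) (lift P T b) c c'
      = (\<Sum>t\<in>cfgs S. a (restr c S) t * lift P T b (join t (restr c (P - S))) c')"
    by (rule lift_mmult_left[OF P(1,2) c])
  also have "\<dots> = (\<Sum>t\<in>cfgs S. if t = restr c' S then
      a (restr c S) (restr c' S) * b (restr c T) (restr c' T) * (if ?Q then 1 else 0) else 0)"
  proof (rule sum.cong[OF refl])
    fix t assume t: "t \<in> cfgs S"
    have 1: "restr (join t (restr c (P - S))) T = restr c T"
      using t P by (auto simp: restr_def join_def cfgs_def fun_eq_iff)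
    have 2: "restr (join t (restr c (P - S))) (P - T) = restr c' (P - T) \<longleftrightarrow> t = restr c' S \<and> ?Q"
      using t P by (auto simp: restr_def join_def cfgs_def fun_eq_iff) blast+
    show "a (restr c S) t * lift P T b (join t (restr c (P - S))) c' = (if t = restr c' S then
      a (restr c S) (restr c' S) * b (restr c T) (restr c' T) * (if ?Q then 1 else 0) else 0)"
      using t c P(2) by (simp add: lift_def join_in_cfgs_Diff 1 2)
  qed
  also have "\<dots> = a (restr c S) (restr c' S) * b (restr c T) (restr c' T) * (if ?Q then 1 else 0)"
    using P by (simp add: finite_subset)
  finally show ?thesis .
qed

lemma lift_commute:
  assumes "finite P" "S \<subseteq> P" "T \<subseteq> P" "S \<inter> T = {}"
  shows "mmult P (lift P S a) (lift P T b) = mmult P (lift P T b) (lift P S a)"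
proof (rule op_on_eqI[of P])
  fix c c' assume c: "c \<in> cfgs P" "c' \<in> cfgs P"
  have "T \<inter> S = {}" "P - T - S = P - S - T" using assms by auto
  then show "mmult P (lift P S a) (lift P T b) c c' = mmult P (lift P T b) (lift P S a) c c'"
    using lift_disjoint_product[OF assms c] lift_disjoint_product[OF assms(1,3,2) _ c] by simp
qed simp_all

text \<open>Duality of lifting and partial trace: a global expectation of a local operator depends
  only on the reduced operator of its region.\<close>

lemma tr_lift:
  assumes P: "finite P" "S \<subseteq> P"
  shows "tr P (mmult P (lift P S w) X) = tr S (mmult S w (ptrace S (P - S) X))"
proof -
  have "tr P (mmult P (lift P S w) X)
      = (\<Sum>s\<in>cfgs S. \<Sum>r\<in>cfgs (P - S). \<Sum>t\<in>cfgs S. w s t * X (join t r) (join s r))"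
    unfolding tr_def sum_cfgs_split[OF P(2)]
    using P by (intro sum.cong refl) (simp add: lift_mmult_left join_in_cfgs_Diff restr_join_Diff)
  also have "\<dots> = (\<Sum>s\<in>cfgs S. \<Sum>t\<in>cfgs S. \<Sum>r\<in>cfgs (P - S). w s t * X (join t r) (join s r))"
    by (intro sum.cong refl sum.swap)
  also have "\<dots> = tr S (mmult S w (ptrace S (P - S) X))"
    by (simp add: tr_def mmult_def ptrace_def sum_distrib_left)
  finally show ?thesis .
qed

section \<open>Heisenberg evolution through a circuit\<close>

definition supported_unitary :: "label set \<Rightarrow> label set \<Rightarrow> op \<Rightarrow> bool" where
  "supported_unitary P S W \<longleftrightarrow> (\<exists>w. unitary S w \<and> W = lift P S w)"

definition conj_by :: "label set \<Rightarrow> op \<Rightarrow> op \<Rightarrow> op" where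
  "conj_by P L W = mmult P (mmult P L W) (adj L)"

lemma supported_unitary_mono:
  assumes "finite P" "S \<subseteq> S'" "S' \<subseteq> P" "supported_unitary P S W"
  shows "supported_unitary P S' W"
proof -
  obtain w where w: "unitary S w" "W = lift P S w"
    using assms unfolding supported_unitary_def by blast
  have "finite S'" using assms finite_subset by blast
  then have "unitary S' (lift S' S w)" "W = lift P S' (lift S' S w)"
    using assms w by (auto simp: unitary_lift lift_lift)
  then show ?thesis unfolding supported_unitary_def by blast
qed

lemma supported_unitary_conj:
  assumes P: "finite P" "S \<subseteq> P" and L: "supported_unitary P S L" and W: "supported_unitary P S W"
  shows "supported_unitary P S (conj_by P L W)"
proof -
  obtain l w where lw: "unitary S l" "L = lift P S l" "unitary S w" "W = lift P S w"
    using L W unfolding supported_unitary_def by blast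
  have fS: "finite S" using P finite_subset by blast
  have "conj_by P L W = lift P S (mmult S (mmult S l w) (adj l))"
    using P lw by (simp add: conj_by_def lift_adj[symmetric] lift_mmult)
  moreover have "unitary S (mmult S (mmult S l w) (adj l))"
    using lw fS by (simp add: unitary_mmult unitary_adj)
  ultimately show ?thesis unfolding supported_unitary_def by blast
qed

lemma conj_by_mmult: "conj_by P (mmult P A B) W = conj_by P A (conj_by P B W)"
  by (simp add: conj_by_def adj_mmult mmult_assoc)

lemma conj_by_ident: "finite P \<Longrightarrow> op_on P W \<Longrightarrow> conj_by P (ident P) W = W"
  by (simp add: conj_by_def mmult_ident_left mmult_ident_right)

lemma conj_by_disjoint:
  assumes P: "finite P" "S \<subseteq> P" "T \<subseteq> P" "S \<inter> T = {}"
    and W: "supported_unitary P S W" and u: "unitary T u"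
  shows "conj_by P (lift P T u) W = W"
proof -
  obtain w where w: "W = lift P S w" using W unfolding supported_unitary_def by blast
  have "conj_by P (lift P T u) W = mmult P (mmult P W (lift P T u)) (adj (lift P T u))"
    using lift_commute[OF P] by (simp add: conj_by_def w)
  also have "\<dots> = mmult P W (ident P)"
    using P u by (simp add: mmult_assoc unitary_adj_right unitary_lift)
  also have "\<dots> = W" using P w by (simp add: mmult_ident_right)
  finally show ?thesis .
qed

lemma valid_layer_Cons:
  assumes "valid_layer Ls (g # gs)"
  shows "valid_layer Ls gs" "valid_gate Ls g"
    "\<And>h. h \<in> set gs \<Longrightarrow> gate_sites g \<inter> gate_sites h = {}"
proof -
  have d: "gate_sites ((g # gs) ! i) \<inter> gate_sites ((g # gs) ! j) = {}"
    if "i < j" "j < length (g # gs)" for i j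
    using assms that unfolding valid_layer_def by blast
  show "valid_gate Ls g" using assms by (simp add: valid_layer_def)
  have "gate_sites (gs ! i) \<inter> gate_sites (gs ! j) = {}" if "i < j" "j < length gs" for i j
    using d[of "Suc i" "Suc j"] that by simp
  then show "valid_layer Ls gs" using assms by (simp add: valid_layer_def)
  fix h assume "h \<in> set gs"
  then obtain i where "i < length gs" "h = gs ! i" by (metis in_set_conv_nth)
  then show "gate_sites g \<inter> gate_sites h = {}" using d[of 0 "Suc i"] by simp
qed

lemma valid_gate_sites: "valid_gate Ls g \<Longrightarrow> gate_sites g \<subseteq> box Ls"
  by (auto simp: valid_gate_def gate_sites_def)

lemma supported_unitary_op_on: "supported_unitary P S W \<Longrightarrow> op_on P W"
  by (auto simp: supported_unitary_def)

text \<open>A gate that misses \<open>A\<close> also misses the other gates of its layer, hence the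
  whole support accumulated so far, and cancels against its adjoint. Only gates that touch
  \<open>A\<close> itself enlarge the support: within one layer growth does not propagate.\<close>

lemma layer_conj_support:
  assumes P: "finite (phys Ls)" and A: "A \<subseteq> box Ls" and W: "supported_unitary (phys Ls) (Site ` A) W"
  shows "valid_layer Ls gs \<Longrightarrow>
    supported_unitary (phys Ls)
      (Site ` (A \<union> (\<Union>g\<in>{g \<in> set gs. gate_sites g \<inter> A \<noteq> {}}. gate_sites g)))
      (conj_by (phys Ls) (layer_op (phys Ls) gs) W)"
proof (induction gs)
  case Nil
  then show ?case
    using W P by (simp add: layer_op_def conj_by_ident supported_unitary_op_on)
next
  case (Cons g gs)
  let ?P = "phys Ls"
  let ?B = "\<lambda>gs. A \<union> (\<Union>g\<in>{g \<in> set gs. gate_sites g \<inter> A \<noteq> {}}. gate_sites g)"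
  note v = valid_layer_Cons[OF Cons.prems]
  define X where "X = conj_by ?P (layer_op ?P gs) W"
  have X: "supported_unitary ?P (Site ` ?B gs) X" unfolding X_def by (rule Cons.IH[OF v(1)])
  have "gate_sites h \<subseteq> box Ls" if "h \<in> set (g # gs)" for h
    using Cons.prems that by (intro valid_gate_sites) (auto simp: valid_layer_def)
  then have "?B gs \<subseteq> box Ls" "?B (g # gs) \<subseteq> box Ls" "gate_sites g \<subseteq> box Ls"
    using A by fastforce+
  then have sub: "Site ` ?B gs \<subseteq> ?P" "Site ` ?B (g # gs) \<subseteq> ?P" "Site ` gate_sites g \<subseteq> ?P"
    unfolding phys_def by (simp_all only: image_mono)
  have u: "unitary (Site ` gate_sites g) (snd (snd g))" using v(2) by (simp add: valid_gate_def)
  have eq: "conj_by ?P (layer_op ?P (g # gs)) W = conj_by ?P (lift ?P (Site ` gate_sites g) (snd (snd g))) X"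
    by (simp add: layer_op_def conj_by_mmult X_def gate_op_lift)
  show ?case
  proof (cases "gate_sites g \<inter> A = {}")
    case True
    then have "gate_sites g \<inter> ?B gs = {}"
      using v(3) by (simp add: Int_Un_distrib Int_UN_distrib)
    then have "Site ` ?B gs \<inter> Site ` gate_sites g = {}" by auto
    then have "conj_by ?P (layer_op ?P (g # gs)) W = X"
      unfolding eq using conj_by_disjoint[OF P sub(1,3) _ X u] by blast
    moreover have "?B (g # gs) = ?B gs" using True by auto
    ultimately show ?thesis using X by simp
  next
    case False
    then have "?B gs \<subseteq> ?B (g # gs)" "gate_sites g \<subseteq> ?B (g # gs)" by auto
    then have s: "Site ` ?B gs \<subseteq> Site ` ?B (g # gs)" "Site ` gate_sites g \<subseteq> Site ` ?B (g # gs)"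
      by (simp_all only: image_mono)
    have "supported_unitary ?P (Site ` gate_sites g) (lift ?P (Site ` gate_sites g) (snd (snd g)))"
      using u by (auto simp: supported_unitary_def)
    then show ?thesis
      unfolding eq
      using supported_unitary_conj[OF P sub(2)] supported_unitary_mono[OF P s(1) sub(2) X]
        supported_unitary_mono[OF P s(2) sub(2)] by blast
  qed
qed

definition circuit_op :: "label set \<Rightarrow> gate list list \<Rightarrow> op" where
  "circuit_op P cs = fold (\<lambda>gs M. mmult P (layer_op P gs) M) cs (ident P)"

lemma vec_on_zero_state [simp]: "vec_on S zero_state"
  by (auto simp: vec_on_def zero_state_def)

lemma run_circuit_eq:
  assumes "finite P"
  shows "run_circuit P cs = app P (circuit_op P cs) zero_state"
  by (induction cs rule: rev_induct)
    (use assms in \<open>simp_all add: run_circuit_def circuit_op_def app_ident app_mmult\<close>)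

text \<open>The first layer is the innermost conjugation, so the support grows in the order of
  execution.\<close>

lemma conj_by_circuit:
  assumes "finite P" "op_on P W"
  shows "conj_by P (circuit_op P cs) W = fold (\<lambda>gs X. conj_by P (layer_op P gs) X) cs W"
  by (induction cs rule: rev_induct)
    (use assms in \<open>simp_all add: circuit_op_def conj_by_ident conj_by_mmult\<close>)

lemma unitary_layer_op:
  assumes "finite (phys Ls)"
  shows "valid_layer Ls gs \<Longrightarrow> unitary (phys Ls) (layer_op (phys Ls) gs)"
proof (induction gs)
  case Nil
  then show ?case using assms by (simp add: layer_op_def)
next
  case (Cons g gs)
  note v = valid_layer_Cons[OF Cons.prems]
  have "Site ` gate_sites g \<subseteq> phys Ls" using valid_gate_sites[OF v(2)] by (auto simp: phys_def)
  then have "unitary (phys Ls) (gate_op (phys Ls) g)"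
    using assms v(2) by (simp add: gate_op_lift unitary_lift valid_gate_def)
  then show ?case using Cons.IH[OF v(1)] assms by (simp add: layer_op_def unitary_mmult)
qed

lemma unitary_circuit_op:
  assumes "finite (phys Ls)"
  shows "\<forall>gs\<in>set cs. valid_layer Ls gs \<Longrightarrow> unitary (phys Ls) (circuit_op (phys Ls) cs)"
  by (induction cs rule: rev_induct)
    (use assms in \<open>simp_all add: circuit_op_def unitary_mmult unitary_layer_op\<close>)

section \<open>The lattice\<close>

text \<open>The bounds vary with the coordinate: the lattice, and every cube cut off at its
  boundary, have this form, and a single connectivity argument covers them.\<close>

definition rect :: "nat \<Rightarrow> (nat \<Rightarrow> int) \<Rightarrow> (nat \<Rightarrow> int) \<Rightarrow> int list set" where
  "rect D lo hi = {x. length x = D \<and> (\<forall>i<D. lo i \<le> x ! i \<and> x ! i < hi i)}"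

lemma ladj_step:
  assumes "i < length x" "\<bar>e\<bar> = 1"
  shows "ladj x (x[i := x ! i + e])"
proof -
  have "(\<Sum>j<length x. \<bar>x ! j - x[i := x ! i + e] ! j\<bar>) = (\<Sum>j<length x. if j = i then 1 else 0)"
    using assms by (intro sum.cong) (auto simp: nth_list_update)
  then show ?thesis using assms by (simp add: ladj_def)
qed

lemma ladj_sym: "ladj x y \<Longrightarrow> ladj y x"
  by (auto simp: ladj_def abs_minus_commute)

text \<open>Walk towards \<open>y\<close> by correcting one coordinate by one unit: the new value
  lies between two admissible ones, and the l1 distance drops by one.\<close>

lemma rect_path:
  assumes y: "y \<in> rect D lo hi"
  shows "x \<in> rect D lo hi \<Longrightarrow>
    (x, y) \<in> {(a, b). a \<in> rect D lo hi \<and> b \<in> rect D lo hi \<and> ladj a b}\<^sup>*"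
proof (induction "nat (\<Sum>i<D. \<bar>x ! i - y ! i\<bar>)" arbitrary: x rule: less_induct)
  case less
  show ?case
  proof (cases "x = y")
    case True
    then show ?thesis by simp
  next
    case False
    have lx: "length x = D" "length y = D" using less.prems y by (auto simp: rect_def)
    then obtain i where i: "i < D" "x ! i \<noteq> y ! i" using False by (metis nth_equalityI)
    define e where "e = sgn (y ! i - x ! i)"
    have e1: "\<bar>e\<bar> = 1" and e2: "\<bar>x ! i + e - y ! i\<bar> = \<bar>x ! i - y ! i\<bar> - 1"
      using i by (auto simp: e_def sgn_if)
    define x' where "x' = x[i := x ! i + e]"
    have xi: "lo i \<le> x ! i" "x ! i < hi i" "lo i \<le> y ! i" "y ! i < hi i"
      using less.prems y i by (auto simp: rect_def)
    have x': "x' \<in> rect D lo hi"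
    proof -
      have "lo i \<le> x ! i + e \<and> x ! i + e < hi i" using xi i by (auto simp: e_def sgn_if)
      then show ?thesis using less.prems i by (auto simp: rect_def x'_def nth_list_update)
    qed
    have "(\<Sum>j<D. \<bar>x' ! j - y ! j\<bar>) = (\<Sum>j<D. \<bar>x ! j - y ! j\<bar> - (if j = i then 1 else 0))"
      using i lx e2 by (intro sum.cong) (auto simp: x'_def nth_list_update)
    also have "\<dots> = (\<Sum>j<D. \<bar>x ! j - y ! j\<bar>) - 1" using i by (simp add: sum_subtractf)
    finally have s: "(\<Sum>j<D. \<bar>x' ! j - y ! j\<bar>) = (\<Sum>j<D. \<bar>x ! j - y ! j\<bar>) - 1" .
    have "0 \<le> (\<Sum>j<D. \<bar>x' ! j - y ! j\<bar>)" by (simp add: sum_nonneg)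
    then have "(x', y) \<in> {(a, b). a \<in> rect D lo hi \<and> b \<in> rect D lo hi \<and> ladj a b}\<^sup>*"
      using s by (intro less.hyps x') linarith
    moreover have "(x, x') \<in> {(a, b). a \<in> rect D lo hi \<and> b \<in> rect D lo hi \<and> ladj a b}"
      using less.prems x' ladj_step[of i x e] i lx e1 by (simp add: x'_def)
    ultimately show ?thesis by (rule converse_rtrancl_into_rtrancl[rotated])
  qed
qed

lemma lconnected_rect: "rect D lo hi \<noteq> {} \<Longrightarrow> lconnected (rect D lo hi)"
  unfolding lconnected_def using rect_path by blast

lemma box_eq_rect: "box Ls = rect (length Ls) (\<lambda>_. 0) (\<lambda>i. int (Ls ! i))"
  by (simp add: box_def rect_def)

lemma cube_Int_box_eq_rect:
  "cube (length Ls) a s \<inter> box Ls = rect (length Ls) (\<lambda>i. max 0 (a ! i)) (\<lambda>i. min (int (Ls ! i)) (a ! i + int s))"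
  by (auto simp: box_def rect_def cube_def)

section \<open>Site counts, neighbourhoods of cubes and growth of connected regions\<close>

lemma card_cube:
  assumes "length a = D"
  shows "finite (cube D a s)" "card (cube D a s) \<le> s ^ D"
proof -
  let ?X = "{xs. set xs \<subseteq> {0..<int s} \<and> length xs = D}"
  have sub: "cube D a s \<subseteq> (\<lambda>xs. map2 (+) a xs) ` ?X"
  proof
    fix x assume x: "x \<in> cube D a s"
    let ?y = "map2 (-) x a"
    have "x = map2 (+) a ?y" using x assms by (intro nth_equalityI) (auto simp: cube_def)
    moreover have "?y \<in> ?X" using x assms by (auto simp: cube_def in_set_conv_nth diff_less_eq add.commute)
    ultimately show "x \<in> (\<lambda>xs. map2 (+) a xs) ` ?X" by blast
  qed
  have fin: "finite ?X" by (rule finite_lists_length_eq) simp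
  show "finite (cube D a s)" using sub fin finite_surj by blast
  have "card (cube D a s) \<le> card ?X" using surj_card_le[OF fin sub] .
  also have "\<dots> = s ^ D" by (subst card_lists_length_eq) auto
  finally show "card (cube D a s) \<le> s ^ D" .
qed

lemma finite_box [simp]: "finite (box Ls)"
proof -
  let ?X = "{xs. set xs \<subseteq> {0..<int (sum_list Ls)} \<and> length xs = length Ls}"
  have "box Ls \<subseteq> ?X"
  proof
    fix x assume x: "x \<in> box Ls"
    have "int (Ls ! i) \<le> int (sum_list Ls)" if "i < length Ls" for i
      using member_le_sum_list[of "Ls ! i" Ls] that by simp
    then show "x \<in> ?X" using x by (fastforce simp: box_def in_set_conv_nth)
  qed
  then show ?thesis using finite_lists_length_eq[of "{0..<int (sum_list Ls)}"] finite_subset by blast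
qed

lemma finite_phys [simp]: "finite (phys Ls)"
  by (simp add: phys_def)

text \<open>A neighbour differs by at most one in each coordinate. One layer therefore costs a
  margin of one on both sides, which is the 2 in the side length \<open>s + 2 * t\<close> of a light
  cone.\<close>

lemma ladj_cube:
  assumes "length a = D" "y \<in> cube D a s" "ladj x y"
  shows "x \<in> cube D (map (\<lambda>z. z - 1) a) (s + 2)"
proof -
  have l: "length x = D" using assms by (simp add: ladj_def cube_def)
  have "\<bar>x ! i - y ! i\<bar> \<le> 1" if "i < D" for i
  proof -
    have "\<bar>x ! i - y ! i\<bar> \<le> (\<Sum>i<length x. \<bar>x ! i - y ! i\<bar>)"
      using that l by (intro member_le_sum) auto
    then show ?thesis using assms by (auto simp: ladj_def)
  qed
  moreover have "a ! i \<le> y ! i \<and> y ! i < a ! i + int s" if "i < D" for i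
    using assms that by (simp add: cube_def)
  ultimately show ?thesis using l assms(1) by (fastforce simp: cube_def)
qed

lemma lconnected_insert:
  assumes S: "lconnected S" and u: "u \<in> S" "ladj u v"
  shows "lconnected (insert v S)"
proof -
  let ?R = "\<lambda>S. {(a, b). a \<in> S \<and> b \<in> S \<and> ladj a b}"
  have mono: "(?R S)\<^sup>* \<subseteq> (?R (insert v S))\<^sup>*" by (rule rtrancl_mono) auto
  have in_S: "(x, y) \<in> (?R (insert v S))\<^sup>*" if "x \<in> S" "y \<in> S" for x y
    using S that mono unfolding lconnected_def by blast
  have e: "(u, v) \<in> ?R (insert v S)" "(v, u) \<in> ?R (insert v S)" using u ladj_sym by auto
  have to: "(x, v) \<in> (?R (insert v S))\<^sup>*" if "x \<in> S" for x
    using in_S[OF that u(1)] e(1) by (rule rtrancl_into_rtrancl)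
  have fr: "(v, x) \<in> (?R (insert v S))\<^sup>*" if "x \<in> S" for x
    using e(2) in_S[OF u(1) that] by (rule converse_rtrancl_into_rtrancl)
  show ?thesis unfolding lconnected_def using in_S to fr by blast
qed

text \<open>A path inside \<open>B\<close> from a point of \<open>S\<close> to a point outside must
  leave \<open>S\<close> along some edge.\<close>

lemma lconnected_boundary_edge:
  assumes B: "lconnected B" and S: "S \<subseteq> B" "S \<noteq> {}" "S \<noteq> B"
  shows "\<exists>u\<in>S. \<exists>v\<in>B - S. ladj u v"
proof -
  obtain x y where x: "x \<in> S" and y: "y \<in> B - S" using S by blast
  have "(x, y) \<in> {(a, b). a \<in> B \<and> b \<in> B \<and> ladj a b}\<^sup>*"
    using B x y S unfolding lconnected_def by blast
  then have "y \<in> S \<or> (\<exists>u\<in>S. \<exists>v\<in>B - S. ladj u v)"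
    by (induction rule: rtrancl_induct) (use x in auto)
  then show ?thesis using y by blast
qed

text \<open>Light cones have at most \<open>d\<close> sites, while \<open>max_eps_tilde\<close>
  speaks of regions with exactly \<open>d\<close>; adding sites across boundary edges fills the
  gap.\<close>

lemma lconnected_extend:
  assumes B: "finite B" "lconnected B" and S: "S \<subseteq> B" "lconnected S" and m: "card S \<le> m"
  shows "m \<le> card B \<Longrightarrow> \<exists>S'. S \<subseteq> S' \<and> S' \<subseteq> B \<and> lconnected S' \<and> card S' = m"
  using m
proof (induction rule: dec_induct)
  case base
  then show ?case using S by blast
next
  case (step m)
  then obtain S' where S': "S \<subseteq> S'" "S' \<subseteq> B" "lconnected S'" "card S' = m" by auto
  have "S' \<noteq> B" using S' step by auto
  then obtain u v where uv: "u \<in> S'" "v \<in> B - S'" "ladj u v"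
    using lconnected_boundary_edge[OF B(2) S'(2)] S'(3) unfolding lconnected_def by blast
  then have "lconnected (insert v S')" using lconnected_insert S'(3) by blast
  moreover have "card (insert v S') = Suc m"
    using S' uv B finite_subset by (metis Diff_iff card_insert_disjoint)
  ultimately show ?case using S' uv by (intro exI[of _ "insert v S'"]) auto
qed

section \<open>An entropy bound for almost deterministic cells\<close>

text \<open>The comparison distribution on one cell: mass \<open>1 - p\<close> on the zero
  configuration and mass \<open>p\<close> spread evenly over the \<open>2 ^ t - 1\<close> others of
  a full cell. This spread is the origin of the logarithm of \<open>2 ^ t - 1\<close>; on a cell
  with fewer sites the total mass is at most 1.\<close>

definition cell_weight :: "real \<Rightarrow> nat \<Rightarrow> cfg \<Rightarrow> real" where
  "cell_weight p t x = (if x = (\<lambda>_. False) then 1 - p else p / (2 ^ t - 1))"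

lemma sum_cell_weight:
  assumes B: "finite B" "card B \<le> t" and t: "1 \<le> t" and p: "0 \<le> p"
  shows "(\<Sum>x\<in>cfgs B. cell_weight p t x) \<le> 1"
proof -
  let ?z = "\<lambda>_. False"
  have t2: "(2::real) \<le> 2 ^ t" using power_increasing[OF t, of "2::real"] by simp
  have N: "real (card (cfgs B)) \<le> 2 ^ t" using B by (simp add: card_cfgs power_increasing)
  have N1: "1 \<le> real (card (cfgs B))" using B by (simp add: card_cfgs)
  have "(\<Sum>x\<in>cfgs B. cell_weight p t x) = cell_weight p t ?z + (\<Sum>x\<in>cfgs B - {?z}. cell_weight p t x)"
    using B by (simp add: sum.remove)
  also have "(\<Sum>x\<in>cfgs B - {?z}. cell_weight p t x) = (\<Sum>x\<in>cfgs B - {?z}. p / (2 ^ t - 1))"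
    by (intro sum.cong) (auto simp: cell_weight_def)
  also have "\<dots> = (real (card (cfgs B)) - 1) * (p / (2 ^ t - 1))"
    using B N1 by (simp add: card_Diff_singleton of_nat_diff)
  also have "cell_weight p t ?z + \<dots> \<le> cell_weight p t ?z + (2 ^ t - 1) * (p / (2 ^ t - 1))"
    using N t2 p by (intro add_left_mono mult_right_mono) auto
  also have "\<dots> = 1" using t2 by (simp add: cell_weight_def)
  finally show ?thesis .
qed

lemma sum_product_weight:
  fixes m n :: nat
  assumes fin: "\<And>i. i < m \<Longrightarrow> finite (B i)"
    and disj: "\<And>i j. i < j \<Longrightarrow> j < m \<Longrightarrow> B i \<inter> B j = {}"
    and w0: "\<And>x. 0 \<le> w x" and w: "\<And>i. i < m \<Longrightarrow> (\<Sum>x\<in>cfgs (B i). w x) \<le> (1::real)"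
  shows "n \<le> m \<Longrightarrow> (\<Sum>c\<in>cfgs (\<Union>i<n. B i). \<Prod>i<n. w (restr c (B i))) \<le> 1"
proof (induction n)
  case 0
  have "cfgs {} = {\<lambda>_. False}" by (auto simp: cfgs_def)
  then show ?case by simp
next
  case (Suc n)
  let ?U = "\<Union>i<n. B i"
  have d: "?U \<inter> B n = {}" using disj Suc.prems by fastforce
  have "(\<Sum>c\<in>cfgs (\<Union>i<Suc n. B i). \<Prod>i<Suc n. w (restr c (B i)))
      = (\<Sum>c\<in>cfgs (?U \<union> B n). \<Prod>i<Suc n. w (restr c (B i)))"
    by (simp add: lessThan_Suc Un_commute)
  also have "\<dots> = (\<Sum>s\<in>cfgs ?U. \<Sum>t\<in>cfgs (B n). \<Prod>i<Suc n. w (restr (join s t) (B i)))"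
    by (rule sum_cfgs_Un[OF d])
  also have "\<dots> = (\<Sum>s\<in>cfgs ?U. \<Sum>t\<in>cfgs (B n). (\<Prod>i<n. w (restr s (B i))) * w t)"
  proof (intro sum.cong refl)
    fix s t assume st: "s \<in> cfgs ?U" "t \<in> cfgs (B n)"
    have "restr (join s t) (B i) = restr s (B i)" if "i < n" for i
      using st(2) disj[of i n] that Suc.prems
      by (auto simp: restr_def join_def cfgs_def fun_eq_iff)
    then show "(\<Prod>i<Suc n. w (restr (join s t) (B i))) = (\<Prod>i<n. w (restr s (B i))) * w t"
      using restr_join(2)[OF st d] by simp
  qed
  also have "\<dots> = (\<Sum>s\<in>cfgs ?U. \<Prod>i<n. w (restr s (B i))) * (\<Sum>t\<in>cfgs (B n). w t)"
    by (simp add: sum_product)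
  also have "\<dots> \<le> 1 * 1"
    using Suc w w0 by (intro mult_mono) (auto intro!: sum_nonneg prod_nonneg)
  finally show ?case by simp
qed

text \<open>Since \<open>q\<close> is at most 2^-k everywhere, k is a lower bound for its entropy,
  and Gibbs' inequality against the product R of the cell weights bounds the entropy from above.
  Both enter in the pointwise form q ln(2^k R) <= R - q. Minus the logarithm of a cell weight takes
  only two values, so the cross entropy depends on nothing but the probabilities of nonzero
  cells.\<close>

lemma entropy_cell_bound:
  fixes q :: "cfg \<Rightarrow> real"
  assumes P: "finite P" "(\<Union>i<m. B i) = P"
    and disj: "\<And>i j. i < j \<Longrightarrow> j < m \<Longrightarrow> B i \<inter> B j = {}"
    and card: "\<And>i. i < m \<Longrightarrow> card (B i) \<le> t" and t: "1 \<le> t"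
    and q0: "\<And>c. c \<in> cfgs P \<Longrightarrow> 0 \<le> q c" and qk: "\<And>c. c \<in> cfgs P \<Longrightarrow> q c \<le> 1 / 2 ^ k"
    and q1: "(\<Sum>c\<in>cfgs P. q c) = 1"
    and p: "0 < p" "p < 1 / 2"
    and pB: "\<And>i. i < m \<Longrightarrow> (\<Sum>c\<in>cfgs P. if restr c (B i) = (\<lambda>_. False) then 0 else q c) \<le> p"
  shows "real k \<le> real m * H2 p + real m * log 2 (2 ^ t - 1) * p"
proof -
  let ?z = "\<lambda>_. False" and ?w = "cell_weight p t"
  define T where "T = (2::real) ^ t - 1"
  have T: "1 \<le> T" using power_increasing[OF t, of "2::real"] by (simp add: T_def)
  define L0 L1 where "L0 = - ln (1 - p)" and "L1 = ln T - ln p"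
  \<comment> \<open>Nonzero configurations cost more because \<open>p < 1 / 2\<close>; a larger
    probability of a nonzero cell can then only raise the bound, and this probability may be
    replaced by \<open>p\<close>.\<close>
  have L: "L0 \<le> L1"
  proof -
    have "ln p \<le> ln (1 - p)" using p by simp
    moreover have "0 \<le> ln T" using T by simp
    ultimately show ?thesis by (simp add: L0_def L1_def)
  qed
  have wpos: "0 < ?w x" for x using p T by (simp add: cell_weight_def T_def[symmetric])
  have lnw: "- ln (?w x) = (if x = ?z then L0 else L1)" for x
    using p T by (simp add: cell_weight_def T_def[symmetric] L0_def L1_def ln_div)
  have fin: "finite (B i)" if "i < m" for i using P that by (auto intro: finite_subset)
  define R where "R = (\<lambda>c. \<Prod>i<m. ?w (restr c (B i)))"
  have Rpos: "0 < R c" for c unfolding R_def using wpos by (intro prod_pos) auto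
  have R1: "(\<Sum>c\<in>cfgs P. R c) \<le> 1"
    unfolding R_def P(2)[symmetric] using p t
    by (intro sum_product_weight[of m B, OF fin disj _ sum_cell_weight])
      (auto simp: fin card t intro: less_imp_le[OF wpos])
  have pt: "q c * (real k * ln 2 + ln (R c)) \<le> R c - q c" if c: "c \<in> cfgs P" for c
  proof (cases "q c = 0")
    case True
    then show ?thesis using Rpos[of c] by simp
  next
    case False
    then have qp: "0 < q c" using q0[OF c] by simp
    have "ln (q c) \<le> ln (1 / 2 ^ k)" using qp qk[OF c] by simp
    then have "real k * ln 2 + ln (R c) \<le> ln (R c) - ln (q c)" by (simp add: ln_div ln_realpow)
    also have "\<dots> = ln (R c / q c)" using qp Rpos[of c] by (simp add: ln_div)
    also have "\<dots> \<le> R c / q c - 1" using qp Rpos[of c] by (intro ln_le_minus_one) simp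
    finally have "q c * (real k * ln 2 + ln (R c)) \<le> q c * (R c / q c - 1)"
      using qp by (intro mult_left_mono) auto
    also have "\<dots> = R c - q c" using qp by (simp add: field_simps)
    finally show ?thesis .
  qed
  have "(\<Sum>c\<in>cfgs P. q c * (real k * ln 2 + ln (R c))) \<le> (\<Sum>c\<in>cfgs P. R c - q c)"
    by (intro sum_mono pt)
  also have "\<dots> \<le> 0" using R1 q1 by (simp add: sum_subtractf)
  finally have "real k * ln 2 * (\<Sum>c\<in>cfgs P. q c) \<le> (\<Sum>c\<in>cfgs P. q c * (- ln (R c)))"
    by (simp add: ring_distribs sum.distrib sum_distrib_left sum_distrib_right sum_negf mult_ac)
  also have "(\<Sum>c\<in>cfgs P. q c * (- ln (R c)))
      = (\<Sum>c\<in>cfgs P. \<Sum>i<m. q c * (if restr c (B i) = ?z then L0 else L1))"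
  proof (intro sum.cong refl)
    fix c
    have "- ln (R c) = (\<Sum>i<m. - ln (?w (restr c (B i))))"
      unfolding R_def using wpos by (subst ln_prod) (auto simp: sum_negf less_imp_neq[THEN not_sym])
    then show "q c * (- ln (R c)) = (\<Sum>i<m. q c * (if restr c (B i) = ?z then L0 else L1))"
      by (simp only: lnw sum_distrib_left)
  qed
  also have "\<dots> = (\<Sum>i<m. \<Sum>c\<in>cfgs P. q c * (if restr c (B i) = ?z then L0 else L1))"
    by (rule sum.swap)
  also have "\<dots> \<le> (\<Sum>i<m. L0 + (L1 - L0) * p)"
  proof (intro sum_mono)
    fix i assume "i \<in> {..<m}"
    then have i: "i < m" by simp
    have "(\<Sum>c\<in>cfgs P. q c * (if restr c (B i) = ?z then L0 else L1))
        = (\<Sum>c\<in>cfgs P. L0 * q c + (L1 - L0) * (if restr c (B i) = ?z then 0 else q c))"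
      by (intro sum.cong) (auto simp: algebra_simps)
    also have "\<dots> = L0 * 1 + (L1 - L0) * (\<Sum>c\<in>cfgs P. if restr c (B i) = ?z then 0 else q c)"
      by (simp only: sum.distrib sum_distrib_left[symmetric] q1)
    also have "\<dots> \<le> L0 + (L1 - L0) * p"
      using pB[OF i] L by (simp add: mult_left_mono)
    finally show "(\<Sum>c\<in>cfgs P. q c * (if restr c (B i) = ?z then L0 else L1)) \<le> L0 + (L1 - L0) * p" .
  qed
  finally have main: "real k * ln 2 \<le> real m * (L0 + (L1 - L0) * p)" by (simp add: q1)
  \<comment> \<open>The expected cost (1 - p) L0 + p L1 is the binary entropy plus p ln T in natural
    units.\<close>
  have "real m * (L0 + (L1 - L0) * p) = (real m * H2 p + real m * log 2 (2 ^ t - 1) * p) * ln 2"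
    unfolding H2_def log_def L0_def L1_def T_def[symmetric] by (simp add: field_simps)
  with main show ?thesis by (simp add: mult_le_cancel_right)
qed

section \<open>Every state is prepared by some local circuit\<close>

definition reaches :: "nat list \<Rightarrow> vec \<Rightarrow> vec \<Rightarrow> bool" where
  "reaches Ls u v \<longleftrightarrow> (\<exists>cs. (\<forall>gs\<in>set cs. valid_layer Ls gs) \<and>
     v = app (phys Ls) (circuit_op (phys Ls) cs) u)"

text \<open>The circuit may depend on the vector. For preparing a single state this is enough, and
  maps compose without being written as operators.\<close>

definition implementable :: "nat list \<Rightarrow> (vec \<Rightarrow> vec) \<Rightarrow> bool" where
  "implementable Ls F \<longleftrightarrow> (\<forall>v. vec_on (phys Ls) v \<longrightarrow> reaches Ls v (F v))"

lemma reaches_vec_on: "reaches Ls u v \<Longrightarrow> vec_on (phys Ls) v"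
  by (auto simp: reaches_def)

lemma app_circuit_op_append:
  "app (phys Ls) (circuit_op (phys Ls) (cs @ ds)) u
   = app (phys Ls) (circuit_op (phys Ls) ds) (app (phys Ls) (circuit_op (phys Ls) cs) u)"
proof (induction ds rule: rev_induct)
  case Nil
  then show ?case by (simp add: circuit_op_def app_ident)
next
  case (snoc g ds)
  then show ?case by (simp add: circuit_op_def app_mmult)
qed

lemma reaches_trans: "reaches Ls u v \<Longrightarrow> reaches Ls v w \<Longrightarrow> reaches Ls u w"
  unfolding reaches_def
proof (elim exE conjE)
  fix cs ds
  assume "\<forall>gs\<in>set cs. valid_layer Ls gs" "v = app (phys Ls) (circuit_op (phys Ls) cs) u"
    "\<forall>gs\<in>set ds. valid_layer Ls gs" "w = app (phys Ls) (circuit_op (phys Ls) ds) v"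
  then show "\<exists>cs. (\<forall>gs\<in>set cs. valid_layer Ls gs) \<and> w = app (phys Ls) (circuit_op (phys Ls) cs) u"
    by (intro exI[of _ "cs @ ds"]) (auto simp: app_circuit_op_append)
qed

lemma reaches_refl: "vec_on (phys Ls) u \<Longrightarrow> reaches Ls u u"
  unfolding reaches_def by (intro exI[of _ "[]"]) (simp add: circuit_op_def app_ident)

lemma reaches_inner:
  assumes "reaches Ls u v" "vec_on (phys Ls) u"
  shows "inner (phys Ls) v v = inner (phys Ls) u u"
  using assms inner_unitary[OF finite_phys unitary_circuit_op] by (auto simp: reaches_def)

lemma implementable_comp:
  "implementable Ls F \<Longrightarrow> implementable Ls G \<Longrightarrow> implementable Ls (\<lambda>v. F (G v))"
  unfolding implementable_def using reaches_trans reaches_vec_on by blast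

lemma implementable_gate:
  assumes "valid_gate Ls g"
  shows "implementable Ls (app (phys Ls) (gate_op (phys Ls) g))"
  unfolding implementable_def reaches_def
proof (intro allI impI)
  fix v assume v: "vec_on (phys Ls) v"
  have "circuit_op (phys Ls) [[g]] = gate_op (phys Ls) g"
    by (simp add: circuit_op_def layer_op_def mmult_ident_right gate_op_lift)
  then show "\<exists>cs. (\<forall>gs\<in>set cs. valid_layer Ls gs) \<and>
      app (phys Ls) (gate_op (phys Ls) g) v = app (phys Ls) (circuit_op (phys Ls) cs) v"
    using assms by (intro exI[of _ "[[g]]"]) (simp add: valid_layer_def)
qed

subsection \<open>Two-qubit gates\<close>

definition pair_op :: "label \<Rightarrow> label \<Rightarrow> (bool \<Rightarrow> bool \<Rightarrow> bool \<Rightarrow> bool \<Rightarrow> complex) \<Rightarrow> op" where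
  "pair_op x y K = (\<lambda>e e'. if e \<in> cfgs {x, y} \<and> e' \<in> cfgs {x, y}
     then K (e x) (e y) (e' x) (e' y) else 0)"

text \<open>The gate written on configurations of the entire lattice, the kernel \<open>K\<close>
  taking output bits before input bits. Identities between gates then reduce to evaluating
  functions.\<close>

definition pair_map :: "label \<Rightarrow> label \<Rightarrow> (bool \<Rightarrow> bool \<Rightarrow> bool \<Rightarrow> bool \<Rightarrow> complex) \<Rightarrow> vec \<Rightarrow> vec" where
  "pair_map x y K v = (\<lambda>c. \<Sum>a\<in>UNIV. \<Sum>b\<in>UNIV. K (c x) (c y) a b * v (c(x := a, y := b)))"

definition pair_cfg :: "label \<Rightarrow> label \<Rightarrow> bool \<Rightarrow> bool \<Rightarrow> cfg" where
  "pair_cfg x y a b = (\<lambda>z. z = x \<and> a \<or> z = y \<and> b)"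

lemma pair_cfg_in [simp]: "pair_cfg x y a b \<in> cfgs {x, y}"
  by (auto simp: cfgs_def pair_cfg_def)

lemma pair_cfg_apply [simp]:
  assumes "x \<noteq> y"
  shows "pair_cfg x y a b x = a" "pair_cfg x y a b y = b"
  using assms by (auto simp: pair_cfg_def)

lemma pair_cfg_collapse: "e \<in> cfgs {x, y} \<Longrightarrow> pair_cfg x y (e x) (e y) = e"
  by (auto simp: pair_cfg_def cfgs_def fun_eq_iff)

lemma sum_cfgs_pair:
  assumes "x \<noteq> y"
  shows "(\<Sum>e\<in>cfgs {x, y}. f e) = (\<Sum>a\<in>UNIV. \<Sum>b\<in>UNIV. f (pair_cfg x y a b))"
proof -
  have "(\<Sum>e\<in>cfgs {x, y}. f e) = (\<Sum>w\<in>UNIV \<times> UNIV. f (pair_cfg x y (fst w) (snd w)))"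
    by (rule sum.reindex_bij_witness[of _ "\<lambda>w. pair_cfg x y (fst w) (snd w)" "\<lambda>e. (e x, e y)"])
      (use assms in \<open>auto simp: pair_cfg_collapse\<close>)
  then show ?thesis by (simp add: sum.cartesian_product case_prod_beta)
qed

lemma app_pair_op:
  assumes P: "finite P" "x \<in> P" "y \<in> P" "x \<noteq> y" and v: "vec_on P v"
  shows "app P (lift P {x, y} (pair_op x y K)) v = pair_map x y K v"
proof (rule vec_on_eqI[of P])
  show "vec_on P (pair_map x y K v)"
    unfolding vec_on_def
  proof (intro allI impI)
    fix c assume "c \<notin> cfgs P"
    then obtain z where "z \<notin> P" "c z" by (auto simp: cfgs_def)
    then have "c(x := a, y := b) \<notin> cfgs P" for a b using P by (auto simp: cfgs_def)
    then have "v (c(x := a, y := b)) = 0" for a b using v by (simp add: vec_on_def)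
    then show "pair_map x y K v c = 0" by (simp add: pair_map_def)
  qed
  fix c assume c: "c \<in> cfgs P"
  let ?S = "{x, y}"
  have S: "?S \<subseteq> P" using P by simp
  have j: "join (pair_cfg x y a b) (restr c (P - ?S)) = c(x := a, y := b)" for a b
    using c P by (auto simp: pair_cfg_def join_def restr_def cfgs_def fun_eq_iff)
  show "app P (lift P ?S (pair_op x y K)) v c = pair_map x y K v c"
    using P(4) restr_in_cfgs[of c ?S]
    unfolding app_lift[OF P(1) S c] sum_cfgs_pair[OF P(4)] j pair_map_def pair_op_def
    by (simp add: restr_def)
qed simp

definition pair_unitary :: "(bool \<Rightarrow> bool \<Rightarrow> bool \<Rightarrow> bool \<Rightarrow> complex) \<Rightarrow> bool" where
  "pair_unitary K \<longleftrightarrow> (\<forall>a b a' b'. (\<Sum>c\<in>UNIV. \<Sum>d\<in>UNIV. cnj (K c d a b) * K c d a' b')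
     = (if a = a' \<and> b = b' then 1 else 0))"

lemma unitary_pair_op:
  assumes xy: "x \<noteq> y" and K: "pair_unitary K"
  shows "unitary {x, y} (pair_op x y K)"
  unfolding unitary_def
proof (intro conjI op_on_eqI)
  show "op_on {x, y} (pair_op x y K)" by (auto simp: op_on_def pair_op_def)
  fix c c' assume c: "c \<in> cfgs {x, y}" "c' \<in> cfgs {x, y}"
  have "mmult {x, y} (adj (pair_op x y K)) (pair_op x y K) c c'
     = (\<Sum>a\<in>UNIV. \<Sum>b\<in>UNIV. cnj (K a b (c x) (c y)) * K a b (c' x) (c' y))"
    using c xy unfolding mmult_def sum_cfgs_pair[OF xy]
    by (simp add: adj_def pair_op_def)
  also have "\<dots> = (if c x = c' x \<and> c y = c' y then 1 else 0)" using K by (simp add: pair_unitary_def)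
  also have "c x = c' x \<and> c y = c' y \<longleftrightarrow> c' = c" using c by (auto simp: cfgs_def fun_eq_iff)
  finally show "mmult {x, y} (adj (pair_op x y K)) (pair_op x y K) c c' = ident {x, y} c c'"
    using c by (simp add: ident_def)
qed simp_all

lemma ladj_irrefl: "ladj x y \<Longrightarrow> x \<noteq> y"
  by (auto simp: ladj_def)

lemma implementable_pair_map:
  assumes "x \<in> box Ls" "y \<in> box Ls" "ladj x y" "pair_unitary K"
  shows "implementable Ls (pair_map (Site x) (Site y) K)"
proof -
  let ?g = "(x, y, pair_op (Site x) (Site y) K)"
  have xy: "x \<noteq> y" using assms ladj_irrefl by blast
  have "valid_gate Ls ?g"
    using assms xy by (simp add: valid_gate_def gate_sites_def unitary_pair_op)
  then have "implementable Ls (app (phys Ls) (gate_op (phys Ls) ?g))" by (rule implementable_gate)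
  moreover have "app (phys Ls) (gate_op (phys Ls) ?g) v = pair_map (Site x) (Site y) K v"
    if "vec_on (phys Ls) v" for v
    using app_pair_op[OF finite_phys _ _ _ that, of "Site x" "Site y"] assms xy
    by (simp add: gate_op_lift gate_sites_def phys_def)
  ultimately show ?thesis by (simp add: implementable_def)
qed

definition swap_map :: "label \<Rightarrow> label \<Rightarrow> vec \<Rightarrow> vec" where
  "swap_map x y v = (\<lambda>c. v (c(x := c y, y := c x)))"

lemma implementable_swap:
  assumes "x \<in> box Ls" "y \<in> box Ls" "ladj x y"
  shows "implementable Ls (swap_map (Site x) (Site y))"
proof -
  let ?K = "\<lambda>a b a' b'. if a = b' \<and> b = a' then 1 else (0::complex)"
  have "pair_map (Site x) (Site y) ?K = swap_map (Site x) (Site y)"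
    by (intro ext) (auto simp: pair_map_def swap_map_def UNIV_bool)
  moreover have "pair_unitary ?K" by (auto simp: pair_unitary_def UNIV_bool)
  ultimately show ?thesis using implementable_pair_map[OF assms, of ?K] by simp
qed

subsection \<open>Multiply controlled rotations\<close>

text \<open>The control is an arbitrary predicate on configurations, so that nearest-neighbour
  gates, gates between distant sites and multiply controlled gates are instances of one
  notion.\<close>

definition ctl :: "(cfg \<Rightarrow> bool) \<Rightarrow> label \<Rightarrow> (bool \<Rightarrow> bool \<Rightarrow> complex) \<Rightarrow> vec \<Rightarrow> vec" where
  "ctl Q i A v = (\<lambda>c. if Q c then A (c i) False * v (c(i := False)) + A (c i) True * v (c(i := True))
     else v c)"

text \<open>This is exp(i \<theta> Z) with \<open>False\<close> as the first basis state, and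
  \<open>roty\<close> is exp(-i \<theta> Y). As angles are not halved, pi/2 gives a Pauli matrix up
  to a phase.\<close>

definition rotz :: "real \<Rightarrow> bool \<Rightarrow> bool \<Rightarrow> complex" where
  "rotz \<theta> b b' = (if b = b' then (if b then cis (- \<theta>) else cis \<theta>) else 0)"

definition roty :: "real \<Rightarrow> bool \<Rightarrow> bool \<Rightarrow> complex" where
  "roty \<theta> b b' = of_real (if b = b' then cos \<theta> else if b then sin \<theta> else - sin \<theta>)"

text \<open>The control must not read the target: then it has the same value on both configurations
  that a rotation of the target mixes.\<close>

definition ignores :: "(cfg \<Rightarrow> bool) \<Rightarrow> label \<Rightarrow> bool" where
  "ignores Q i \<longleftrightarrow> (\<forall>c b. Q (c(i := b)) = Q c)"

lemma fun_upd_self: "\<not> c i \<Longrightarrow> c(i := False) = c" "c i \<Longrightarrow> c(i := True) = c"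
  by (auto simp: fun_eq_iff)

lemma ctl_rotz_inverse:
  assumes "ignores Q i"
  shows "ctl Q i (rotz (- \<theta>)) (ctl Q i (rotz \<theta>) v) = v"
proof (rule ext)
  fix c
  have Q: "Q (c(i := b)) = Q c" for b using assms by (simp add: ignores_def)
  show "ctl Q i (rotz (- \<theta>)) (ctl Q i (rotz \<theta>) v) c = v c"
    by (cases "c i") (simp_all add: ctl_def Q rotz_def fun_upd_self mult.assoc[symmetric] cis_mult)
qed

lemma ctl_roty_inverse:
  assumes "ignores Q i"
  shows "ctl Q i (roty (- \<theta>)) (ctl Q i (roty \<theta>) v) = v"
proof (rule ext)
  fix c
  have Q: "Q (c(i := b)) = Q c" for b using assms by (simp add: ignores_def)
  have cs: "of_real (cos \<theta>) * (of_real (cos \<theta>) * z) + of_real (sin \<theta>) * (of_real (sin \<theta>) * z) = z" for z :: complex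
  proof -
    have "of_real (cos \<theta>) * (of_real (cos \<theta>) * z) + of_real (sin \<theta>) * (of_real (sin \<theta>) * z)
      = of_real ((cos \<theta>)\<^sup>2 + (sin \<theta>)\<^sup>2) * z"
      by (simp only: of_real_add of_real_mult power2_eq_square ring_distribs mult.assoc)
    then show ?thesis by simp
  qed
  show "ctl Q i (roty (- \<theta>)) (ctl Q i (roty \<theta>) v) c = v c"
    using cs[of "v c"]
    by (cases "c i") (simp_all add: ctl_def Q roty_def fun_upd_self algebra_simps)
qed

text \<open>Conjugation by a quarter turn inverts the other rotation, so that the group commutator
  is the full rotation; it is trivial as soon as one of the two controls is off.\<close>

lemma ctl_commutator_rotz:
  assumes "ignores Q i" "ignores Q' i"
  shows "ctl Q i (rotz (\<theta> / 2)) (ctl Q' i (roty (pi / 2))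
      (ctl Q i (rotz (- (\<theta> / 2))) (ctl Q' i (roty (- (pi / 2))) v)))
    = ctl (\<lambda>c. Q c \<and> Q' c) i (rotz \<theta>) v"
proof (rule ext)
  fix c
  have Q: "Q (c(i := b)) = Q c" "Q' (c(i := b)) = Q' c" for b using assms by (simp_all add: ignores_def)
  show "ctl Q i (rotz (\<theta> / 2)) (ctl Q' i (roty (pi / 2))
      (ctl Q i (rotz (- (\<theta> / 2))) (ctl Q' i (roty (- (pi / 2))) v))) c
    = ctl (\<lambda>c. Q c \<and> Q' c) i (rotz \<theta>) v c"
    by (cases "c i"; cases "Q c"; cases "Q' c")
      (simp_all add: ctl_def Q rotz_def roty_def fun_upd_self mult.assoc[symmetric] cis_mult)
qed

lemma ctl_commutator_roty:
  assumes "ignores Q i" "ignores Q' i"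
  shows "ctl Q i (roty (\<theta> / 2)) (ctl Q' i (rotz (pi / 2))
      (ctl Q i (roty (- (\<theta> / 2))) (ctl Q' i (rotz (- (pi / 2))) v)))
    = ctl (\<lambda>c. Q c \<and> Q' c) i (roty \<theta>) v"
proof (rule ext)
  fix c
  have Q: "Q (c(i := b)) = Q c" "Q' (c(i := b)) = Q' c" for b using assms by (simp_all add: ignores_def)
  define C S where "C = complex_of_real (cos (\<theta> / 2))" and "S = complex_of_real (sin (\<theta> / 2))"
  have "cos \<theta> = (cos (\<theta> / 2))\<^sup>2 - (sin (\<theta> / 2))\<^sup>2" "sin \<theta> = 2 * sin (\<theta> / 2) * cos (\<theta> / 2)"
    using cos_double[of "\<theta> / 2"] sin_double[of "\<theta> / 2"] by simp_all
  then have dbl: "complex_of_real (cos \<theta>) = C * C - S * S" "complex_of_real (sin \<theta>) = 2 * S * C"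
    by (simp_all add: C_def S_def power2_eq_square)
  have "C * C + S * S = of_real ((cos (\<theta> / 2))\<^sup>2 + (sin (\<theta> / 2))\<^sup>2)"
    by (simp only: of_real_add of_real_mult C_def S_def power2_eq_square)
  then have CS: "C * C = 1 - S * S" by (simp add: algebra_simps)
  have one: "C * (C * z) = z - S * (S * z)" for z
    by (simp add: mult.assoc[symmetric] CS left_diff_distrib)
  show "ctl Q i (roty (\<theta> / 2)) (ctl Q' i (rotz (pi / 2))
      (ctl Q i (roty (- (\<theta> / 2))) (ctl Q' i (rotz (- (pi / 2))) v))) c
    = ctl (\<lambda>c. Q c \<and> Q' c) i (roty \<theta>) v c"
    by (cases "c i"; cases "Q c"; cases "Q' c")
      (simp_all add: ctl_def Q rotz_def roty_def fun_upd_self dbl C_def[symmetric] S_def[symmetric] algebra_simps one)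
qed

definition unitary2 :: "(bool \<Rightarrow> bool \<Rightarrow> complex) \<Rightarrow> bool" where
  "unitary2 A \<longleftrightarrow> (\<forall>a a'. cnj (A False a) * A False a' + cnj (A True a) * A True a'
     = (if a = a' then 1 else 0))"

lemma unitary2_rotz: "unitary2 (rotz \<theta>)"
  by (auto simp: unitary2_def rotz_def cis_cnj cis_mult)

lemma unitary2_roty: "unitary2 (roty \<theta>)"
proof -
  have "complex_of_real (cos \<theta>) * of_real (cos \<theta>) + of_real (sin \<theta>) * of_real (sin \<theta>)
      = of_real ((cos \<theta>)\<^sup>2 + (sin \<theta>)\<^sup>2)"
    by (simp only: of_real_add of_real_mult power2_eq_square)
  then have "complex_of_real (cos \<theta>) * of_real (cos \<theta>) + of_real (sin \<theta>) * of_real (sin \<theta>) = 1"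
    by simp
  then show ?thesis by (auto simp: unitary2_def roty_def add.commute mult.commute)
qed

lemma implementable_ctl_adjacent:
  assumes xy: "x \<in> box Ls" "y \<in> box Ls" "ladj x y" and A: "unitary2 A"
  shows "implementable Ls (ctl (\<lambda>c. c (Site y) = \<beta>) (Site x) A)"
proof -
  let ?K = "\<lambda>a b a' b'. if b = b' then (if b = \<beta> then A a a' else if a = a' then 1 else 0) else 0"
  have ne: "Site x \<noteq> Site y" using ladj_irrefl[OF xy(3)] by simp
  have "pair_map (Site x) (Site y) ?K v c = ctl (\<lambda>c. c (Site y) = \<beta>) (Site x) A v c" for v c
  proof -
    have u: "c(Site x := a, Site y := c (Site y)) = c(Site x := a)" for a
      using ne by (auto simp: fun_eq_iff)
    have "pair_map (Site x) (Site y) ?K v c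
        = (\<Sum>a\<in>UNIV. (if c (Site y) = \<beta> then A (c (Site x)) a else if c (Site x) = a then 1 else 0)
            * v (c(Site x := a, Site y := c (Site y))))"
      unfolding pair_map_def by (intro sum.cong refl) (cases "c (Site y)"; simp add: UNIV_bool)
    also have "\<dots> = ctl (\<lambda>c. c (Site y) = \<beta>) (Site x) A v c"
      unfolding u by (cases "c (Site x)") (simp_all add: UNIV_bool ctl_def fun_upd_self)
    finally show ?thesis .
  qed
  then have eq: "pair_map (Site x) (Site y) ?K = ctl (\<lambda>c. c (Site y) = \<beta>) (Site x) A"
    by (intro ext)
  have "pair_unitary ?K"
    unfolding pair_unitary_def
  proof (intro allI)
    fix a b a' b'
    have "cnj (A False a) * A False a' + cnj (A True a) * A True a' = (if a = a' then 1 else 0)"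
      using A by (simp add: unitary2_def)
    then show "(\<Sum>c\<in>UNIV. \<Sum>d\<in>UNIV. cnj (?K c d a b) * ?K c d a' b') = (if a = a' \<and> b = b' then 1 else 0)"
      by (cases b; cases b'; cases \<beta>; cases a; cases a') (simp_all add: UNIV_bool)
  qed
  then show ?thesis using implementable_pair_map[OF xy, of ?K] eq by simp
qed

lemma swap_conj_ctl:
  assumes "i \<noteq> j" "i \<noteq> j'" "j \<noteq> j'"
  shows "swap_map j j' (ctl (\<lambda>c. c j = \<beta>) i A (swap_map j j' v)) = ctl (\<lambda>c. c j' = \<beta>) i A v"
proof (rule ext)
  fix c :: cfg
  define sw where "sw = (\<lambda>c :: cfg. c(j := c j', j' := c j))"
  have e: "swap_map j j' u c = u (sw c)" for u c by (simp add: swap_map_def sw_def)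
  have "sw ((sw c)(i := b)) = c(i := b)" "sw (sw c) = c" "sw c j = c j'" "sw c i = c i" for b
    using assms by (auto simp: sw_def fun_eq_iff)
  then show "swap_map j j' (ctl (\<lambda>c. c j = \<beta>) i A (swap_map j j' v)) c
      = ctl (\<lambda>c. c j' = \<beta>) i A v c"
    unfolding e by (simp add: ctl_def e)
qed

text \<open>The control is carried along a lattice path that starts at the target, one swap per
  edge. A swap with both ends off the target moves the control; an edge leaving the target is a
  genuine two-qubit gate. The disjunct \<open>j = i\<close> in the induction lets the path pass
  through the target.\<close>

lemma implementable_ctl_one:
  assumes con: "lconnected (box Ls)" and ij: "i \<in> box Ls" "j \<in> box Ls" "i \<noteq> j" and A: "unitary2 A"
  shows "implementable Ls (ctl (\<lambda>c. c (Site j) = \<beta>) (Site i) A)"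
proof -
  have "(i, j) \<in> {(a, b). a \<in> box Ls \<and> b \<in> box Ls \<and> ladj a b}\<^sup>*"
    using con ij unfolding lconnected_def by blast
  then have "j = i \<or> implementable Ls (ctl (\<lambda>c. c (Site j) = \<beta>) (Site i) A)"
  proof (induction rule: rtrancl_induct)
    case base
    then show ?case by simp
  next
    case (step y z)
    have yz: "y \<in> box Ls" "z \<in> box Ls" "ladj y z" using step by auto
    consider "z = i" | "y = i" "z \<noteq> i" | "y \<noteq> i" "z \<noteq> i" by blast
    then show ?case
    proof cases
      case 2
      then show ?thesis using implementable_ctl_adjacent[OF yz A] by simp
    next
      case 3
      then have c: "implementable Ls (ctl (\<lambda>c. c (Site y) = \<beta>) (Site i) A)" using step.IH by simp
      have "implementable Ls (\<lambda>v. swap_map (Site y) (Site z)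
         (ctl (\<lambda>c. c (Site y) = \<beta>) (Site i) A (swap_map (Site y) (Site z) v)))"
        using implementable_comp[OF implementable_swap[OF yz] implementable_comp[OF c implementable_swap[OF yz]]] .
      then show ?thesis
        using swap_conj_ctl[of "Site i" "Site y" "Site z"] 3 ladj_irrefl[OF yz(3)] by simp
    qed simp
  qed
  then show ?thesis using ij by simp
qed

definition pattern :: "int list set \<Rightarrow> cfg \<Rightarrow> cfg \<Rightarrow> bool" where
  "pattern X r c \<longleftrightarrow> (\<forall>x\<in>X. c (Site x) = r (Site x))"

lemma ignores_pattern: "i \<notin> X \<Longrightarrow> ignores (pattern X r) (Site i)"
  by (auto simp: ignores_def pattern_def)

text \<open>Each further control site costs one group commutator, between the rotation controlled by
  the earlier sites and a singly controlled pi/2 rotation about the other axis. The induction starts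
  from one control site because gates act on two qubits.\<close>

lemma implementable_ctl_pattern:
  assumes con: "lconnected (box Ls)" and i: "i \<in> box Ls"
    and X: "finite X" "X \<noteq> {}"
  shows "X \<subseteq> box Ls - {i} \<Longrightarrow> implementable Ls (ctl (pattern X r) (Site i) (rotz \<theta>))
      \<and> implementable Ls (ctl (pattern X r) (Site i) (roty \<theta>))"
  using X
proof (induction X arbitrary: \<theta> rule: finite_ne_induct)
  case (singleton x)
  have "pattern {x} r = (\<lambda>c. c (Site x) = r (Site x))" by (auto simp: pattern_def)
  then show ?case
    using implementable_ctl_one[OF con i] singleton unitary2_roty unitary2_rotz by auto
next
  case (insert x X)
  let ?Q = "pattern X r" and ?Q' = "\<lambda>c. c (Site x) = r (Site x)"
  have ig: "ignores ?Q (Site i)" "ignores ?Q' (Site i)"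
    using insert.prems ignores_pattern[of i X] by (auto simp: ignores_def)
  have eq: "pattern (insert x X) r = (\<lambda>c. ?Q c \<and> ?Q' c)" by (auto simp: pattern_def)
  have X: "implementable Ls (ctl ?Q (Site i) (rotz \<theta>))" "implementable Ls (ctl ?Q (Site i) (roty \<theta>))" for \<theta>
    using insert by auto
  have x: "implementable Ls (ctl ?Q' (Site i) (rotz \<theta>))" "implementable Ls (ctl ?Q' (Site i) (roty \<theta>))" for \<theta>
    using implementable_ctl_one[OF con i] insert.prems unitary2_roty unitary2_rotz by auto
  note comm = implementable_comp[OF _ implementable_comp[OF _ implementable_comp]]
  show ?case
    using comm[OF X(1)[of "\<theta> / 2"] x(2)[of "pi / 2"] X(1)[of "- (\<theta> / 2)"] x(2)[of "- (pi / 2)"]]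
      comm[OF X(2)[of "\<theta> / 2"] x(1)[of "pi / 2"] X(2)[of "- (\<theta> / 2)"] x(1)[of "- (pi / 2)"]]
    unfolding eq ctl_commutator_rotz[OF ig] ctl_commutator_roty[OF ig] by blast
qed

subsection \<open>Reduction of a state to the zero state\<close>

text \<open>Euler angles: the first phase rotation gives \<alpha> and \<beta> a common phase, the
  real rotation by minus the polar angle of the remaining real pair turns it onto the first axis,
  and the last rotation removes the common phase.\<close>

lemma rotate_to_nonneg:
  obtains \<theta>1 \<theta>2 \<theta>3 \<rho> where
    "of_real (sin \<theta>2) * (cis \<theta>1 * \<alpha>) + of_real (cos \<theta>2) * (cis (- \<theta>1) * \<beta>) = 0"
    "cis \<theta>3 * (of_real (cos \<theta>2) * (cis \<theta>1 * \<alpha>) - of_real (sin \<theta>2) * (cis (- \<theta>1) * \<beta>)) = of_real \<rho>"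
    "\<rho> \<ge> 0"
proof -
  obtain ra a where a: "\<alpha> = rcis ra a" using rcis_Ex by blast
  obtain rb b where b: "\<beta> = rcis rb b" using rcis_Ex by blast
  define t where "t = Arg (Complex ra rb)"
  define R where "R = cmod (Complex ra rb)"
  have "Complex ra rb = rcis R t" by (simp add: R_def t_def rcis_cmod_Arg)
  then have r: "ra = R * cos t" "rb = R * sin t" by (simp_all add: rcis_def complex_eq_iff)
  define \<phi> where "\<phi> = (a + b) / 2"
  have ph: "cis ((b - a) / 2) * \<alpha> = of_real ra * cis \<phi>" "cis (- ((b - a) / 2)) * \<beta> = of_real rb * cis \<phi>"
    by (simp_all add: a b rcis_def mult.left_commute cis_mult \<phi>_def field_simps)
  show ?thesis
  proof (rule that[of "- t" "(b - a) / 2" "- \<phi>" R])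
    show "of_real (sin (- t)) * (cis ((b - a) / 2) * \<alpha>)
        + of_real (cos (- t)) * (cis (- ((b - a) / 2)) * \<beta>) = 0"
      unfolding ph by (simp add: r mult_ac)
    have "of_real (cos (- t)) * (cis ((b - a) / 2) * \<alpha>) - of_real (sin (- t)) * (cis (- ((b - a) / 2)) * \<beta>)
       = of_real (R * ((cos t)\<^sup>2 + (sin t)\<^sup>2)) * cis \<phi>"
      unfolding ph by (simp add: r power2_eq_square algebra_simps del: sin_cos_squared_add sin_cos_squared_add2 sin_cos_squared_add3)
    also have "\<dots> = of_real R * cis \<phi>" by simp
    finally show "cis (- \<phi>) * (of_real (cos (- t)) * (cis ((b - a) / 2) * \<alpha>)
        - of_real (sin (- t)) * (cis (- ((b - a) / 2)) * \<beta>)) = of_real R"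
      by (simp add: mult.left_commute cis_mult)
    show "R \<ge> 0" by (simp add: R_def)
  qed
qed

text \<open>The qubits in \<open>Y\<close> are in the state zero and unentangled with the
  others.\<close>

definition vanishes_on :: "label set \<Rightarrow> vec \<Rightarrow> bool" where
  "vanishes_on Y v \<longleftrightarrow> (\<forall>c. (\<exists>y\<in>Y. c y) \<longrightarrow> v c = 0)"

lemma vanishes_on_ctl:
  assumes "vanishes_on Y v" "i \<notin> Y"
  shows "vanishes_on Y (ctl Q i A v)"
  unfolding vanishes_on_def
proof (intro allI impI)
  fix c assume "\<exists>y\<in>Y. c y"
  then obtain y where "y \<in> Y" "c y" by blast
  then have "(c(i := b)) y" for b using assms by auto
  then have "v (c(i := b)) = 0" "v c = 0" for b
    using assms \<open>y \<in> Y\<close> \<open>c y\<close> unfolding vanishes_on_def by blast+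
  then show "ctl Q i A v c = 0" by (simp add: ctl_def)
qed

text \<open>Amplitudes are cleared starting from the target state, while the wanted circuit starts
  from the zero state; recording both directions replaces the inversion of circuits.\<close>

definition mutual :: "nat list \<Rightarrow> vec \<Rightarrow> vec \<Rightarrow> bool" where
  "mutual Ls u v \<longleftrightarrow> reaches Ls u v \<and> reaches Ls v u"

lemma mutual_trans: "mutual Ls u v \<Longrightarrow> mutual Ls v w \<Longrightarrow> mutual Ls u w"
  unfolding mutual_def using reaches_trans by blast

context
  fixes Ls :: "nat list" and i :: "int list"
  assumes con: "lconnected (box Ls)" and i: "i \<in> box Ls" and two: "box Ls \<noteq> {i}"
begin

lemma other_sites: "finite (box Ls - {i})" "box Ls - {i} \<noteq> {}" "box Ls - {i} \<subseteq> box Ls - {i}"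
  using i two by auto

lemma mutual_ctl:
  assumes v: "vec_on (phys Ls) v"
  shows "mutual Ls v (ctl (pattern (box Ls - {i}) r) (Site i) (rotz \<theta>) v)"
    "mutual Ls v (ctl (pattern (box Ls - {i}) r) (Site i) (roty \<theta>) v)"
proof -
  let ?Q = "pattern (box Ls - {i}) r"
  have ig: "ignores ?Q (Site i)" by (rule ignores_pattern) simp
  have im: "implementable Ls (ctl ?Q (Site i) (rotz \<theta>))" "implementable Ls (ctl ?Q (Site i) (roty \<theta>))" for \<theta>
    using implementable_ctl_pattern[OF con i other_sites] by auto
  have f: "reaches Ls v (ctl ?Q (Site i) (rotz \<theta>) v)" "reaches Ls v (ctl ?Q (Site i) (roty \<theta>) v)"
    using im v unfolding implementable_def by auto
  have "reaches Ls (ctl ?Q (Site i) (rotz \<theta>) v) v" "reaches Ls (ctl ?Q (Site i) (roty \<theta>) v) v"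
    using im(1)[of "- \<theta>"] im(2)[of "- \<theta>"] reaches_vec_on[OF f(1)] reaches_vec_on[OF f(2)]
      ctl_rotz_inverse[OF ig] ctl_roty_inverse[OF ig]
    unfolding implementable_def by metis+
  then show "mutual Ls v (ctl ?Q (Site i) (rotz \<theta>) v)" "mutual Ls v (ctl ?Q (Site i) (roty \<theta>) v)"
    using f by (auto simp: mutual_def)
qed

text \<open>With all other sites as controls, the three rotations touch a single pair of amplitudes,
  those at \<open>r\<close> and \<open>r(Site i := True)\<close>.\<close>

lemma clear_pattern:
  assumes v: "vec_on (phys Ls) v" and r: "\<not> r (Site i)" and Y: "vanishes_on Y v" "Site i \<notin> Y"
  shows "\<exists>w \<rho>. mutual Ls v w \<and> vanishes_on Y w \<and> w (r(Site i := True)) = 0 \<and> w r = of_real \<rho> \<and> \<rho> \<ge> 0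
     \<and> (\<forall>c. \<not> pattern (box Ls - {i}) r c \<longrightarrow> w c = v c)"
proof -
  let ?Q = "pattern (box Ls - {i}) r" and ?i = "Site i"
  obtain \<theta>1 \<theta>2 \<theta>3 \<rho> where th:
    "of_real (sin \<theta>2) * (cis \<theta>1 * v r) + of_real (cos \<theta>2) * (cis (- \<theta>1) * v (r(?i := True))) = 0"
    "cis \<theta>3 * (of_real (cos \<theta>2) * (cis \<theta>1 * v r) - of_real (sin \<theta>2) * (cis (- \<theta>1) * v (r(?i := True)))) = of_real \<rho>"
    "\<rho> \<ge> 0"
    by (rule rotate_to_nonneg[where \<alpha> = "v r" and \<beta> = "v (r(?i := True))"])
  define v1 where "v1 = ctl ?Q ?i (rotz \<theta>1) v"
  define v2 where "v2 = ctl ?Q ?i (roty \<theta>2) v1"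
  define w where "w = ctl ?Q ?i (rotz \<theta>3) v2"
  have m1: "mutual Ls v v1" unfolding v1_def by (rule mutual_ctl[OF v])
  have m2: "mutual Ls v1 v2" unfolding v2_def
    using m1 reaches_vec_on by (intro mutual_ctl) (auto simp: mutual_def)
  have m3: "mutual Ls v2 w" unfolding w_def
    using m2 reaches_vec_on by (intro mutual_ctl) (auto simp: mutual_def)
  have Q: "?Q r" "?Q (r(?i := b))" for b by (auto simp: pattern_def)
  have rr: "r(?i := False) = r" using r by (rule fun_upd_self)
  have v1: "v1 r = cis \<theta>1 * v r" "v1 (r(?i := True)) = cis (- \<theta>1) * v (r(?i := True))"
    using r by (simp_all add: v1_def ctl_def Q rr rotz_def)
  have v2: "v2 r = of_real (cos \<theta>2) * v1 r - of_real (sin \<theta>2) * v1 (r(?i := True))"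
    "v2 (r(?i := True)) = of_real (sin \<theta>2) * v1 r + of_real (cos \<theta>2) * v1 (r(?i := True))"
    using r by (simp_all add: v2_def ctl_def Q rr roty_def)
  have "w r = cis \<theta>3 * v2 r" "w (r(?i := True)) = cis (- \<theta>3) * v2 (r(?i := True))"
    using r by (simp_all add: w_def ctl_def Q rr rotz_def)
  then have "w r = of_real \<rho>" "w (r(?i := True)) = 0"
    using th by (simp_all add: v2 v1)
  moreover have "vanishes_on Y w"
    unfolding w_def v2_def v1_def using Y by (intro vanishes_on_ctl)
  moreover have "w c = v c" if "\<not> ?Q c" for c
    using that by (simp add: w_def v2_def v1_def ctl_def)
  ultimately show ?thesis using mutual_trans[OF mutual_trans[OF m1 m2] m3] th(3) by blast
qed

lemma pattern_unique:
  assumes "r \<in> cfgs (phys Ls - {Site i})" "r' \<in> cfgs (phys Ls - {Site i})" "pattern (box Ls - {i}) r r'"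
  shows "r = r'"
proof (rule ext)
  fix z
  show "r z = r' z"
  proof (cases "z \<in> phys Ls - {Site i}")
    case True
    then obtain x where "z = Site x" "x \<in> box Ls - {i}" by (auto simp: phys_def)
    then show ?thesis using assms(3) by (auto simp: pattern_def)
  next
    case False
    then show ?thesis using assms(1,2) by (auto simp: cfgs_def)
  qed
qed

text \<open>Different patterns on the other sites belong to disjoint pairs of amplitudes, so
  clearing one pair leaves those already cleared as they are.\<close>

lemma clear_patterns:
  assumes v: "vec_on (phys Ls) v" and Y: "vanishes_on Y v" "Site i \<notin> Y"
    and R: "finite R"
  shows "R \<subseteq> cfgs (phys Ls - {Site i}) \<Longrightarrow>
    \<exists>w. mutual Ls v w \<and> vanishes_on Y w \<and>
      (\<forall>r\<in>R. w (r(Site i := True)) = 0 \<and> (\<exists>\<rho>\<ge>0. w r = of_real \<rho>))"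
  using R
proof (induction R rule: finite_induct)
  case empty
  then show ?case using v Y reaches_refl by (auto simp: mutual_def)
next
  case (insert r R)
  then obtain u where u: "mutual Ls v u" "vanishes_on Y u"
    "\<forall>r\<in>R. u (r(Site i := True)) = 0 \<and> (\<exists>\<rho>\<ge>0. u r = of_real \<rho>)" by blast
  have uv: "vec_on (phys Ls) u" using u(1) reaches_vec_on by (auto simp: mutual_def)
  have ri: "\<not> r (Site i)" using insert.prems by (auto simp: cfgs_def)
  obtain w \<rho> where w: "mutual Ls u w" "vanishes_on Y w" "w (r(Site i := True)) = 0"
    "w r = of_real \<rho>" "\<rho> \<ge> 0" "\<forall>c. \<not> pattern (box Ls - {i}) r c \<longrightarrow> w c = u c"
    using clear_pattern[of u r Y, OF uv ri u(2) Y(2)] by blast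
  have "w r' = u r' \<and> w (r'(Site i := True)) = u (r'(Site i := True))" if "r' \<in> R" for r'
  proof -
    have "\<not> pattern (box Ls - {i}) r r'"
      using pattern_unique[of r r'] that insert by auto
    moreover from this have "\<not> pattern (box Ls - {i}) r (r'(Site i := True))"
      using ignores_pattern[of i "box Ls - {i}" r] by (auto simp: ignores_def)
    ultimately show ?thesis using w(6) by blast
  qed
  then have "\<forall>r\<in>insert r R. w (r(Site i := True)) = 0 \<and> (\<exists>\<rho>\<ge>0. w r = of_real \<rho>)"
    using u(3) w by auto
  then show ?case using mutual_trans[OF u(1) w(1)] w(2) by blast
qed

lemma clear_site:
  assumes v: "vec_on (phys Ls) v" and Y: "vanishes_on Y v" "Site i \<notin> Y"
  shows "\<exists>w. mutual Ls v w \<and> vanishes_on (insert (Site i) Y) w \<and> (\<exists>\<rho>\<ge>0. w (\<lambda>_. False) = of_real \<rho>)"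
proof -
  obtain w where w: "mutual Ls v w" "vanishes_on Y w"
    "\<forall>r\<in>cfgs (phys Ls - {Site i}). w (r(Site i := True)) = 0 \<and> (\<exists>\<rho>\<ge>0. w r = of_real \<rho>)"
    using clear_patterns[OF v Y, of "cfgs (phys Ls - {Site i})"] by auto
  have wv: "vec_on (phys Ls) w" using w(1) reaches_vec_on by (auto simp: mutual_def)
  have "w c = 0" if "c (Site i)" for c
  proof (cases "c \<in> cfgs (phys Ls)")
    case True
    then have "c(Site i := False) \<in> cfgs (phys Ls - {Site i})" by (auto simp: cfgs_def)
    then have "w ((c(Site i := False))(Site i := True)) = 0" using w(3) by blast
    then show ?thesis using that fun_upd_self(2)[of c] by simp
  qed (use wv in \<open>simp add: vec_on_def\<close>)
  then have "vanishes_on (insert (Site i) Y) w" using w(2) by (auto simp: vanishes_on_def)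
  moreover have "\<exists>\<rho>\<ge>0. w (\<lambda>_. False) = of_real \<rho>" using w(3) zero_in_cfgs by blast
  ultimately show ?thesis using w(1) by blast
qed

end

theorem universal_state_preparation:
  assumes con: "lconnected (box Ls)" and two: "2 \<le> card (box Ls)"
    and v: "vec_on (phys Ls) v" "inner (phys Ls) v v = 1"
  shows "\<exists>cs. (\<forall>gs\<in>set cs. valid_layer Ls gs) \<and> run_circuit (phys Ls) cs = v"
proof -
  have ne: "box Ls \<noteq> {i}" for i
  proof
    assume "box Ls = {i}"
    with two show False by simp
  qed
  have "finite Y \<Longrightarrow> Y \<noteq> {} \<Longrightarrow> Y \<subseteq> box Ls \<Longrightarrow>
    \<exists>w. mutual Ls v w \<and> vanishes_on (Site ` Y) w \<and> (\<exists>\<rho>\<ge>0. w (\<lambda>_. False) = of_real \<rho>)" for Y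
  proof (induction Y rule: finite_ne_induct)
    case (singleton i)
    have i: "i \<in> box Ls" "box Ls \<noteq> {i}" using singleton ne by simp_all
    have "vanishes_on {} v" by (simp add: vanishes_on_def)
    then have "\<exists>w. mutual Ls v w \<and> vanishes_on {Site i} w \<and> (\<exists>\<rho>\<ge>0. w (\<lambda>_. False) = of_real \<rho>)"
      using clear_site[of Ls i v "{}", OF con i v(1)] by simp
    then show ?case by (simp only: image_insert image_empty)
  next
    case (insert i Y)
    then obtain u where u: "mutual Ls v u" "vanishes_on (Site ` Y) u" by blast
    have vu: "vec_on (phys Ls) u" using u(1) reaches_vec_on unfolding mutual_def by blast
    have i: "i \<in> box Ls" "box Ls \<noteq> {i}" using insert.prems ne by simp_all
    have "Site i \<notin> Site ` Y" using insert.hyps by auto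
    then have "\<exists>w. mutual Ls u w \<and> vanishes_on (insert (Site i) (Site ` Y)) w
        \<and> (\<exists>\<rho>\<ge>0. w (\<lambda>_. False) = of_real \<rho>)"
      by (rule clear_site[of Ls i u "Site ` Y", OF con i vu u(2)])
    then show ?case
      using mutual_trans[OF u(1)] unfolding image_insert by blast
  qed
  moreover have "box Ls \<noteq> {}" using two by auto
  ultimately obtain w \<rho> where w: "mutual Ls v w" "vanishes_on (phys Ls) w"
    and \<rho>: "\<rho> \<ge> 0" "w (\<lambda>_. False) = of_real \<rho>"
    unfolding phys_def using finite_box by blast
  have wv: "vec_on (phys Ls) w" using w(1) reaches_vec_on by (auto simp: mutual_def)
  \<comment> \<open>No site is left that could be 1, so only the amplitude at the zero configuration
    survives. It is nonnegative, so normalisation makes it 1 and no global phase remains.\<close>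
  have w0: "w = (\<lambda>c. of_real \<rho> * zero_state c)"
  proof (rule ext)
    fix c
    show "w c = of_real \<rho> * zero_state c"
    proof (cases "c = (\<lambda>_. False)")
      case False
      then obtain z where "c z" by (auto simp: fun_eq_iff)
      then have "w c = 0"
        using w(2) wv by (cases "z \<in> phys Ls") (auto simp: vanishes_on_def vec_on_def cfgs_def)
      then show ?thesis using False by (simp add: zero_state_def)
    qed (simp add: \<rho> zero_state_def)
  qed
  have "inner (phys Ls) w w = 1" using reaches_inner[of Ls v w] w(1) v by (simp add: mutual_def)
  moreover have "inner (phys Ls) zero_state zero_state = 1"
    using inner_unit_vec[OF finite_phys zero_in_cfgs, of Ls zero_state] by (simp add: zero_state_def)
  ultimately have "complex_of_real (\<rho> * \<rho>) = 1"
    by (simp add: w0 inner_scale_left inner_scale_right)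
  then have "\<rho> * \<rho> = 1" using of_real_eq_1_iff by blast
  then have "\<rho> = 1" using \<rho>(1) by (simp add: square_eq_1_iff)
  then have "w = zero_state" using w0 by simp
  then have "reaches Ls zero_state v" using w(1) by (simp add: mutual_def)
  then show ?thesis unfolding reaches_def run_circuit_eq[OF finite_phys] by auto
qed

section \<open>Erasure of a region and recovery\<close>

lemma join_commute: "join a b = join b a"
  by (auto simp: join_def)

definition ketbra :: "vec \<Rightarrow> vec \<Rightarrow> op" where
  "ketbra y x = (\<lambda>c c'. y c * cnj (x c'))"

lemma ketbra_self: "ketbra x x = proj x"
  by (simp add: ketbra_def proj_def)

lemma tr_ketbra: "tr S (ketbra y x) = inner S x y"
  by (simp add: tr_def ketbra_def inner_def mult.commute)

text \<open>Contracting \<open>x\<close> with \<open>y\<close> on \<open>P - S\<close> leaves a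
  vector \<open>h\<close> on \<open>S\<close>, and the expectation becomes that of \<gamma> in
  \<open>h\<close>.\<close>

lemma psd_tensor_proj:
  assumes P: "finite P" "S \<subseteq> P" and g: "psd S \<gamma>"
  shows "psd P (tensor (P - S) S (proj y) \<gamma>)"
  unfolding psd_def
proof (intro conjI allI impI)
  let ?Q = "P - S"
  have U: "?Q \<union> S = P" "?Q \<inter> S = {}" using P by auto
  have "P \<union> S = P" using P by auto
  then show "op_on P (tensor ?Q S (proj y) \<gamma>)" by (auto simp: op_on_def tensor_def)
  fix x assume "vec_on P x"
  define h where "h = (\<lambda>s. if s \<in> cfgs S then (\<Sum>r\<in>cfgs ?Q. cnj (y r) * x (join r s)) else 0)"
  have hS: "vec_on S h" by (simp add: vec_on_def h_def)
  have sumP: "(\<Sum>c\<in>cfgs P. f c) = (\<Sum>s\<in>cfgs S. \<Sum>r\<in>cfgs ?Q. f (join r s))" for f :: "cfg \<Rightarrow> complex"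
    using sum_cfgs_split[OF P(2), of f] by (simp add: join_commute)
  have t: "tensor ?Q S (proj y) \<gamma> (join r s) (join r' s') = y r * cnj (y r') * \<gamma> s s'"
    if "r \<in> cfgs ?Q" "r' \<in> cfgs ?Q" "s \<in> cfgs S" "s' \<in> cfgs S" for r r' s s'
    using that join_in_cfgs[of _ ?Q _ S] restr_join[of _ ?Q _ S] U
    by (simp add: tensor_def proj_def)
  have a: "app P (tensor ?Q S (proj y) \<gamma>) x (join r s) = y r * app S \<gamma> h s"
    if "r \<in> cfgs ?Q" "s \<in> cfgs S" for r s
  proof -
    have "join r s \<in> cfgs P" using join_in_cfgs[OF that] U by simp
    then have "app P (tensor ?Q S (proj y) \<gamma>) x (join r s)
        = (\<Sum>s'\<in>cfgs S. \<Sum>r'\<in>cfgs ?Q. y r * cnj (y r') * \<gamma> s s' * x (join r' s'))"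
      using that by (simp add: app_def sumP t)
    also have "\<dots> = y r * app S \<gamma> h s"
      using that by (simp add: app_def h_def sum_distrib_left mult_ac)
    finally show ?thesis .
  qed
  have "inner P x (app P (tensor ?Q S (proj y) \<gamma>) x)
      = (\<Sum>s\<in>cfgs S. \<Sum>r\<in>cfgs ?Q. cnj (x (join r s)) * (y r * app S \<gamma> h s))"
    unfolding inner_def sumP by (intro sum.cong refl) (simp add: a)
  also have "\<dots> = inner S h (app S \<gamma> h)"
    by (simp add: inner_def h_def sum_distrib_right mult_ac)
  finally have "inner P x (app P (tensor ?Q S (proj y) \<gamma>) x) = inner S h (app S \<gamma> h)" .
  then show "Im (inner P x (app P (tensor ?Q S (proj y) \<gamma>) x)) = 0"
    "0 \<le> Re (inner P x (app P (tensor ?Q S (proj y) \<gamma>) x))"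
    using g hS by (simp_all add: psd_def)
qed

section \<open>Replacement channels: positivity, trace and absorbed unitaries\<close>

lemma op_on_replacement: "S \<subseteq> P \<Longrightarrow> op_on P (replacement P S \<gamma> X)"
  by (auto simp: replacement_def op_on_def tensor_def Un_absorb2)

lemma replacement_linear:
  "replacement P S \<gamma> (\<lambda>c c'. X c c' + a * Y c c')
    = (\<lambda>c c'. replacement P S \<gamma> X c c' + a * replacement P S \<gamma> Y c c')"
  by (intro ext) (simp add: replacement_def tensor_def ptrace_def sum.distrib sum_distrib_left ring_distribs mult_ac)

text \<open>The reduced operator of a pure state is a sum of rank-one operators, one for the slice
  of the state at each configuration of the erased region.\<close>

lemma psd_replacement_proj:
  assumes P: "finite P" "S \<subseteq> P" and g: "psd S \<gamma>"
  shows "psd P (replacement P S \<gamma> (proj w))"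
proof -
  have "replacement P S \<gamma> (proj w)
      = (\<lambda>c c'. \<Sum>t\<in>cfgs S. tensor (P - S) S (proj (\<lambda>r. w (join r t))) \<gamma> c c')"
    by (intro ext) (auto simp: replacement_def tensor_def ptrace_def proj_def sum_distrib_right)
  then show ?thesis using psd_sum[of "cfgs S" P] psd_tensor_proj[OF P g] by simp
qed

lemma tr_replacement:
  assumes P: "finite P" "S \<subseteq> P" and g: "tr S \<gamma> = 1"
  shows "tr P (replacement P S \<gamma> X) = tr P X"
proof -
  let ?Q = "P - S"
  have U: "?Q \<union> S = P" "?Q \<inter> S = {}" using P by auto
  have sumP: "(\<Sum>c\<in>cfgs P. f c) = (\<Sum>r\<in>cfgs ?Q. \<Sum>s\<in>cfgs S. f (join r s))" for f :: "cfg \<Rightarrow> complex"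
    using sum_cfgs_Un[OF U(2), of f] U(1) by simp
  have "tr P (replacement P S \<gamma> X) = (\<Sum>r\<in>cfgs ?Q. \<Sum>s\<in>cfgs S. ptrace ?Q S X r r * \<gamma> s s)"
    unfolding tr_def sumP using join_in_cfgs[of _ ?Q _ S] restr_join[of _ ?Q _ S] U
    by (intro sum.cong refl) (simp add: replacement_def tensor_def)
  also have "\<dots> = (\<Sum>r\<in>cfgs ?Q. ptrace ?Q S X r r)"
    using g by (simp add: sum_distrib_left[symmetric] tr_def)
  also have "\<dots> = tr P X" by (simp add: tr_def sumP ptrace_def)
  finally show ?thesis .
qed

text \<open>The entries of the reduced operator are inner products of the slices
  \<open>part r\<close> over the erased region; a unitary on that region preserves them.\<close>

lemma replacement_absorbs_unitary:
  assumes P: "finite P" "S \<subseteq> P" and W: "supported_unitary P S W" and v: "vec_on P v"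
  shows "replacement P S \<gamma> (proj (app P W v)) = replacement P S \<gamma> (proj v)"
proof -
  let ?Q = "P - S"
  obtain w where w: "unitary S w" "W = lift P S w" using W unfolding supported_unitary_def by blast
  have fS: "finite S" using P finite_subset by blast
  define part where "part = (\<lambda>r s. if s \<in> cfgs S then v (join s r) else 0)"
  have pS: "vec_on S (part r)" for r by (simp add: part_def vec_on_def)
  have ap: "app P W v (join r t) = app S w (part r) t" if "r \<in> cfgs ?Q" "t \<in> cfgs S" for r t
  proof -
    have "join t r \<in> cfgs P" by (rule join_in_cfgs_Diff[OF P(2) that(2,1)])
    then show ?thesis
      using that unfolding join_commute[of r t] w(2)
      by (simp add: app_lift[OF P] restr_join_Diff[OF that(2,1)] app_def[of S] part_def)
  qed
  have "ptrace ?Q S (proj (app P W v)) = ptrace ?Q S (proj v)"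
  proof (intro ext)
    fix r r'
    show "ptrace ?Q S (proj (app P W v)) r r' = ptrace ?Q S (proj v) r r'"
    proof (cases "r \<in> cfgs ?Q \<and> r' \<in> cfgs ?Q")
      case True
      then have "ptrace ?Q S (proj (app P W v)) r r'
          = (\<Sum>t\<in>cfgs S. cnj (app S w (part r') t) * app S w (part r) t)"
        by (simp add: ptrace_def proj_def ap mult.commute)
      also have "\<dots> = inner S (part r') (part r)"
        using inner_unitary[OF fS w(1) pS] by (simp add: inner_def)
      also have "\<dots> = ptrace ?Q S (proj v) r r'"
        using True by (simp add: inner_def part_def ptrace_def proj_def join_commute mult.commute)
      finally show ?thesis .
    qed (auto simp: ptrace_def)
  qed
  then show ?thesis by (simp add: replacement_def)
qed

text \<open>Cauchy-Schwarz for a positive form known through its values on u + z y, with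
  \<open>a\<close>, \<open>b\<close>, \<open>c\<close>, \<open>d\<close> the coefficients of 1, z,
  its conjugate and |z|^2. The form may be degenerate, so \<open>Re d = 0\<close> is a case of its
  own.\<close>

lemma form_Cauchy_Schwarz:
  assumes q: "\<And>z. Im (a + z * b + cnj z * c + z * cnj z * d) = 0 \<and> 0 \<le> Re (a + z * b + cnj z * c + z * cnj z * d)"
    and d: "0 \<le> Re d"
  shows "(cmod b)\<^sup>2 \<le> Re a * Re d"
proof -
  have a: "Im a = 0" "0 \<le> Re a" using q[of 0] by auto
  have c: "c = cnj b"
    using q[of 1] q[of "- 1"] q[of \<i>] q[of "- \<i>"] a by (simp add: complex_eq_iff)
  have Imd: "Im d = 0" using q[of 1] q[of "- 1"] a by simp
  have Re_q: "0 \<le> Re a - 2 * t * (cmod b)\<^sup>2 + t\<^sup>2 * (cmod b)\<^sup>2 * Re d" for t :: real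
  proof -
    let ?z = "of_real (- t) * cnj b"
    have zb: "?z * b = of_real (- t * (cmod b)\<^sup>2)"
      by (simp add: complex_norm_square mult.commute del: of_real_power)
    have zc: "cnj ?z * c = of_real (- t * (cmod b)\<^sup>2)"
      unfolding c by (simp add: complex_norm_square mult.commute del: of_real_power)
    have "?z * cnj ?z = of_real t * of_real t * (b * cnj b)" by simp
    also have "\<dots> = of_real (t\<^sup>2 * (cmod b)\<^sup>2)"
      by (simp add: complex_norm_square power2_eq_square[of t] del: of_real_power)
    finally have zz: "?z * cnj ?z = of_real (t\<^sup>2 * (cmod b)\<^sup>2)" .
    have "0 \<le> Re (a + ?z * b + cnj ?z * c + ?z * cnj ?z * d)" using q by blast
    then show ?thesis unfolding zb zc zz by (simp del: of_real_mult)
  qed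
  show ?thesis
  proof (cases "Re d = 0")
    case True
    have "b = 0"
    proof (rule ccontr)
      assume b: "b \<noteq> 0"
      \<comment> \<open>For vanishing \<open>Re d\<close> the expression is affine in
        \<open>t\<close>, and this \<open>t\<close> makes it equal to -1.\<close>
      have "0 \<le> Re a - 2 * ((Re a + 1) / (2 * (cmod b)\<^sup>2)) * (cmod b)\<^sup>2"
        using Re_q[of "(Re a + 1) / (2 * (cmod b)\<^sup>2)"] True by simp
      also have "\<dots> = - 1" using b by (simp add: field_simps)
      finally show False by simp
    qed
    then show ?thesis using True by simp
  next
    case False
    then have dp: "0 < Re d" using d by simp
    have "0 \<le> Re a - 2 * (1 / Re d) * (cmod b)\<^sup>2 + (1 / Re d)\<^sup>2 * (cmod b)\<^sup>2 * Re d" by (rule Re_q)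
    also have "\<dots> = Re a - (cmod b)\<^sup>2 / Re d" using dp by (simp add: field_simps power2_eq_square)
    finally show ?thesis using dp by (simp add: field_simps)
  qed
qed

text \<open>With an empty reference system, complete positivity specialises to positivity, and the
  channel fidelity can be tested on states of \<open>A\<close> alone.\<close>

lemma ext_empty:
  assumes "op_on A X" "op_on B (\<Phi> X)"
  shows "ext A B {} \<Phi> X = \<Phi> X"
proof -
  have r: "restr c {} = (\<lambda>_. False)" for c by (simp add: restr_def)
  have j: "join a (\<lambda>_. False) = a" for a by (simp add: join_def)
  have "block A X (\<lambda>_. False) (\<lambda>_. False) = X"
    using assms(1) by (intro ext) (auto simp: block_def j op_on_def)
  then show ?thesis
    using assms(2) by (intro ext) (auto simp: ext_def r restr_id op_on_def)
qed

section \<open>Consequences of the channel axioms and a trivial recovery\<close>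

lemma channel_op_on: "channel A B \<Phi> \<Longrightarrow> op_on A X \<Longrightarrow> op_on B (\<Phi> X)"
  by (simp add: channel_def)

lemma channel_linear:
  "channel A B \<Phi> \<Longrightarrow> op_on A X \<Longrightarrow> op_on A Y \<Longrightarrow>
    \<Phi> (\<lambda>c c'. X c c' + a * Y c c') = (\<lambda>c c'. \<Phi> X c c' + a * \<Phi> Y c c')"
  by (simp add: channel_def)

lemma channel_tr: "channel A B \<Phi> \<Longrightarrow> op_on A X \<Longrightarrow> tr B (\<Phi> X) = tr A X"
  by (simp add: channel_def)

lemma channel_psd:
  assumes c: "channel A B \<Phi>" and X: "psd A X"
  shows "psd B (\<Phi> X)"
proof -
  have "\<forall>R X. finite R \<longrightarrow> R \<inter> (A \<union> B) = {} \<longrightarrow> psd (A \<union> R) X \<longrightarrow> psd (B \<union> R) (ext A B R \<Phi> X)"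
    using c by (simp add: channel_def)
  from this[rule_format, of "{}" X] X have "psd B (ext A B {} \<Phi> X)" by simp
  then show ?thesis
    using ext_empty[of A X B \<Phi>] psd_op_on[OF X] channel_op_on[OF c] by simp
qed

text \<open>A recovery that ignores its input and outputs the zero state. Its existence keeps the
  infimum in \<open>eps_tilde\<close> from being taken over the empty set.\<close>

lemma channel_discard:
  assumes A: "finite A" and B: "finite B"
  shows "channel A B (\<lambda>X c c'. tr A X * proj zero_state c c')"
  unfolding channel_def
proof (intro conjI allI impI)
  let ?\<Phi> = "\<lambda>X c c'. tr A X * proj zero_state c c'" and ?z = "\<lambda>_. False"
  have op: "op_on B (?\<Phi> X)" for X using op_on_proj[of B zero_state] by (simp add: op_on_def)
  show "op_on B (?\<Phi> X)" for X by (rule op)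
  show "?\<Phi> (\<lambda>c c'. X c c' + a * Y c c') = (\<lambda>c c'. ?\<Phi> X c c' + a * ?\<Phi> Y c c')" for X Y a
    by (simp add: tr_def sum.distrib sum_distrib_left[symmetric] ring_distribs mult.assoc)
  show "tr B (?\<Phi> X) = tr A X" for X
  proof -
    have "tr B (?\<Phi> X) = (\<Sum>c\<in>cfgs B. if c = ?z then tr A X else 0)"
      unfolding tr_def[of B] by (intro sum.cong) (auto simp: proj_def zero_state_def)
    then show ?thesis using B by simp
  qed
  fix R X assume R: "finite R" "R \<inter> (A \<union> B) = {}" and X: "psd (A \<union> R) X"
  let ?E = "ext A B R ?\<Phi> X"
  have BR: "B \<inter> R = {}" and AR: "A \<inter> R = {}" using R by auto
  show "psd (B \<union> R) ?E"
    unfolding psd_def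
  proof (intro conjI allI impI)
    show "op_on (B \<union> R) ?E" by (auto simp: op_on_def ext_def)
    fix x assume "vec_on (B \<union> R) x"
    \<comment> \<open>The reduced operator of \<open>X\<close> on the reference system; the extended
      channel outputs the zero state tensored with it.\<close>
    define M where "M = (\<lambda>r r'. \<Sum>a\<in>cfgs A. X (join a r) (join a r'))"
    have E: "?E (join b r) (join b' r') = (if b = ?z \<and> b' = ?z then M r r' else 0)"
      if "b \<in> cfgs B" "b' \<in> cfgs B" "r \<in> cfgs R" "r' \<in> cfgs R" for b b' r r'
      using that join_in_cfgs[of _ B _ R] restr_join[of _ B _ R] BR
      by (simp add: ext_def block_def tr_def M_def proj_def zero_state_def)
    have zj: "join ?z r = r" for r by (simp add: join_def)
    have ap: "app (B \<union> R) ?E x (join b r) = (if b = ?z then \<Sum>r'\<in>cfgs R. M r r' * x r' else 0)"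
      if "b \<in> cfgs B" "r \<in> cfgs R" for b r
    proof -
      have "app (B \<union> R) ?E x (join b r)
          = (\<Sum>b'\<in>cfgs B. \<Sum>r'\<in>cfgs R. ?E (join b r) (join b' r') * x (join b' r'))"
        using join_in_cfgs[OF that] by (simp add: app_def sum_cfgs_Un[OF BR])
      also have "\<dots> = (\<Sum>b'\<in>cfgs B. if b' = ?z then
          (if b = ?z then \<Sum>r'\<in>cfgs R. M r r' * x (join b' r') else 0) else 0)"
        using that by (intro sum.cong) (auto simp: E)
      also have "\<dots> = (if b = ?z then \<Sum>r'\<in>cfgs R. M r r' * x r' else 0)"
        using B by (simp add: zj)
      finally show ?thesis .
    qed
    have "inner (B \<union> R) x (app (B \<union> R) ?E x)
        = (\<Sum>b\<in>cfgs B. \<Sum>r\<in>cfgs R. cnj (x (join b r)) * app (B \<union> R) ?E x (join b r))"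
      by (simp add: inner_def sum_cfgs_Un[OF BR])
    also have "\<dots> = (\<Sum>b\<in>cfgs B. if b = ?z then
        \<Sum>r\<in>cfgs R. cnj (x (join b r)) * (\<Sum>r'\<in>cfgs R. M r r' * x r') else 0)"
      by (intro sum.cong) (auto simp: ap)
    also have "\<dots> = (\<Sum>r\<in>cfgs R. cnj (x r) * (\<Sum>r'\<in>cfgs R. M r r' * x r'))"
      using B by (simp add: zj)
    also have "\<dots> = (\<Sum>r\<in>cfgs R. \<Sum>r'\<in>cfgs R. \<Sum>a\<in>cfgs A.
        cnj (x r) * (X (join a r) (join a r') * x r'))"
      by (simp add: M_def sum_distrib_left sum_distrib_right)
    also have "\<dots> = (\<Sum>r\<in>cfgs R. \<Sum>a\<in>cfgs A. \<Sum>r'\<in>cfgs R.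
        cnj (x r) * (X (join a r) (join a r') * x r'))"
      by (intro sum.cong refl sum.swap)
    also have "\<dots> = (\<Sum>a\<in>cfgs A. \<Sum>r\<in>cfgs R. \<Sum>r'\<in>cfgs R.
        cnj (x r) * (X (join a r) (join a r') * x r'))"
      by (rule sum.swap)
    finally have q: "inner (B \<union> R) x (app (B \<union> R) ?E x) = (\<Sum>a\<in>cfgs A. \<Sum>r\<in>cfgs R. \<Sum>r'\<in>cfgs R.
        cnj (x r) * (X (join a r) (join a r') * x r'))" .
    define g where "g = (\<lambda>a. \<Sum>r\<in>cfgs R. \<Sum>r'\<in>cfgs R. cnj (x r) * (X (join a r) (join a r') * x r'))"
    have pos: "Im (g a) = 0 \<and> 0 \<le> Re (g a)"
      if a: "a \<in> cfgs A" for a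
    proof -
      \<comment> \<open>The basis state \<open>a\<close> on \<open>A\<close> tensored with the part
        of \<open>x\<close> living on \<open>R\<close>: the expectation of \<open>X\<close> in it is
        the summand \<open>g a\<close>.\<close>
      define y where "y = (\<lambda>c. if c \<in> cfgs (A \<union> R) \<and> restr c A = a then x (restr c R) else 0)"
      have y: "vec_on (A \<union> R) y" by (simp add: vec_on_def y_def)
      have yj: "y (join a' r) = (if a' = a then x r else 0)" if "a' \<in> cfgs A" "r \<in> cfgs R" for a' r
        using join_in_cfgs[OF that] restr_join[OF that AR] by (auto simp: y_def)
      have ay: "app (A \<union> R) X y (join a r) = (\<Sum>r'\<in>cfgs R. X (join a r) (join a r') * x r')"
        if "r \<in> cfgs R" for r
      proof -
        have "app (A \<union> R) X y (join a r)
            = (\<Sum>a'\<in>cfgs A. \<Sum>r'\<in>cfgs R. X (join a r) (join a' r') * y (join a' r'))"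
          using join_in_cfgs[OF a that] by (simp add: app_def sum_cfgs_Un[OF AR])
        also have "\<dots> = (\<Sum>a'\<in>cfgs A. if a' = a then
            \<Sum>r'\<in>cfgs R. X (join a r) (join a' r') * x r' else 0)"
          by (intro sum.cong) (auto simp: yj)
        finally show ?thesis using A a by simp
      qed
      have "inner (A \<union> R) y (app (A \<union> R) X y)
          = (\<Sum>a'\<in>cfgs A. \<Sum>r\<in>cfgs R. cnj (y (join a' r)) * app (A \<union> R) X y (join a' r))"
        by (simp add: inner_def sum_cfgs_Un[OF AR])
      also have "\<dots> = (\<Sum>a'\<in>cfgs A. if a' = a then
          \<Sum>r\<in>cfgs R. cnj (x r) * app (A \<union> R) X y (join a' r) else 0)"
        by (intro sum.cong) (auto simp: yj)
      also have "\<dots> = (\<Sum>r\<in>cfgs R. \<Sum>r'\<in>cfgs R. cnj (x r) * (X (join a r) (join a r') * x r'))"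
        using A a by (simp add: ay sum_distrib_left)
      finally have "inner (A \<union> R) y (app (A \<union> R) X y) = g a" by (simp only: g_def)
      then show ?thesis using X y by (metis psd_def)
    qed
    show "Im (inner (B \<union> R) x (app (B \<union> R) ?E x)) = 0" "0 \<le> Re (inner (B \<union> R) x (app (B \<union> R) ?E x))"
      using q pos unfolding g_def[symmetric] by (simp_all add: sum_nonneg)
  qed
qed

lemma app_opadd: "app S (\<lambda>c c'. A c c' + a * B c c') v = (\<lambda>c. app S A v c + a * app S B v c)"
  unfolding app_def by (rule ext) (simp add: ring_distribs sum.distrib sum_distrib_left mult_ac)

text \<open>Erasure followed by recovery, read out in \<phi>, is a positive form q bounded by the
  trace. The vector u = W x is erased to the same state as x, so q nearly exhausts the norm of u; y
  is recovered as \<chi>, orthogonal to \<phi>, so q nearly vanishes on y. Cauchy-Schwarz for q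
  bounds its share of the inner product of u and y by e, and Cauchy-Schwarz for the complementary
  form bounds the rest by e.\<close>

lemma recovery_overlap:
  assumes P: "finite P" "S \<subseteq> P" and L: "finite L" "2 \<le> card (cfgs L)"
    and g: "density S \<gamma>" and rec: "channel P L \<R>" and W: "supported_unitary P S W"
    and x: "vec_on P x" "inner P x x = 1" and y: "vec_on P y" "inner P y y = 1"
    and f: "vec_on L \<phi>" "inner L \<phi> \<phi> = 1" and h: "vec_on L \<chi>" "inner L \<chi> \<chi> = 1"
    and fh: "inner L \<phi> \<chi> = 0" and e: "0 \<le> e"
    and recf: "1 - e\<^sup>2 \<le> Re (inner L \<phi> (app L (\<R> (replacement P S \<gamma> (proj x))) \<phi>))"
    and rech: "1 - e\<^sup>2 \<le> Re (inner L \<chi> (app L (\<R> (replacement P S \<gamma> (proj y))) \<chi>))"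
  shows "cmod (inner P (app P W x) y) \<le> 2 * e"
proof -
  define T where "T = (\<lambda>X. \<R> (replacement P S \<gamma> X))"
  define q where "q = (\<lambda>X. inner L \<phi> (app L (T X) \<phi>))"
  define u where "u = app P W x"
  have u: "vec_on P u" by (simp add: u_def)
  obtain w where w: "unitary S w" "W = lift P S w" using W unfolding supported_unitary_def by blast
  have uu: "inner P u u = 1"
    using inner_unitary[OF P(1) unitary_lift[OF P w(1)] x(1)] x(2) w(2) by (simp add: u_def)
  have psdg: "psd S \<gamma>" and trg: "tr S \<gamma> = 1" using g by (auto simp: density_def)
  have Tlin: "T (\<lambda>c c'. X c c' + a * Y c c') = (\<lambda>c c'. T X c c' + a * T Y c c')" for X Y a
    unfolding T_def replacement_linear
    by (rule channel_linear[OF rec]) (simp_all add: op_on_replacement[OF P(2)])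
  have qlin: "q (\<lambda>c c'. X c c' + a * Y c c') = q X + a * q Y" for X Y a
    by (simp add: q_def Tlin app_opadd inner_add_right inner_scale_right)
  have Tpsd: "psd L (T (proj v))" for v
    unfolding T_def by (rule channel_psd[OF rec psd_replacement_proj[OF P psdg]])
  have Ttr: "tr L (T X) = tr P X" for X
    unfolding T_def
    using channel_tr[OF rec op_on_replacement[OF P(2)]] tr_replacement[OF P trg] by simp
  have qpos: "Im (q (proj v)) = 0" "0 \<le> Re (q (proj v))" for v
    using Tpsd[of v] f(1) by (auto simp: psd_def q_def)
  have qle: "Re (q (proj v)) \<le> Re (inner P v v)" for v
    using psd_expectation_le_tr[OF L(1) Tpsd f, of v] Ttr[of "proj v"] tr_ketbra[of P v v]
    by (simp add: q_def ketbra_self)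
  have qz: "q (proj (\<lambda>c. u c + z * y c))
      = q (proj u) + z * q (ketbra y u) + cnj z * q (ketbra u y) + z * cnj z * q (proj y)" for z
  proof -
    define X2 where "X2 = (\<lambda>c c'. proj u c c' + z * ketbra y u c c')"
    define X3 where "X3 = (\<lambda>c c'. X2 c c' + cnj z * ketbra u y c c')"
    have "proj (\<lambda>c. u c + z * y c) = (\<lambda>c c'. X3 c c' + (z * cnj z) * proj y c c')"
      by (intro ext) (simp add: X3_def X2_def proj_def ketbra_def ring_distribs mult_ac)
    then have "q (proj (\<lambda>c. u c + z * y c)) = q X3 + (z * cnj z) * q (proj y)"
      by (simp only: qlin[of X3 "z * cnj z" "proj y"])
    also have "q X3 = q X2 + cnj z * q (ketbra u y)" unfolding X3_def by (rule qlin)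
    also have "q X2 = q (proj u) + z * q (ketbra y u)" unfolding X2_def by (rule qlin)
    finally show ?thesis .
  qed
  have iz: "inner P (\<lambda>c. u c + z * y c) (\<lambda>c. u c + z * y c)
      = inner P u u + z * inner P u y + cnj z * inner P y u + z * cnj z * inner P y y" for z
    by (simp add: inner_add_left inner_add_right inner_scale_left inner_scale_right ring_distribs mult_ac)
  have qu: "Re (q (proj u)) \<ge> 1 - e\<^sup>2"
    using recf unfolding q_def T_def u_def replacement_absorbs_unitary[OF P W x(1)] .
  \<comment> \<open>\<phi> and \<chi> are orthonormal and the recovered state has trace 1, so a
    large weight on \<chi> limits the weight on \<phi>.\<close>
  have qy: "Re (q (proj y)) \<le> e\<^sup>2"
  proof -
    define b where "b = (\<lambda>i::nat. if i = 0 then \<phi> else \<chi>)"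
    have "inner L \<chi> \<phi> = 0" using fh cnj_inner[of L \<phi> \<chi>] by simp
    then have "orthonormal L 2 b" using f h fh by (auto simp: orthonormal_def b_def less_2_cases_iff)
    from psd_expectations_le_tr[OF L(1) Tpsd this L(2), of y]
    have "Re (q (proj y)) + Re (inner L \<chi> (app L (T (proj y)) \<chi>)) \<le> 1"
      using Ttr[of "proj y"] tr_ketbra[of P y y] y(2)
      by (simp add: b_def q_def ketbra_self numeral_2_eq_2)
    then show ?thesis using rech by (simp add: T_def)
  qed
  have "(cmod (q (ketbra y u)))\<^sup>2 \<le> Re (q (proj u)) * Re (q (proj y))"
  proof (rule form_Cauchy_Schwarz)
    show "Im (q (proj u) + z * q (ketbra y u) + cnj z * q (ketbra u y) + z * cnj z * q (proj y)) = 0 \<and>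
      0 \<le> Re (q (proj u) + z * q (ketbra y u) + cnj z * q (ketbra u y) + z * cnj z * q (proj y))" for z
      unfolding qz[symmetric] using qpos by blast
  qed (rule qpos)
  also have "\<dots> \<le> 1 * e\<^sup>2"
    using qle[of u] uu qy qpos by (intro mult_mono) auto
  finally have 1: "cmod (q (ketbra y u)) \<le> e" by (intro power2_le_imp_le[OF _ e]) simp
  \<comment> \<open>The inner product minus q is again a positive form, by \<open>qle\<close>; for
    this one it is u that has small weight.\<close>
  have "(cmod (inner P u y - q (ketbra y u)))\<^sup>2
      \<le> Re (inner P u u - q (proj u)) * Re (inner P y y - q (proj y))"
  proof (rule form_Cauchy_Schwarz[where c = "inner P y u - q (ketbra u y)"])
    fix z
    let ?v = "\<lambda>c. u c + z * y c"
    have "inner P u u - q (proj u) + z * (inner P u y - q (ketbra y u))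
        + cnj z * (inner P y u - q (ketbra u y)) + z * cnj z * (inner P y y - q (proj y))
      = inner P ?v ?v - q (proj ?v)"
      unfolding iz qz by (simp add: algebra_simps)
    moreover have "Im (inner P ?v ?v) = 0" by (simp add: inner_self del: of_real_sum)
    ultimately show "Im (inner P u u - q (proj u) + z * (inner P u y - q (ketbra y u))
        + cnj z * (inner P y u - q (ketbra u y)) + z * cnj z * (inner P y y - q (proj y))) = 0 \<and>
      0 \<le> Re (inner P u u - q (proj u) + z * (inner P u y - q (ketbra y u))
        + cnj z * (inner P y u - q (ketbra u y)) + z * cnj z * (inner P y y - q (proj y)))"
      using qpos qle[of ?v] by simp
  qed (use qle[of y] in simp)
  also have "\<dots> \<le> e\<^sup>2 * 1"
    using qu qle[of u] qle[of y] uu y(2) qpos by (intro mult_mono) auto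
  finally have 2: "cmod (inner P u y - q (ketbra y u)) \<le> e" by (intro power2_le_imp_le[OF _ e]) simp
  have "cmod (inner P u y) \<le> cmod (inner P u y - q (ketbra y u)) + cmod (q (ketbra y u))"
    by (metis diff_add_cancel norm_triangle_ineq)
  then show ?thesis using 1 2 by (simp add: u_def)
qed

section \<open>Code states against the maximally mixed code state\<close>

definition enc :: "label set \<Rightarrow> op \<Rightarrow> vec \<Rightarrow> vec" where
  "enc L V \<phi> = (\<lambda>p. \<Sum>l\<in>cfgs L. V p l * \<phi> l)"

definition col :: "op \<Rightarrow> cfg \<Rightarrow> vec" where
  "col V l = (\<lambda>p. V p l)"

lemma vec_on_enc: "isometry L P V \<Longrightarrow> vec_on P (enc L V \<phi>)"
  by (simp add: isometry_def vec_on_def enc_def)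

lemma vec_on_col: "isometry L P V \<Longrightarrow> vec_on P (col V l)"
  by (simp add: isometry_def vec_on_def col_def)

lemma inner_col:
  "isometry L P V \<Longrightarrow> l \<in> cfgs L \<Longrightarrow> l' \<in> cfgs L \<Longrightarrow> inner P (col V l) (col V l') = (if l = l' then 1 else 0)"
  by (simp add: isometry_def inner_def col_def)

lemma enc_eq_col: "enc L V \<phi> = (\<lambda>p. \<Sum>l\<in>cfgs L. \<phi> l * col V l p)"
  by (simp add: enc_def col_def mult.commute)

lemma inner_sum_left:
  "inner S (\<lambda>c. \<Sum>j\<in>J. f j c) u = (\<Sum>j\<in>J. inner S (f j) u)"
  unfolding inner_def by (simp add: sum_distrib_right, rule sum.swap)

lemma inner_enc_app:
  "inner P (enc L V \<phi>) (app P W (enc L V \<chi>))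
    = (\<Sum>l\<in>cfgs L. \<Sum>l'\<in>cfgs L. cnj (\<phi> l) * (inner P (col V l) (app P W (col V l')) * \<chi> l'))"
  unfolding enc_eq_col app_sum app_scale inner_sum_left inner_sum_right inner_scale_left inner_scale_right
  by (simp add: mult_ac sum_distrib_left)

lemma inner_enc:
  assumes V: "isometry L P V" and L: "finite L"
  shows "inner P (enc L V \<phi>) (enc L V \<chi>) = inner L \<phi> \<chi>"
proof -
  have "inner P (enc L V \<phi>) (enc L V \<chi>)
      = (\<Sum>l\<in>cfgs L. \<Sum>l'\<in>cfgs L. cnj (\<phi> l) * (\<chi> l' * inner P (col V l) (col V l')))"
    unfolding enc_eq_col inner_sum_left inner_sum_right inner_scale_left inner_scale_right
    by (simp add: mult_ac sum_distrib_left)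
  also have "\<dots> = (\<Sum>l\<in>cfgs L. \<Sum>l'\<in>cfgs L. if l' = l then cnj (\<phi> l) * \<chi> l else 0)"
    by (intro sum.cong refl) (auto simp: inner_col[OF V])
  also have "\<dots> = inner L \<phi> \<chi>" using L by (simp add: inner_def)
  finally show ?thesis .
qed

lemma encode_proj: "encode L V (proj \<phi>) = proj (enc L V \<phi>)"
  by (intro ext) (simp add: encode_def proj_def enc_def sum_product mult_ac)

text \<open>The expectation of \<open>W\<close> in the maximally mixed code state, written with the
  columns of \<open>V\<close> as the basis of the code.\<close>

definition mixed_exp :: "label set \<Rightarrow> label set \<Rightarrow> op \<Rightarrow> op \<Rightarrow> complex" where
  "mixed_exp L P V W = (\<Sum>l\<in>cfgs L. inner P (col V l) (app P W (col V l))) / of_nat (card (cfgs L))"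

lemma finite_logi [simp]: "finite (logi k)"
  by (simp add: logi_def)

lemma card_cfgs_logi: "card (cfgs (logi k)) = 2 ^ k"
  by (simp add: card_cfgs logi_def card_image inj_on_def)

lemma tr_mmult_Gamma:
  assumes "isometry (logi k) (phys Ls) V"
  shows "tr (phys Ls) (mmult (phys Ls) W (Gamma Ls k V)) = mixed_exp (logi k) (phys Ls) V W"
proof -
  let ?P = "phys Ls" and ?L = "logi k"
  have "tr ?P (mmult ?P W (Gamma Ls k V))
      = (\<Sum>c\<in>cfgs ?P. \<Sum>e\<in>cfgs ?P. \<Sum>l\<in>cfgs ?L. W c e * proj (col V l) e c / 2 ^ k)"
    by (simp add: tr_def mmult_def Gamma_def proj_def col_def sum_distrib_left sum_divide_distrib)
  also have "\<dots> = (\<Sum>c\<in>cfgs ?P. \<Sum>l\<in>cfgs ?L. \<Sum>e\<in>cfgs ?P. W c e * proj (col V l) e c / 2 ^ k)"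
    by (intro sum.cong refl sum.swap)
  also have "\<dots> = (\<Sum>l\<in>cfgs ?L. \<Sum>c\<in>cfgs ?P. \<Sum>e\<in>cfgs ?P. W c e * proj (col V l) e c / 2 ^ k)"
    by (rule sum.swap)
  also have "\<dots> = (\<Sum>l\<in>cfgs ?L. tr ?P (mmult ?P W (proj (col V l))) / 2 ^ k)"
    by (simp add: tr_def mmult_def sum_divide_distrib)
  also have "\<dots> = mixed_exp ?L ?P V W"
    by (simp add: tr_mmult_proj[OF vec_on_col[OF assms]] mixed_exp_def card_cfgs_logi sum_divide_distrib)
  finally show ?thesis .
qed

text \<open>The sum is the trace of \<open>W\<close> compressed to the logical register, hence the
  same in every orthonormal basis. This allows a basis that contains a given code state.\<close>

lemma mixed_exp_orthonormal:
  assumes L: "finite L" and f: "orthonormal L (card (cfgs L)) f"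
  shows "mixed_exp L P V W
    = (\<Sum>i<card (cfgs L). inner P (enc L V (f i)) (app P W (enc L V (f i)))) / of_nat (card (cfgs L))"
proof -
  define A where "A = (\<lambda>l l'. inner P (col V l) (app P W (col V l')))"
  have "inner P (enc L V g) (app P W (enc L V g)) = inner L g (app L A g)" for g
    by (simp add: inner_enc_app A_def inner_def[of L] app_def[of L] sum_distrib_left)
  then show ?thesis
    using tr_orthonormal[OF L f, of A] by (simp add: mixed_exp_def tr_def A_def)
qed

subsection \<open>Bounds through the local distinguishability\<close>

lemma tr_mmult_opdiff: "tr S (mmult S W (opdiff A B)) = tr S (mmult S W A) - tr S (mmult S W B)"
  by (simp add: tr_def mmult_def opdiff_def right_diff_distrib sum_subtractf)

lemma ptrace_opdiff: "ptrace S T (opdiff A B) = opdiff (ptrace S T A) (ptrace S T B)"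
  by (intro ext) (simp add: ptrace_def opdiff_def sum_subtractf)

lemma phys_Diff: "Site ` (box Ls - S) = phys Ls - Site ` S"
  by (auto simp: phys_def)

lemma pure_exp_diff_le_tnorm:
  assumes S: "finite S" and W: "unitary S W" and uv: "vec_on S u" "vec_on S v"
  shows "Re (inner S u (app S W u)) - Re (inner S v (app S W v)) \<le> tnorm S (opdiff (proj u) (proj v))"
  using tnorm_ge_tr_unitary[OF S W, of "opdiff (proj u) (proj v)"]
  by (simp add: tr_mmult_opdiff tr_mmult_proj uv)

lemma code_state_enc:
  assumes V: "isometry (logi k) (phys Ls) V" and \<psi>: "code_state Ls k V \<psi>"
  obtains \<phi> where "vec_on (logi k) \<phi>" "\<psi> = enc (logi k) V \<phi>" "inner (logi k) \<phi> \<phi> = 1"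
proof -
  obtain \<phi> where \<phi>: "vec_on (logi k) \<phi>" "\<psi> = enc (logi k) V \<phi>" "vnorm (phys Ls) \<psi> = 1"
    using \<psi> unfolding code_state_def enc_def by blast
  then have "inner (logi k) \<phi> \<phi> = 1"
    using inner_enc[OF V finite_logi, of \<phi> \<phi>] by (simp add: vnorm_eq_1_iff)
  then show ?thesis using that \<phi> by blast
qed

lemma norm_le_1_of_unit:
  assumes "finite S" "inner S v v = 1" "vec_on S v"
  shows "cmod (v c) \<le> 1"
proof (cases "c \<in> cfgs S")
  case True
  have "(cmod (v c))\<^sup>2 \<le> (\<Sum>c\<in>cfgs S. (cmod (v c))\<^sup>2)"
    using assms True by (intro member_le_sum) auto
  also have "\<dots> = 1" using assms Re_inner_self[of S v] by simp
  finally show ?thesis by (simp add: power2_le_imp_le)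
qed (use assms in \<open>simp add: vec_on_def\<close>)

text \<open>A real supremum bounds its members only over a bounded set. The constant
  \<open>M\<close> depends on the lattice and the code alone: entries of the reduced operators are
  sums of at most \<open>K\<close> entries, bounded by 1 for \<psi> and by \<open>g\<close> for the
  mixed state.\<close>

lemma bdd_above_eps_code:
  assumes V: "isometry (logi k) (phys Ls) V"
  shows "bdd_above {tnorm (Site ` S) (opdiff (reduced Ls S (proj \<psi>)) (reduced Ls S (Gamma Ls k V))) | \<psi> S.
       code_state Ls k V \<psi> \<and> S \<subseteq> box Ls \<and> lconnected S \<and> card S \<le> d}"
proof -
  let ?P = "phys Ls" and ?G = "Gamma Ls k V"
  define K where "K = real (card (cfgs ?P))"
  define g where "g = (\<Sum>c\<in>cfgs ?P. \<Sum>c'\<in>cfgs ?P. cmod (?G c c'))"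
  define M where "M = K + K * (K * (K * (1 + g))\<^sup>2)"
  have "tnorm (Site ` S) (opdiff (reduced Ls S (proj \<psi>)) (reduced Ls S ?G)) \<le> M"
    if \<psi>: "code_state Ls k V \<psi>" and S: "S \<subseteq> box Ls" for \<psi> S
  proof -
    let ?S = "Site ` S" and ?A = "opdiff (reduced Ls S (proj \<psi>)) (reduced Ls S ?G)"
    have SP: "?S \<subseteq> ?P" using S by (auto simp: phys_def)
    have fS: "finite ?S" using SP finite_subset[OF _ finite_phys] by blast
    obtain \<phi> where \<phi>: "\<psi> = enc (logi k) V \<phi>" "inner (logi k) \<phi> \<phi> = 1"
      using code_state_enc[OF V \<psi>] by blast
    have v: "vec_on ?P \<psi>" "inner ?P \<psi> \<psi> = 1"
      using \<phi> by (auto simp: vec_on_enc[OF V] inner_enc[OF V])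
    have p1: "cmod (proj \<psi> c c') \<le> 1" for c c'
      using norm_le_1_of_unit[OF finite_phys v(2,1)]
      by (simp add: proj_def norm_mult mult_le_one)
    have g1: "cmod (?G c c') \<le> g" if "c \<in> cfgs ?P" "c' \<in> cfgs ?P" for c c'
    proof -
      have "cmod (?G c c') \<le> (\<Sum>c'\<in>cfgs ?P. cmod (?G c c'))"
        using that by (intro member_le_sum) auto
      also have "\<dots> \<le> g" unfolding g_def using that by (intro member_le_sum[of c]) (auto intro: sum_nonneg)
      finally show ?thesis .
    qed
    have cS: "real (card (cfgs ?S)) \<le> K" and cT: "real (card (cfgs (?P - ?S))) \<le> K"
      unfolding K_def using SP by (auto intro!: card_mono cfgs_mono)
    have g0: "0 \<le> g" unfolding g_def by (intro sum_nonneg) auto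
    have K0: "0 \<le> K" by (simp add: K_def)
    have entry: "cmod (?A c c') \<le> K * (1 + g)" if c: "c \<in> cfgs ?S" "c' \<in> cfgs ?S" for c c'
    proof -
      have "?A c c' = (\<Sum>t\<in>cfgs (?P - ?S). proj \<psi> (join c t) (join c' t) - ?G (join c t) (join c' t))"
        using c by (simp add: opdiff_def reduced_def ptrace_def phys_Diff sum_subtractf)
      also have "cmod \<dots> \<le> (\<Sum>t\<in>cfgs (?P - ?S). 1 + g)"
      proof (rule order_trans[OF norm_sum], intro sum_mono)
        fix t assume t: "t \<in> cfgs (?P - ?S)"
        have "cmod (proj \<psi> (join c t) (join c' t) - ?G (join c t) (join c' t))
            \<le> cmod (proj \<psi> (join c t) (join c' t)) + cmod (?G (join c t) (join c' t))"
          by (rule norm_triangle_ineq4)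
        also have "\<dots> \<le> 1 + g"
          using p1 g1[of "join c t" "join c' t"] join_in_cfgs_Diff[OF SP _ t] c by (intro add_mono) auto
        finally show "cmod (proj \<psi> (join c t) (join c' t) - ?G (join c t) (join c' t)) \<le> 1 + g" .
      qed
      also have "\<dots> \<le> K * (1 + g)" using cT g0 by (simp add: mult_right_mono)
      finally show ?thesis .
    qed
    have "tnorm ?S ?A \<le> real (card (cfgs ?S)) + (\<Sum>c\<in>cfgs ?S. \<Sum>c'\<in>cfgs ?S. (cmod (?A c' c))\<^sup>2)"
      by (rule tnorm_upper_bound[OF fS])
    also have "\<dots> \<le> real (card (cfgs ?S)) + (\<Sum>c\<in>cfgs ?S. \<Sum>c'\<in>cfgs ?S. (K * (1 + g))\<^sup>2)"
      using entry by (intro add_left_mono sum_mono power_mono) auto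
    also have "\<dots> = real (card (cfgs ?S)) + real (card (cfgs ?S)) * (real (card (cfgs ?S)) * (K * (1 + g))\<^sup>2)"
      by simp
    also have "\<dots> \<le> M"
      unfolding M_def using cS K0 by (intro add_mono mult_mono) auto
    finally show ?thesis .
  qed
  then show ?thesis by (intro bdd_aboveI[of _ M]) blast
qed

lemma code_exp_diff_le_eps_code:
  assumes V: "isometry (logi k) (phys Ls) V" and \<psi>: "code_state Ls k V \<psi>"
    and S: "S \<subseteq> box Ls" "lconnected S" "card S \<le> d"
    and W: "supported_unitary (phys Ls) (Site ` S) W"
  shows "Re (inner (phys Ls) \<psi> (app (phys Ls) W \<psi>)) - Re (mixed_exp (logi k) (phys Ls) V W)
    \<le> eps_code Ls k V d"
proof -
  let ?P = "phys Ls" and ?S = "Site ` S" and ?G = "Gamma Ls k V"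
  have SP: "?S \<subseteq> ?P" using S by (auto simp: phys_def)
  have fS: "finite ?S" using SP finite_subset[OF _ finite_phys] by blast
  obtain w where w: "unitary ?S w" "W = lift ?P ?S w" using W unfolding supported_unitary_def by blast
  obtain \<phi> where "\<psi> = enc (logi k) V \<phi>" using code_state_enc[OF V \<psi>] by blast
  then have v: "vec_on ?P \<psi>" using vec_on_enc[OF V] by simp
  have "Re (inner ?P \<psi> (app ?P W \<psi>)) - Re (mixed_exp (logi k) ?P V W)
      = Re (tr ?P (mmult ?P W (opdiff (proj \<psi>) ?G)))"
    by (simp add: tr_mmult_opdiff tr_mmult_proj[OF v] tr_mmult_Gamma[OF V])
  also have "\<dots> = Re (tr ?S (mmult ?S w (opdiff (reduced Ls S (proj \<psi>)) (reduced Ls S ?G))))"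
    by (simp add: w tr_lift[OF finite_phys SP] ptrace_opdiff reduced_def phys_Diff)
  also have "\<dots> \<le> tnorm ?S (opdiff (reduced Ls S (proj \<psi>)) (reduced Ls S ?G))"
    by (rule tnorm_ge_tr_unitary[OF fS w(1)])
  also have "\<dots> \<le> eps_code Ls k V d"
    unfolding eps_code_def using \<psi> S by (intro cSup_upper bdd_above_eps_code[OF V]) blast
  finally show ?thesis .
qed

subsection \<open>Bounds through recovery from erasure\<close>

text \<open>The infimum is tested with an empty reference system and the pure input
  \<open>proj \<phi>\<close>, where the fidelity is the square root of \<open>x\<close>.\<close>

lemma chan_fid_pure_bounds:
  assumes P: "finite P" "S \<subseteq> P" and L: "finite L" and g: "density S \<gamma>" and rec: "channel P L \<R>"
    and V: "isometry L P V" and f: "vec_on L \<phi>" "inner L \<phi> \<phi> = 1"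
    and F_def: "F = chan_fid L (\<R> \<circ> replacement P S \<gamma> \<circ> encode L V) id"
    and x_def: "x = Re (inner L \<phi> (app L (\<R> (replacement P S \<gamma> (proj (enc L V \<phi>)))) \<phi>))"
  shows "0 \<le> F" "F\<^sup>2 \<le> x" "x \<le> 1"
proof -
  let ?\<Phi> = "\<R> \<circ> replacement P S \<gamma> \<circ> encode L V"
  have psdg: "psd S \<gamma>" and trg: "tr S \<gamma> = 1" using g by (auto simp: density_def)
  define \<tau> where "\<tau> = \<R> (replacement P S \<gamma> (proj (enc L V \<phi>)))"
  have T: "psd L \<tau>"
    unfolding \<tau>_def by (rule channel_psd[OF rec psd_replacement_proj[OF P psdg]])
  have "tr L \<tau> = inner P (enc L V \<phi>) (enc L V \<phi>)"
    unfolding \<tau>_def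
    using channel_tr[OF rec op_on_replacement[OF P(2)]] tr_replacement[OF P trg]
    by (simp add: tr_ketbra ketbra_self[symmetric])
  then have trT: "tr L \<tau> = 1" using inner_enc[OF V L] f by simp
  have \<Phi>: "?\<Phi> (proj \<phi>) = \<tau>" by (simp add: encode_proj \<tau>_def)
  have opp: "op_on L (proj \<phi>)" by (rule op_on_proj[OF f(1)])
  have "fid (L \<union> {}) (ext L L {} ?\<Phi> (proj \<phi>)) (ext L L {} id (proj \<phi>)) = fid L \<tau> (proj \<phi>)"
    using ext_empty[OF opp, of L ?\<Phi>] ext_empty[OF opp, of L id] psd_op_on[OF T] opp \<Phi> by simp
  also have "\<dots> = sqrt x" using fid_pure[OF L T f] by (simp add: x_def \<tau>_def)
  finally have fx: "fid (L \<union> {}) (ext L L {} ?\<Phi> (proj \<phi>)) (ext L L {} id (proj \<phi>)) = sqrt x" .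
  let ?A = "{fid (L \<union> R) (ext L L R ?\<Phi> \<rho>) (ext L L R id \<rho>) | R \<rho>.
       finite R \<and> R \<inter> L = {} \<and> density (L \<union> R) \<rho>}"
  have "tr L (proj \<phi>) = 1" using f(2) tr_ketbra[of L \<phi> \<phi>] by (simp add: ketbra_self)
  then have "density (L \<union> {}) (proj \<phi>)" using psd_proj[OF f(1)] by (simp add: density_def)
  then have "finite {} \<and> {} \<inter> L = {} \<and> density (L \<union> {}) (proj \<phi>)" by simp
  then have mem: "sqrt x \<in> ?A" using fx by (metis (mono_tags, lifting) mem_Collect_eq)
  have low: "0 \<le> y" if "y \<in> ?A" for y using that L fid_nonneg by auto
  show F0: "0 \<le> F" unfolding F_def chan_fid_def using mem low by (intro cInf_greatest) auto
  have x0: "0 \<le> x" using T f(1) by (simp add: psd_def x_def \<tau>_def)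
  have "F \<le> sqrt x"
    unfolding F_def chan_fid_def using mem low by (intro cInf_lower bdd_belowI[of _ 0]) auto
  then have "F\<^sup>2 \<le> (sqrt x)\<^sup>2" using F0 by (intro power_mono)
  then show "F\<^sup>2 \<le> x" using x0 by simp
  show "x \<le> 1" using psd_expectation_le_tr[OF L T f] trT by (simp add: x_def \<tau>_def)
qed

lemma pdist_bounds:
  assumes P: "finite P" "S \<subseteq> P" and L: "finite L" and g: "density S \<gamma>" and rec: "channel P L \<R>"
    and V: "isometry L P V"
    and p_def: "p = pdist L (\<R> \<circ> replacement P S \<gamma> \<circ> encode L V) id"
  shows "0 \<le> p" "p \<le> 1"
    and "vec_on L \<phi> \<Longrightarrow> inner L \<phi> \<phi> = 1 \<Longrightarrow>
      1 - p\<^sup>2 \<le> Re (inner L \<phi> (app L (\<R> (replacement P S \<gamma> (proj (enc L V \<phi>)))) \<phi>))"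
proof -
  let ?F = "chan_fid L (\<R> \<circ> replacement P S \<gamma> \<circ> encode L V) id"
  have p: "p = sqrt (1 - ?F\<^sup>2)" by (simp add: p_def pdist_def)
  \<comment> \<open>One unit vector has to be fed in to see that the radicand in \<open>p\<close> is
    nonnegative; the zero state exists on every register.\<close>
  have z: "inner L zero_state zero_state = 1"
    using inner_unit_vec[OF L zero_in_cfgs, of zero_state] by (simp add: zero_state_def)
  note b = chan_fid_pure_bounds[OF P L g rec V vec_on_zero_state z refl refl]
  have F1: "?F\<^sup>2 \<le> 1" using b by linarith
  show "0 \<le> p" "p \<le> 1" using F1 by (simp_all add: p)
  assume "vec_on L \<phi>" "inner L \<phi> \<phi> = 1"
  from chan_fid_pure_bounds(2)[OF P L g rec V this refl refl]
  show "1 - p\<^sup>2 \<le> Re (inner L \<phi> (app L (\<R> (replacement P S \<gamma> (proj (enc L V \<phi>)))) \<phi>))"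
    using F1 by (simp add: p)
qed

context
  fixes Ls :: "nat list" and k :: nat and V :: op
  assumes V: "isometry (logi k) (phys Ls) V"
begin

text \<open>The distances lie in the unit interval and at least one recovery exists. The upper bound
  feeds the supremum over replacement channels; the last claim supplies an actual recovery in place
  of the infimum.\<close>

lemma eps_tilde_le_1:
  assumes S: "S \<subseteq> box Ls" and N: "is_replacement (phys Ls) (Site ` S) N"
  shows "0 \<le> eps_tilde Ls k V N" "eps_tilde Ls k V N \<le> 1"
    "eps_tilde Ls k V N < e \<Longrightarrow>
      \<exists>\<R>. channel (phys Ls) (logi k) \<R> \<and> pdist (logi k) (\<R> \<circ> N \<circ> encode (logi k) V) id < e"
proof -
  obtain \<gamma> where g: "density (Site ` S) \<gamma>" "N = replacement (phys Ls) (Site ` S) \<gamma>"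
    using N unfolding is_replacement_def by blast
  have SP: "Site ` S \<subseteq> phys Ls" using S by (auto simp: phys_def)
  let ?A = "{pdist (logi k) (\<R> \<circ> N \<circ> encode (logi k) V) id | \<R>. channel (phys Ls) (logi k) \<R>}"
  obtain \<R> where R: "channel (phys Ls) (logi k) \<R>" using channel_discard[OF finite_phys finite_logi] by blast
  have mem: "pdist (logi k) (\<R> \<circ> N \<circ> encode (logi k) V) id \<in> ?A" using R by blast
  have bd: "0 \<le> y \<and> y \<le> 1" if "y \<in> ?A" for y
    using that pdist_bounds[OF finite_phys SP finite_logi g(1) _ V refl] unfolding g(2) by blast
  have bb: "bdd_below ?A" using bd by (intro bdd_belowI[of _ 0]) blast
  show "0 \<le> eps_tilde Ls k V N"
    unfolding eps_tilde_def using mem bd by (intro cInf_greatest) blast+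
  have "eps_tilde Ls k V N \<le> pdist (logi k) (\<R> \<circ> N \<circ> encode (logi k) V) id"
    unfolding eps_tilde_def by (rule cInf_lower[OF mem bb])
  then show "eps_tilde Ls k V N \<le> 1" using bd[OF mem] by linarith
  assume "eps_tilde Ls k V N < e"
  then have lt: "Inf ?A < e" by (simp only: eps_tilde_def)
  have ne: "?A \<noteq> {}" using mem by (metis empty_iff)
  obtain y where "y \<in> ?A" "y < e" using cInf_lessD[OF ne lt] by (elim bexE)
  then show "\<exists>\<R>. channel (phys Ls) (logi k) \<R> \<and> pdist (logi k) (\<R> \<circ> N \<circ> encode (logi k) V) id < e"
    by blast
qed

lemma eps_tilde_le_max:
  assumes S: "S \<subseteq> box Ls" "lconnected S" "card S = d" and N: "is_replacement (phys Ls) (Site ` S) N"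
  shows "eps_tilde Ls k V N \<le> max_eps_tilde Ls k V d"
  unfolding max_eps_tilde_def
proof (rule cSup_upper)
  show "bdd_above {eps_tilde Ls k V N | N S.
       S \<subseteq> box Ls \<and> lconnected S \<and> card S = d \<and> is_replacement (phys Ls) (Site ` S) N}"
    using eps_tilde_le_1(2) by (intro bdd_aboveI[of _ 1]) blast
qed (use S N in blast)

text \<open>Any fixed state could be put on the erased region; the zero state is the one used
  throughout.\<close>

lemma is_replacement_zero:
  assumes "S \<subseteq> box Ls"
  shows "is_replacement (phys Ls) (Site ` S) (replacement (phys Ls) (Site ` S) (proj zero_state))"
    "density (Site ` S) (proj zero_state)"
proof -
  have "finite (Site ` S)" using assms finite_subset[OF _ finite_box] by blast
  then have "inner (Site ` S) zero_state zero_state = 1"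
    using inner_unit_vec[OF _ zero_in_cfgs, of "Site ` S" zero_state] by (simp add: zero_state_def)
  then have "tr (Site ` S) (proj zero_state) = 1"
    using tr_ketbra[of "Site ` S" zero_state zero_state] by (simp add: ketbra_self)
  then show "density (Site ` S) (proj zero_state)" by (simp add: density_def psd_proj)
  then show "is_replacement (phys Ls) (Site ` S) (replacement (phys Ls) (Site ` S) (proj zero_state))"
    unfolding is_replacement_def by blast
qed

lemma max_eps_tilde_nonneg:
  assumes S: "S \<subseteq> box Ls" "lconnected S" "card S = d"
  shows "0 \<le> max_eps_tilde Ls k V d"
  using eps_tilde_le_1(1)[OF S(1) is_replacement_zero(1)[OF S(1)]]
    eps_tilde_le_max[OF S is_replacement_zero(1)[OF S(1)]] by linarith

lemma code_overlap_le_max_eps_tilde: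
  assumes S: "S \<subseteq> box Ls" "lconnected S" "card S = d" and k: "1 \<le> k"
    and W: "supported_unitary (phys Ls) (Site ` S) W"
    and f: "vec_on (logi k) \<phi>" "inner (logi k) \<phi> \<phi> = 1"
    and h: "vec_on (logi k) \<chi>" "inner (logi k) \<chi> \<chi> = 1" and fh: "inner (logi k) \<phi> \<chi> = 0"
  shows "cmod (inner (phys Ls) (enc (logi k) V \<chi>) (app (phys Ls) W (enc (logi k) V \<phi>)))
    \<le> 2 * max_eps_tilde Ls k V d"
proof (rule field_le_epsilon)
  let ?P = "phys Ls" and ?L = "logi k" and ?\<gamma> = "proj zero_state"
  fix t :: real assume t: "0 < t"
  \<comment> \<open>The slack \<open>t\<close> pays for a recovery that misses the infimum; doubling
    \<open>e\<close> turns \<open>t / 2\<close> back into \<open>t\<close>.\<close>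
  define e where "e = max_eps_tilde Ls k V d + t / 2"
  define N where "N = replacement ?P (Site ` S) ?\<gamma>"
  have SP: "Site ` S \<subseteq> ?P" using S by (auto simp: phys_def)
  note N = is_replacement_zero[OF S(1)]
  have "eps_tilde Ls k V N < e"
    using eps_tilde_le_max[OF S N(1)] t by (simp add: e_def N_def)
  then obtain \<R> where R: "channel ?P ?L \<R>" "pdist ?L (\<R> \<circ> N \<circ> encode ?L V) id < e"
    using eps_tilde_le_1(3)[OF S(1) N(1)] unfolding N_def by blast
  note pb = pdist_bounds[OF finite_phys SP finite_logi N(2) R(1) V refl]
  have e0: "0 \<le> e" using max_eps_tilde_nonneg[OF S] t by (simp add: e_def)
  have "(pdist ?L (\<R> \<circ> N \<circ> encode ?L V) id)\<^sup>2 \<le> e\<^sup>2"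
    using R(2) pb(1) unfolding N_def by (intro power_mono) auto
  then have rec: "1 - e\<^sup>2 \<le> Re (inner ?L \<phi> (app ?L (\<R> (replacement ?P (Site ` S) ?\<gamma> (proj (enc ?L V \<phi>)))) \<phi>))"
    if "vec_on ?L \<phi>" "inner ?L \<phi> \<phi> = 1" for \<phi>
    using pb(3)[OF that] unfolding N_def by linarith
  have "(2::nat) ^ 1 \<le> 2 ^ k" using k by (intro power_increasing) auto
  then have L2: "2 \<le> card (cfgs ?L)" by (simp add: card_cfgs_logi)
  have "cmod (inner ?P (app ?P W (enc ?L V \<phi>)) (enc ?L V \<chi>)) \<le> 2 * e"
    by (rule recovery_overlap[OF finite_phys SP finite_logi L2 N(2) R(1) W _ _ _ _ f h fh e0])
      (simp_all add: vec_on_enc[OF V] inner_enc[OF V] f h rec)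
  also have "inner ?P (app ?P W (enc ?L V \<phi>)) (enc ?L V \<chi>)
      = cnj (inner ?P (enc ?L V \<chi>) (app ?P W (enc ?L V \<phi>)))"
    by (simp add: cnj_inner)
  finally show "cmod (inner ?P (enc ?L V \<chi>) (app ?P W (enc ?L V \<phi>))) \<le> 2 * max_eps_tilde Ls k V d + t"
    by (simp add: e_def)
qed

lemma enc_lincomb: "enc L V (\<lambda>c. a * \<phi> c + b * \<chi> c) = (\<lambda>p. a * enc L V \<phi> p + b * enc L V \<chi> p)"
  by (simp add: enc_def ring_distribs sum.distrib sum_distrib_left mult_ac)

text \<open>Polarisation: the difference of two diagonal matrix elements is a sum of two off-diagonal
  ones in the rotated basis.\<close>

lemma code_pair_exp_diff:
  assumes S: "S \<subseteq> box Ls" "lconnected S" "card S = d" and k: "1 \<le> k"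
    and W: "supported_unitary (phys Ls) (Site ` S) W"
    and f: "vec_on (logi k) \<phi>" "inner (logi k) \<phi> \<phi> = 1"
    and h: "vec_on (logi k) \<chi>" "inner (logi k) \<chi> \<chi> = 1" and fh: "inner (logi k) \<phi> \<chi> = 0"
  shows "Re (inner (phys Ls) (enc (logi k) V \<phi>) (app (phys Ls) W (enc (logi k) V \<phi>)))
    - Re (inner (phys Ls) (enc (logi k) V \<chi>) (app (phys Ls) W (enc (logi k) V \<chi>)))
    \<le> 4 * max_eps_tilde Ls k V d"
proof -
  let ?P = "phys Ls" and ?L = "logi k" and ?m = "max_eps_tilde Ls k V d"
  define s where "s = complex_of_real (1 / sqrt 2)"
  have "s * s = of_real (1 / sqrt 2 * (1 / sqrt 2))" unfolding s_def by (simp only: of_real_mult)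
  then have ss: "s * s = 1 / 2" by simp
  have cs: "cnj s = s" by (simp add: s_def)
  define p where "p = (\<lambda>c. s * \<phi> c + s * \<chi> c)"
  define m where "m = (\<lambda>c. s * \<phi> c + (- s) * \<chi> c)"
  have hf: "inner ?L \<chi> \<phi> = 0" using fh cnj_inner[of ?L \<phi> \<chi>] by simp
  have v: "vec_on ?L p" "vec_on ?L m" unfolding p_def m_def by (rule vec_on_lincomb[OF f(1) h(1)])+
  note lin = inner_add_left inner_add_right inner_scale_left inner_scale_right
  have i: "inner ?L p p = 1" "inner ?L m m = 1" "inner ?L p m = 0" "inner ?L m p = 0"
    unfolding p_def m_def lin by (simp_all add: f h fh hf cs ss)
  have o1: "cmod (inner ?P (enc ?L V m) (app ?P W (enc ?L V p))) \<le> 2 * ?m"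
    by (rule code_overlap_le_max_eps_tilde[OF S k W v(1) i(1) v(2) i(2) i(3)])
  have o2: "cmod (inner ?P (enc ?L V p) (app ?P W (enc ?L V m))) \<le> 2 * ?m"
    by (rule code_overlap_le_max_eps_tilde[OF S k W v(2) i(2) v(1) i(1) i(4)])
  define a b c d' where "a = inner ?P (enc ?L V \<phi>) (app ?P W (enc ?L V \<phi>))"
    and "b = inner ?P (enc ?L V \<phi>) (app ?P W (enc ?L V \<chi>))"
    and "c = inner ?P (enc ?L V \<chi>) (app ?P W (enc ?L V \<phi>))"
    and "d' = inner ?P (enc ?L V \<chi>) (app ?P W (enc ?L V \<chi>))"
  have "inner ?P (enc ?L V m) (app ?P W (enc ?L V p)) = s * (s * a + s * b) - s * (s * c + s * d')"
    unfolding m_def p_def enc_lincomb app_add app_scale lin a_def b_def c_def d'_def by (simp add: cs ring_distribs)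
  also have "\<dots> = s * s * (a + b - c - d')" by (simp add: algebra_simps)
  finally have e1: "inner ?P (enc ?L V m) (app ?P W (enc ?L V p)) = (a + b - c - d') / 2" by (simp add: ss)
  have "inner ?P (enc ?L V p) (app ?P W (enc ?L V m)) = s * (s * a - s * b) + s * (s * c - s * d')"
    unfolding m_def p_def enc_lincomb app_add app_scale lin a_def b_def c_def d'_def by (simp add: cs ring_distribs)
  also have "\<dots> = s * s * (a - b + c - d')" by (simp add: algebra_simps)
  finally have e2: "inner ?P (enc ?L V p) (app ?P W (enc ?L V m)) = (a - b + c - d') / 2" by (simp add: ss)
  have "a - d' = inner ?P (enc ?L V m) (app ?P W (enc ?L V p)) + inner ?P (enc ?L V p) (app ?P W (enc ?L V m))"
    unfolding e1 e2 by (simp add: field_simps)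
  then have "cmod (a - d') \<le> 2 * ?m + 2 * ?m"
    using norm_triangle_mono[OF o1 o2] by (simp only:)
  then have "Re (a - d') \<le> 4 * ?m" using complex_Re_le_cmod[of "a - d'"] by linarith
  then show ?thesis by (simp add: a_def d'_def)
qed

text \<open>The logical state behind \<psi> is completed to an orthonormal basis and the mixed
  expectation is averaged over it; against each other basis state the pairwise bound
  applies.\<close>

lemma code_exp_diff_le_max_eps_tilde:
  assumes S: "S \<subseteq> box Ls" "lconnected S" "card S = d"
    and W: "supported_unitary (phys Ls) (Site ` S) W" and \<psi>: "code_state Ls k V \<psi>"
  shows "Re (inner (phys Ls) \<psi> (app (phys Ls) W \<psi>)) - Re (mixed_exp (logi k) (phys Ls) V W)
    \<le> 4 * max_eps_tilde Ls k V d"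
proof -
  let ?P = "phys Ls" and ?L = "logi k" and ?m = "max_eps_tilde Ls k V d"
  let ?N = "card (cfgs ?L)"
  obtain \<phi> where \<phi>: "vec_on ?L \<phi>" "\<psi> = enc ?L V \<phi>" "inner ?L \<phi> \<phi> = 1"
    using code_state_enc[OF V \<psi>] by blast
  have N: "0 < ?N" by (simp add: card_cfgs_logi)
  have "orthonormal ?L 1 (\<lambda>_. \<phi>)" using \<phi> by (simp add: orthonormal_def)
  then obtain f where f: "orthonormal ?L ?N f" "f 0 = \<phi>"
    using orthonormal_extend[OF finite_logi, of k 1 "\<lambda>_. \<phi>" ?N] N by auto
  define E where "E = (\<lambda>i. Re (inner ?P (enc ?L V (f i)) (app ?P W (enc ?L V (f i)))))"
  have le: "E 0 - E i \<le> 4 * ?m" if i: "i < ?N" for i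
  proof (cases "i = 0")
    case True
    then show ?thesis using max_eps_tilde_nonneg[OF S] by simp
  next
    case False
    \<comment> \<open>A second basis vector exists only for \<open>k \<ge> 1\<close>, as the
      pairwise bound requires; for \<open>k = 0\<close> the average has the single term
      \<open>i = 0\<close>.\<close>
    then have "1 < (2::nat) ^ k" using i by (simp add: card_cfgs_logi)
    then have k: "1 \<le> k" by (cases k) auto
    show ?thesis
      unfolding E_def using False f(1) i N
      by (intro code_pair_exp_diff[OF S k W]) (auto simp: orthonormal_def)
  qed
  have "Re (mixed_exp ?L ?P V W) = (\<Sum>i<?N. E i) / real ?N"
    unfolding mixed_exp_orthonormal[OF finite_logi f(1)] E_def by simp
  then have "E 0 - Re (mixed_exp ?L ?P V W) = (\<Sum>i<?N. E 0 - E i) / real ?N"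
    using N by (auto simp: sum_subtractf diff_divide_distrib)
  also have "\<dots> \<le> (\<Sum>i<?N. 4 * ?m) / real ?N"
    using le by (intro divide_right_mono sum_mono) auto
  also have "\<dots> = 4 * ?m" using N by auto
  finally show ?thesis by (simp add: E_def f \<phi>)
qed

end

section \<open>Pulling back local tests through a shallow circuit\<close>

text \<open>The induction runs over all cubes at once: one layer turns a cube cut to the lattice
  into the cube with corner shifted by -1 and side enlarged by 2, again cut to the lattice because
  gates never leave it.\<close>

lemma circuit_conj_support:
  "length a = length Ls \<Longrightarrow> \<forall>gs\<in>set cs. valid_layer Ls gs \<Longrightarrow>
    supported_unitary (phys Ls) (Site ` (cube (length Ls) a s \<inter> box Ls)) W \<Longrightarrow>
    supported_unitary (phys Ls)
      (Site ` (cube (length Ls) (map (\<lambda>z. z - int (length cs)) a) (s + 2 * length cs) \<inter> box Ls))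
      (fold (\<lambda>gs X. conj_by (phys Ls) (layer_op (phys Ls) gs) X) cs W)"
proof (induction cs arbitrary: a s W)
  case Nil
  then show ?case by simp
next
  case (Cons gs cs)
  let ?D = "length Ls" and ?P = "phys Ls"
  let ?A = "cube ?D a s \<inter> box Ls" and ?a = "map (\<lambda>z. z - 1) a"
  let ?X = "conj_by ?P (layer_op ?P gs) W"
  have v: "valid_layer Ls gs" using Cons.prems by simp
  have sub: "?A \<union> (\<Union>g\<in>{g \<in> set gs. gate_sites g \<inter> ?A \<noteq> {}}. gate_sites g) \<subseteq> cube ?D ?a (s + 2) \<inter> box Ls"
  proof
    fix x assume "x \<in> ?A \<union> (\<Union>g\<in>{g \<in> set gs. gate_sites g \<inter> ?A \<noteq> {}}. gate_sites g)"
    then consider "x \<in> ?A" | g y where "g \<in> set gs" "y \<in> gate_sites g" "y \<in> ?A" "x \<in> gate_sites g"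
      by blast
    then show "x \<in> cube ?D ?a (s + 2) \<inter> box Ls"
    proof cases
      case 1
      then show ?thesis using Cons.prems(1) by (auto simp: cube_def)
    next
      case 2
      have g: "valid_gate Ls g" using v 2(1) by (simp add: valid_layer_def)
      have "x \<in> box Ls" using valid_gate_sites[OF g] 2(4) by blast
      moreover have "x = y \<or> ladj x y"
        using g 2(2,4) ladj_sym by (auto simp: valid_gate_def gate_sites_def)
      moreover have "y \<in> cube ?D ?a (s + 2)" using 2(3) Cons.prems(1) by (auto simp: cube_def)
      ultimately show ?thesis using ladj_cube[OF Cons.prems(1)] 2(3) by blast
    qed
  qed
  have "supported_unitary ?P (Site ` (?A \<union> (\<Union>g\<in>{g \<in> set gs. gate_sites g \<inter> ?A \<noteq> {}}. gate_sites g))) ?X"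
    by (rule layer_conj_support[OF finite_phys _ Cons.prems(3) v]) simp
  then have X: "supported_unitary ?P (Site ` (cube ?D ?a (s + 2) \<inter> box Ls)) ?X"
    by (rule supported_unitary_mono[OF finite_phys image_mono[OF sub], rotated]) (auto simp: phys_def)
  have e: "map (\<lambda>z. z - int (length cs)) ?a = map (\<lambda>z. z - int (length (gs # cs))) a"
    "s + 2 + 2 * length cs = s + 2 * length (gs # cs)" by simp_all
  have "supported_unitary ?P
      (Site ` (cube ?D (map (\<lambda>z. z - int (length cs)) ?a) (s + 2 + 2 * length cs) \<inter> box Ls))
      (fold (\<lambda>gs X. conj_by ?P (layer_op ?P gs) X) cs ?X)"
    by (rule Cons.IH[OF _ _ X]) (use Cons.prems in simp_all)
  then show ?case unfolding e by (simp only: fold_simps)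
qed

text \<open>A reflection instead of the projection onto the zero configuration, since trace-norm
  duality and absorption by an erasure are both stated for unitaries.\<close>

definition zero_test :: "label set \<Rightarrow> op" where
  "zero_test B = (\<lambda>c c'. if c \<in> cfgs B \<and> c' = c then (if c = (\<lambda>_. False) then 1 else - 1) else 0)"

lemma unitary_zero_test:
  assumes "finite B"
  shows "unitary B (zero_test B)"
  unfolding unitary_def
proof (intro conjI op_on_eqI)
  show "op_on B (zero_test B)" by (auto simp: op_on_def zero_test_def)
  fix c c' assume c: "c \<in> cfgs B" "c' \<in> cfgs B"
  have "mmult B (adj (zero_test B)) (zero_test B) c c'
      = (\<Sum>e\<in>cfgs B. adj (zero_test B) c e * zero_test B e c')"
    using c by (simp add: mmult_def)
  also have "\<dots> = (\<Sum>e\<in>cfgs B. if e = c then (if c' = c then 1 else 0) else 0)"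
    by (intro sum.cong refl) (auto simp: adj_def zero_test_def)
  finally show "mmult B (adj (zero_test B)) (zero_test B) c c' = ident B c c'"
    using c assms by (simp add: ident_def)
qed simp_all

lemma app_lift_zero_test:
  assumes P: "finite P" "B \<subseteq> P" and c: "c \<in> cfgs P"
  shows "app P (lift P B (zero_test B)) v c = (if restr c B = (\<lambda>_. False) then 1 else - 1) * v c"
proof -
  have "app P (lift P B (zero_test B)) v c
      = (\<Sum>t\<in>cfgs B. if t = restr c B then (if restr c B = (\<lambda>_. False) then 1 else - 1) * v c else 0)"
    unfolding app_lift[OF P c]
    by (intro sum.cong) (auto simp: zero_test_def join_restr_Diff[OF P(2) c])
  then show ?thesis using P finite_subset[of B P] by simp
qed

section \<open>The code state measured after undoing the circuit\<close>

lemma inner_conj_by: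
  "inner P u (app P (conj_by P U R) v) = inner P (app P (adj U) u) (app P R (app P (adj U) v))"
  by (simp add: conj_by_def app_mmult inner_app_adj)

lemma Bessel_unit:
  assumes "finite S" "orthonormal S r e" "c \<in> cfgs S"
  shows "(\<Sum>i<r. (cmod (e i c))\<^sup>2) \<le> 1"
  using inner_unit_residual_self[OF assms] inner_self_nonneg[of S "unit_residual r e c"] by simp

text \<open>The distribution of a computational-basis measurement of the maximally mixed code state,
  undone by the circuit.\<close>

definition mixed_dist :: "label set \<Rightarrow> label set \<Rightarrow> op \<Rightarrow> op \<Rightarrow> cfg \<Rightarrow> real" where
  "mixed_dist L P V U c = (\<Sum>l\<in>cfgs L. (cmod (app P (adj U) (col V l) c))\<^sup>2) / real (card (cfgs L))"

text \<open>The columns of \<open>V\<close> pulled back through the circuit remain orthonormal, so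
  by Bessel's inequality their weights at one configuration sum to at most 1.\<close>

lemma mixed_dist_le:
  assumes P: "finite P" and L: "finite L" and V: "isometry L P V" and U: "unitary P U" and c: "c \<in> cfgs P"
  shows "mixed_dist L P V U c \<le> 1 / real (card (cfgs L))"
proof -
  let ?N = "card (cfgs L)" and ?y = "\<lambda>l. app P (adj U) (col V l)"
  obtain h where h: "bij_betw h {..<?N} (cfgs L)"
    using ex_bij_betw_nat_finite[of "cfgs L"] L by (auto simp: lessThan_atLeast0)
  have hL: "h i \<in> cfgs L" if "i < ?N" for i using h that by (auto simp: bij_betw_def)
  have inj: "h i = h j \<longleftrightarrow> i = j" if "i < ?N" "j < ?N" for i j
    using h that by (auto simp: bij_betw_def inj_on_def)
  have "orthonormal P ?N (\<lambda>i. ?y (h i))"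
    using inner_unitary[OF P unitary_adj[OF P U] vec_on_col[OF V]] inner_col[OF V hL hL] inj
    by (simp add: orthonormal_def)
  then have "(\<Sum>i<?N. (cmod (?y (h i) c))\<^sup>2) \<le> 1" by (rule Bessel_unit[OF P _ c])
  also have "(\<Sum>i<?N. (cmod (?y (h i) c))\<^sup>2) = (\<Sum>l\<in>cfgs L. (cmod (?y l c))\<^sup>2)"
    by (rule sum.reindex_bij_betw[OF h])
  finally show ?thesis by (simp add: mixed_dist_def divide_right_mono)
qed

lemma sum_mixed_dist:
  assumes P: "finite P" and L: "finite L" and V: "isometry L P V" and U: "unitary P U"
  shows "(\<Sum>c\<in>cfgs P. mixed_dist L P V U c) = 1"
proof -
  let ?y = "\<lambda>l. app P (adj U) (col V l)"
  have N: "card (cfgs L) \<noteq> 0" using L by (simp add: card_cfgs)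
  have y: "(\<Sum>c\<in>cfgs P. (cmod (?y l c))\<^sup>2) = 1" if "l \<in> cfgs L" for l
    using inner_unitary[OF P unitary_adj[OF P U] vec_on_col[OF V], of "col V l" l] inner_col[OF V that that]
    by (simp add: Re_inner_self[symmetric])
  have "(\<Sum>c\<in>cfgs P. mixed_dist L P V U c)
      = (\<Sum>c\<in>cfgs P. \<Sum>l\<in>cfgs L. (cmod (?y l c))\<^sup>2) / real (card (cfgs L))"
    by (simp add: mixed_dist_def sum_divide_distrib)
  also have "(\<Sum>c\<in>cfgs P. \<Sum>l\<in>cfgs L. (cmod (?y l c))\<^sup>2) = (\<Sum>l\<in>cfgs L. \<Sum>c\<in>cfgs P. (cmod (?y l c))\<^sup>2)"
    by (rule sum.swap)
  also have "\<dots> = real (card (cfgs L))" using y by simp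
  finally show ?thesis using N by simp
qed

lemma mixed_exp_zero_test:
  assumes P: "finite P" "B \<subseteq> P" and L: "finite L" and V: "isometry L P V" and U: "unitary P U"
  shows "Re (mixed_exp L P V (conj_by P U (lift P B (zero_test B))))
    = 1 - 2 * (\<Sum>c\<in>cfgs P. if restr c B = (\<lambda>_. False) then 0 else mixed_dist L P V U c)"
proof -
  let ?y = "\<lambda>l. app P (adj U) (col V l)" and ?N = "real (card (cfgs L))"
  let ?s = "\<lambda>c. if restr c B = (\<lambda>_. False) then 1 else - 1 :: real"
  have "Re (inner P (?y l) (app P (lift P B (zero_test B)) (?y l))) = (\<Sum>c\<in>cfgs P. ?s c * (cmod (?y l c))\<^sup>2)" for l
  proof -
    have "inner P (?y l) (app P (lift P B (zero_test B)) (?y l))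
        = (\<Sum>c\<in>cfgs P. of_real (?s c * (cmod (?y l c))\<^sup>2))"
      unfolding inner_def
    proof (intro sum.cong refl)
      fix c assume c: "c \<in> cfgs P"
      have "cnj (?y l c) * ?y l c = of_real ((cmod (?y l c))\<^sup>2)"
        by (simp add: complex_norm_square mult.commute del: of_real_power)
      then show "cnj (?y l c) * app P (lift P B (zero_test B)) (?y l) c = of_real (?s c * (cmod (?y l c))\<^sup>2)"
        by (simp add: app_lift_zero_test[OF P c] del: of_real_power)
    qed
    then show ?thesis by (simp only: Re_sum Re_complex_of_real)
  qed
  then have "Re (mixed_exp L P V (conj_by P U (lift P B (zero_test B))))
      = (\<Sum>l\<in>cfgs L. \<Sum>c\<in>cfgs P. ?s c * (cmod (?y l c))\<^sup>2) / ?N"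
    by (simp add: mixed_exp_def inner_conj_by)
  also have "(\<Sum>l\<in>cfgs L. \<Sum>c\<in>cfgs P. ?s c * (cmod (?y l c))\<^sup>2)
      = (\<Sum>c\<in>cfgs P. \<Sum>l\<in>cfgs L. ?s c * (cmod (?y l c))\<^sup>2)"
    by (rule sum.swap)
  also have "\<dots> / ?N = (\<Sum>c\<in>cfgs P. ?s c * mixed_dist L P V U c)"
    by (simp add: mixed_dist_def sum_distrib_left sum_divide_distrib)
  also have "\<dots> = (\<Sum>c\<in>cfgs P. mixed_dist L P V U c
      - 2 * (if restr c B = (\<lambda>_. False) then 0 else mixed_dist L P V U c))"
    by (intro sum.cong) auto
  also have "\<dots> = 1 - 2 * (\<Sum>c\<in>cfgs P. if restr c B = (\<lambda>_. False) then 0 else mixed_dist L P V U c)"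
    by (simp only: sum_subtractf sum_mixed_dist[OF P(1) L V U] sum_distrib_left)
  finally show ?thesis .
qed

lemma zero_state_exp_zero_test:
  assumes P: "finite P" "B \<subseteq> P" and U: "unitary P U"
  shows "inner P (app P U zero_state) (app P (conj_by P U (lift P B (zero_test B))) (app P U zero_state)) = 1"
proof -
  have z: "inner P zero_state zero_state = 1"
    using inner_unit_vec[OF P(1) zero_in_cfgs, of zero_state] by (simp add: zero_state_def)
  have "app P (lift P B (zero_test B)) zero_state = zero_state"
  proof (rule vec_on_eqI[of P])
    fix c assume c: "c \<in> cfgs P"
    have "restr (\<lambda>_. False) B = (\<lambda>_. False)" by (simp add: restr_def)
    then show "app P (lift P B (zero_test B)) zero_state c = zero_state c"
      by (simp add: app_lift_zero_test[OF P c] zero_state_def)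
  qed simp_all
  then show ?thesis by (simp add: inner_conj_by unitary_cancel[OF P(1) U] z)
qed

text \<open>The assumption \<open>loc\<close> is the interface through which either hypothesis
  enters, \<eta> being half the permitted gap. The prepared state passes every test with expectation
  1 and lies within \<delta> of \<psi>, so twice the probability of a nonzero cell is at most 2
  \<eta> + \<delta>. Only nonempty cells are tested, because the light cone of an empty one need not
  be a connected region.\<close>

lemma rate_bound:
  fixes m :: nat
  assumes P: "finite P" "P \<noteq> {}" and V: "isometry (logi k) P V" and U: "unitary P U"
    and \<psi>: "vec_on P \<psi>" and close: "tnorm P (opdiff (proj (app P U zero_state)) (proj \<psi>)) \<le> \<delta>"
    and cells: "(\<Union>i<m. B i) = P" "\<And>i j. i < j \<Longrightarrow> j < m \<Longrightarrow> B i \<inter> B j = {}"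
      "\<And>i. i < m \<Longrightarrow> card (B i) \<le> t" and t: "1 \<le> t"
    and loc: "\<And>i. i < m \<Longrightarrow> B i \<noteq> {} \<Longrightarrow>
      Re (inner P \<psi> (app P (conj_by P U (lift P (B i) (zero_test (B i)))) \<psi>))
      - Re (mixed_exp (logi k) P V (conj_by P U (lift P (B i) (zero_test (B i))))) \<le> 2 * \<eta>"
    and p: "p = \<eta> + \<delta> / 2" "p < 1 / 2"
  shows "real k \<le> real m * H2 p + real m * log 2 (2 ^ t - 1) * p"
proof -
  let ?L = "logi k" and ?z = "\<lambda>_. False"
  define q where "q = mixed_dist ?L P V U"
  have q0: "0 \<le> q c" for c by (simp add: q_def mixed_dist_def sum_nonneg)
  have qk: "q c \<le> 1 / 2 ^ k" if "c \<in> cfgs P" for c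
    using mixed_dist_le[OF P(1) finite_logi V U that] by (simp add: q_def card_cfgs_logi)
  have q1: "(\<Sum>c\<in>cfgs P. q c) = 1" unfolding q_def by (rule sum_mixed_dist[OF P(1) finite_logi V U])
  define pr where "pr = (\<lambda>i. \<Sum>c\<in>cfgs P. if restr c (B i) = ?z then 0 else q c)"
  have pr0: "0 \<le> pr i" for i unfolding pr_def using q0 by (intro sum_nonneg) auto
  have sub: "B i \<subseteq> P" if "i < m" for i using cells(1) that by blast
  have ne: "pr i \<le> p" if i: "i < m" and Bi: "B i \<noteq> {}" for i
  proof -
    let ?W = "conj_by P U (lift P (B i) (zero_test (B i)))"
    have fB: "finite (B i)" using sub[OF i] P finite_subset by blast
    have uW: "unitary P ?W"
      using P U sub[OF i] fB
      by (simp add: conj_by_def unitary_mmult unitary_adj unitary_lift unitary_zero_test)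
    have "Re (inner P (app P U zero_state) (app P ?W (app P U zero_state))) - Re (inner P \<psi> (app P ?W \<psi>)) \<le> \<delta>"
      using pure_exp_diff_le_tnorm[OF P(1) uW vec_on_app \<psi>, of U zero_state] close by linarith
    then have "1 - Re (inner P \<psi> (app P ?W \<psi>)) \<le> \<delta>"
      by (simp add: zero_state_exp_zero_test[OF P(1) sub[OF i] U])
    moreover have "Re (mixed_exp ?L P V ?W) = 1 - 2 * pr i"
      unfolding pr_def q_def by (rule mixed_exp_zero_test[OF P(1) sub[OF i] finite_logi V U])
    ultimately show ?thesis using loc[OF i Bi] p(1) by simp
  qed
  \<comment> \<open>The sign of \<open>p\<close> comes from a nonempty cell, for which
    \<open>p\<close> bounds a probability.\<close>
  obtain x i0 where x: "x \<in> P" "i0 < m" "x \<in> B i0" using P(2) cells(1) by blast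
  have p0: "0 \<le> p" using ne[OF x(2)] x(3) pr0[of i0] by fastforce
  have pB: "pr i \<le> p" if "i < m" for i
  proof (cases "B i = {}")
    case True
    then have "restr c (B i) = ?z" for c by (simp add: restr_def)
    then show ?thesis using p0 by (simp add: pr_def)
  qed (use ne that in blast)
  show ?thesis
  proof (cases "p = 0")
    case True
    \<comment> \<open>The Gibbs argument takes the logarithm of \<open>p\<close>, so
      \<open>p = 0\<close> is treated apart: all mass sits on the zero configuration, and the bound
      2^-k on it forces \<open>k = 0\<close>.\<close>
    have "q c = 0" if c: "c \<in> cfgs P" "c \<noteq> ?z" for c
    proof -
      obtain x where x: "c x" using c by (auto simp: fun_eq_iff)
      then have "x \<in> P" using c by (auto simp: cfgs_def)
      then obtain i where i: "i < m" "x \<in> B i" using cells(1) by blast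
      have "restr c (B i) \<noteq> ?z" using x i by (auto simp: restr_def fun_eq_iff)
      then have "q c = (if restr c (B i) = ?z then 0 else q c)" by simp
      also have "\<dots> \<le> pr i"
        unfolding pr_def using c P q0
        by (intro member_le_sum[of c "cfgs P" "\<lambda>c. if restr c (B i) = ?z then 0 else q c"]) auto
      finally show ?thesis using pB[OF i(1)] q0[of c] True by linarith
    qed
    then have "(\<Sum>c\<in>cfgs P. q c) = (\<Sum>c\<in>{?z}. q c)"
      using P by (intro sum.mono_neutral_right) auto
    then have "1 \<le> 1 / (2::real) ^ k" using q1 qk[OF zero_in_cfgs] by simp
    then have "(2::real) ^ k \<le> 1" by (simp add: field_simps)
    then have "k = 0" by (metis one_less_numeral_iff one_less_power not_le not_gr_zero semiring_norm(76))
    then show ?thesis using True by (simp add: H2_def)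
  next
    case False
    then have "0 < p" using p0 by simp
    then show ?thesis
      using entropy_cell_bound[OF P(1) cells t, of q k p] q0 qk q1 p(2) pB unfolding pr_def by blast
  qed
qed

section \<open>The complexity bound\<close>

lemma lift_whole: "op_on P A \<Longrightarrow> lift P P A = A"
proof -
  assume A: "op_on P A"
  have "restr c {} = restr c' {}" for c c' by (simp add: restr_def)
  then show ?thesis using A by (intro ext) (auto simp: lift_def restr_id op_on_def)
qed

lemma op_eq_on_vectors:
  assumes S: "finite S" and "op_on S A" "op_on S B"
    and eq: "\<And>v. vec_on S v \<Longrightarrow> app S A v = app S B v"
  shows "A = B"
proof (rule op_on_eqI[OF assms(2,3)])
  fix c c' assume c: "c \<in> cfgs S" "c' \<in> cfgs S"
  have "vec_on S (\<lambda>x. if x = c' then 1 else 0)" using c by (auto simp: vec_on_def)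
  from eq[OF this] show "A c c' = B c c'" using app_unit_vec[OF S c(2,1)] by metis
qed

text \<open>Serves to exclude the one-site lattice. The reflection about \<psi> has expectation 1 in
  \<psi> and 2/2^k - 1 in the mixed state; since the whole lattice is an admissible region,
  \<open>eps_code\<close> bounds the gap.\<close>

lemma eps_code_whole_lattice:
  assumes V: "isometry (logi k) (phys Ls) V" and \<psi>: "code_state Ls k V \<psi>"
    and con: "lconnected (box Ls)" and d: "card (box Ls) \<le> d"
  shows "2 - 2 / 2 ^ k \<le> eps_code Ls k V d"
proof -
  let ?P = "phys Ls" and ?L = "logi k"
  obtain \<phi> where \<phi>: "vec_on ?L \<phi>" "\<psi> = enc ?L V \<phi>" "inner ?L \<phi> \<phi> = 1"
    using code_state_enc[OF V \<psi>] by blast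
  have v: "vec_on ?P \<psi>" "inner ?P \<psi> \<psi> = 1"
    using \<phi> by (auto simp: vec_on_enc[OF V] inner_enc[OF V])
  define W where "W = opdiff (\<lambda>c c'. 2 * proj \<psi> c c') (ident ?P)"
  have W: "app ?P W u = (\<lambda>c. 2 * (inner ?P \<psi> u * \<psi> c) - u c)" if "vec_on ?P u" for u
    using that by (simp add: W_def app_opdiff app_opscale app_proj[OF v(1)] app_ident)
  have opW: "op_on ?P W"
    using op_on_proj[OF v(1)] op_on_ident[of ?P] by (simp add: W_def op_on_def opdiff_def)
  have adjW: "adj W = W"
    by (intro ext) (auto simp: W_def adj_def opdiff_def proj_def ident_def)
  have "mmult ?P W W = ident ?P"
  proof (rule op_eq_on_vectors[OF finite_phys])
    fix u assume u: "vec_on ?P u"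
    let ?w = "app ?P W u"
    have "inner ?P \<psi> ?w = 2 * (inner ?P \<psi> u * inner ?P \<psi> \<psi>) - inner ?P \<psi> u"
      unfolding W[OF u] inner_diff_right inner_scale_right ..
    then have i: "inner ?P \<psi> ?w = inner ?P \<psi> u" by (simp add: v)
    have "app ?P W ?w = (\<lambda>c. 2 * (inner ?P \<psi> ?w * \<psi> c) - ?w c)" by (rule W) simp
    also have "\<dots> = u" unfolding i unfolding W[OF u] by simp
    finally have "app ?P W ?w = u" .
    then show "app ?P (mmult ?P W W) u = app ?P (ident ?P) u" using u by (simp add: app_mmult app_ident)
  qed simp_all
  then have "unitary ?P W" using opW by (simp add: unitary_def adjW)
  then have sup: "supported_unitary ?P (Site ` box Ls) W"
    unfolding supported_unitary_def phys_def[symmetric] using lift_whole[OF opW] by metis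
  have N: "card (cfgs ?L) = 2 ^ k" by (rule card_cfgs_logi)
  have "inner ?P (col V l) \<psi> = \<phi> l" if l: "l \<in> cfgs ?L" for l
  proof -
    have "inner ?P (col V l) \<psi> = (\<Sum>l'\<in>cfgs ?L. \<phi> l' * inner ?P (col V l) (col V l'))"
      unfolding \<phi>(2) enc_eq_col inner_sum_right inner_scale_right ..
    also have "\<dots> = (\<Sum>l'\<in>cfgs ?L. if l' = l then \<phi> l else 0)"
      using l by (intro sum.cong refl) (auto simp: inner_col[OF V])
    finally show ?thesis using l by simp
  qed
  then have exp: "Re (inner ?P (col V l) (app ?P W (col V l))) = 2 * (cmod (\<phi> l))\<^sup>2 - 1" if l: "l \<in> cfgs ?L" for l
  proof -
    have "inner ?P (col V l) (app ?P W (col V l))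
        = 2 * (cnj (inner ?P (col V l) \<psi>) * inner ?P (col V l) \<psi>) - inner ?P (col V l) (col V l)"
      unfolding W[OF vec_on_col[OF V]] inner_diff_right inner_scale_right cnj_inner ..
    also have "\<dots> = 2 * (\<phi> l * cnj (\<phi> l)) - 1"
      using \<open>\<And>l. l \<in> cfgs ?L \<Longrightarrow> inner ?P (col V l) \<psi> = \<phi> l\<close>[OF l] inner_col[OF V l l] by (simp add: mult.commute)
    also have "\<phi> l * cnj (\<phi> l) = of_real ((cmod (\<phi> l))\<^sup>2)" by (simp add: complex_norm_square del: of_real_power)
    finally show ?thesis by simp
  qed
  have "Re (mixed_exp ?L ?P V W)
      = (\<Sum>l\<in>cfgs ?L. Re (inner ?P (col V l) (app ?P W (col V l)))) / real (card (cfgs ?L))"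
    by (simp add: mixed_exp_def)
  also have "\<dots> = (\<Sum>l\<in>cfgs ?L. 2 * (cmod (\<phi> l))\<^sup>2 - 1) / 2 ^ k"
    using exp by (simp add: N)
  also have "(\<Sum>l\<in>cfgs ?L. 2 * (cmod (\<phi> l))\<^sup>2 - 1) = 2 * Re (inner ?L \<phi> \<phi>) - 2 ^ k"
    by (simp add: sum_subtractf Re_inner_self sum_distrib_left N)
  finally have "Re (mixed_exp ?L ?P V W) = 2 / 2 ^ k - 1" by (simp add: \<phi> diff_divide_distrib)
  moreover have "inner ?P \<psi> (app ?P W \<psi>) = 1"
    unfolding W[OF v(1)] inner_diff_right inner_scale_right by (simp add: v)
  ultimately show ?thesis
    using code_exp_diff_le_eps_code[OF V \<psi> subset_refl con d sup] by simp
qed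

lemma H2_nonneg: "0 \<le> p \<Longrightarrow> p < 1 \<Longrightarrow> 0 \<le> H2 p"
proof -
  assume p: "0 \<le> p" "p < 1"
  have "p * log 2 p \<le> 0" using p by (cases "p = 0") (auto intro!: mult_nonneg_nonpos)
  moreover have "(1 - p) * log 2 (1 - p) \<le> 0" using p by (intro mult_nonneg_nonpos) auto
  ultimately show ?thesis by (simp add: H2_def)
qed

text \<open>An infimum of naturals is attained once some cover exists, and placing a cube with its
  corner at each site is one.\<close>

lemma cover_num_attained:
  assumes "1 \<le> dt" "\<exists>s. s ^ length Ls = dt" "1 \<le> length Ls"
  obtains as s where "s ^ length Ls = dt" "length as = cover_num Ls dt"
    "\<forall>a\<in>set as. length a = length Ls" "box Ls \<subseteq> (\<Union>a\<in>set as. cube (length Ls) a s)"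
proof -
  let ?A = "{m. \<exists>cs s. s ^ length Ls = dt \<and> length cs = m \<and>
      (\<forall>a\<in>set cs. length a = length Ls) \<and> box Ls \<subseteq> (\<Union>a\<in>set cs. cube (length Ls) a s)}"
  obtain s where s: "s ^ length Ls = dt" using assms by blast
  have "0 < s" using s assms by (intro gr0I) (auto simp: power_0_left split: if_splits)
  obtain xs where xs: "set xs = box Ls" using finite_list[OF finite_box] by blast
  have "length xs \<in> ?A"
    using s xs \<open>0 < s\<close> by (auto simp: cube_def box_def intro!: exI[of _ xs] exI[of _ s])
  then have "cover_num Ls dt \<in> ?A" unfolding cover_num_def by (intro Inf_nat_def1) blast
  then show ?thesis using that by blast
qed

text \<open>With D-th roots taken, the assumption says that t is at most half of d^(1/D) - s, which
  is the light-cone condition solved for t.\<close>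

lemma light_cone_size:
  fixes s t d D :: nat
  assumes D: "1 \<le> D" and d: "1 \<le> d" and s: "0 < s"
    and t: "real t \<le> 1 / 2 * real d powr (1 / real D) * (1 - (real (s ^ D) / real d) powr (1 / real D))"
  shows "(s + 2 * t) ^ D \<le> d"
proof -
  let ?r = "real d powr (1 / real D)"
  have sD: "real (s ^ D) powr (1 / real D) = real s"
  proof -
    have "real (s ^ D) = real s powr real D" using s by (simp add: powr_realpow)
    then show ?thesis using s D by (simp add: powr_powr)
  qed
  have "(real (s ^ D) / real d) powr (1 / real D) = real s / ?r"
    unfolding sD[symmetric] by (rule powr_divide)
  then have "real t \<le> 1 / 2 * ?r * (1 - real s / ?r)" using t by simp
  also have "\<dots> = 1 / 2 * (?r - real s)" using d by (simp add: field_simps)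
  finally have le: "real (s + 2 * t) \<le> ?r" by simp
  have "real ((s + 2 * t) ^ D) \<le> ?r ^ D" using le by (simp add: power_mono)
  also have "?r ^ D = ?r powr real D" using d by (simp add: powr_realpow)
  also have "\<dots> = real d" using D d by (simp add: powr_powr)
  finally show ?thesis by (simp only: of_nat_le_iff)
qed

theorem theorem4:
  fixes Ls :: "nat list" and k :: nat and V :: op and d dt :: nat and \<delta> :: real
  assumes "length Ls \<ge> 1" and "\<forall>i<length Ls. Ls ! i \<ge> 1"
    and "isometry (logi k) (phys Ls) V"
    and "d \<ge> 1" and "\<delta> \<ge> 0" and "1 \<le> dt" and "dt < d"
    and "\<exists>s. s ^ length Ls = dt"
    and "(eps_code Ls k V d / 2 + \<delta> / 2 < 1 / 2 \<and>
          real k > real (cover_num Ls dt) * H2 (eps_code Ls k V d / 2 + \<delta> / 2)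
                 + real (cover_num Ls dt) * log 2 (2 ^ dt - 1) * (eps_code Ls k V d / 2 + \<delta> / 2))
       \<or> ((\<exists>S. S \<subseteq> box Ls \<and> lconnected S \<and> card S = d) \<and>
          2 * max_eps_tilde Ls k V d + \<delta> / 2 < 1 / 2 \<and>
          real k > real (cover_num Ls dt) * H2 (2 * max_eps_tilde Ls k V d + \<delta> / 2)
                 + real (cover_num Ls dt) * log 2 (2 ^ dt - 1) * (2 * max_eps_tilde Ls k V d + \<delta> / 2))"
    and "code_state Ls k V \<psi>"
  shows "real (circ_complexity Ls \<delta> \<psi>)
           > 1 / 2 * real d powr (1 / real (length Ls)) * (1 - (real dt / real d) powr (1 / real (length Ls)))"
proof (rule ccontr)
  let ?P = "phys Ls" and ?L = "logi k" and ?D = "length Ls" and ?m = "cover_num Ls dt"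
  note D = assms(1) and Ls = assms(2) and V = assms(3) and \<psi> = assms(10)
  assume "\<not> ?thesis"
  then have small: "real (circ_complexity Ls \<delta> \<psi>)
      \<le> 1 / 2 * real d powr (1 / real ?D) * (1 - (real dt / real d) powr (1 / real ?D))" by simp
  have "replicate ?D 0 \<in> box Ls" using Ls by (auto simp: box_def intro: less_le_trans)
  then have box_ne: "box Ls \<noteq> {}" by blast
  have con: "lconnected (box Ls)" using box_ne lconnected_rect by (simp add: box_eq_rect)
  have dt2: "(2::real) ^ 1 \<le> 2 ^ dt" using assms(6) by (intro power_increasing) auto
  obtain \<phi> where \<phi>: "\<psi> = enc ?L V \<phi>" "inner ?L \<phi> \<phi> = 1"
    using code_state_enc[OF V \<psi>] by blast
  have v: "vec_on ?P \<psi>" "inner ?P \<psi> \<psi> = 1"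
    using \<phi> by (auto simp: vec_on_enc[OF V] inner_enc[OF V])
  \<comment> \<open>Both alternatives are brought to one form: a gap bound on connected regions of
    at most \<open>d\<close> sites, together with the rate inequality at \<eta>.\<close>
  obtain \<eta> where \<eta>: "\<eta> + \<delta> / 2 < 1 / 2"
      "real k > real ?m * H2 (\<eta> + \<delta> / 2) + real ?m * log 2 (2 ^ dt - 1) * (\<eta> + \<delta> / 2)"
    and loc: "\<And>S W. S \<subseteq> box Ls \<Longrightarrow> lconnected S \<Longrightarrow> card S \<le> d \<Longrightarrow> supported_unitary ?P (Site ` S) W \<Longrightarrow>
        Re (inner ?P \<psi> (app ?P W \<psi>)) - Re (mixed_exp ?L ?P V W) \<le> 2 * \<eta>"
    and two: "2 \<le> card (box Ls)"
  proof (cases "eps_code Ls k V d / 2 + \<delta> / 2 < 1 / 2 \<and>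
          real k > real ?m * H2 (eps_code Ls k V d / 2 + \<delta> / 2)
                 + real ?m * log 2 (2 ^ dt - 1) * (eps_code Ls k V d / 2 + \<delta> / 2)")
    case True
    show ?thesis
    proof (rule that[of "eps_code Ls k V d / 2"])
      show "2 \<le> card (box Ls)"
      proof (rule ccontr)
        assume "\<not> 2 \<le> card (box Ls)"
        \<comment> \<open>On one site \<open>d \<ge> 1\<close> makes the whole lattice admissible.
          The right-hand side of the rate inequality is nonnegative, so \<open>k\<close> is at least
          1 and \<open>eps_code\<close> at least 1, against the bound \<open>1 / 2\<close> on the
          argument of \<open>H2\<close>.\<close>
        then have e: "2 - 2 / 2 ^ k \<le> eps_code Ls k V d"
          using assms(4) by (intro eps_code_whole_lattice[OF V \<psi> con]) simp
        have "2 / 2 ^ k \<le> (2::real)" by (simp add: field_simps)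
        then have "0 \<le> eps_code Ls k V d" using e by linarith
        then have "0 \<le> real ?m * H2 (eps_code Ls k V d / 2 + \<delta> / 2)
            + real ?m * log 2 (2 ^ dt - 1) * (eps_code Ls k V d / 2 + \<delta> / 2)"
          using True assms(5) dt2 by (intro add_nonneg_nonneg mult_nonneg_nonneg H2_nonneg) auto
        then have "1 \<le> k" using True by linarith
        then have "(2::real) ^ 1 \<le> 2 ^ k" by (intro power_increasing) auto
        then have "2 / 2 ^ k \<le> (1::real)" by simp
        then have "1 \<le> eps_code Ls k V d" using e by linarith
        then show False using True assms(5) by linarith
      qed
      show "Re (inner ?P \<psi> (app ?P W \<psi>)) - Re (mixed_exp ?L ?P V W) \<le> 2 * (eps_code Ls k V d / 2)"
        if "S \<subseteq> box Ls" "lconnected S" "card S \<le> d" "supported_unitary ?P (Site ` S) W" for S W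
        using code_exp_diff_le_eps_code[OF V \<psi> that] by simp
    qed (use True in auto)
  next
    case False
    then have c2: "\<exists>S. S \<subseteq> box Ls \<and> lconnected S \<and> card S = d"
      "2 * max_eps_tilde Ls k V d + \<delta> / 2 < 1 / 2"
      "real k > real ?m * H2 (2 * max_eps_tilde Ls k V d + \<delta> / 2)
         + real ?m * log 2 (2 ^ dt - 1) * (2 * max_eps_tilde Ls k V d + \<delta> / 2)"
      using assms(9) by blast+
    have dbox: "d \<le> card (box Ls)" using c2(1) card_mono[OF finite_box] by blast
    show ?thesis
    proof (rule that[OF c2(2,3)])
      \<comment> \<open>A region of \<open>d > dt \<ge> 1\<close> sites fits into the
        lattice.\<close>
      show "2 \<le> card (box Ls)" using dbox assms(6,7) by linarith
      fix S W assume S: "S \<subseteq> box Ls" "lconnected S" "card S \<le> d" and W: "supported_unitary ?P (Site ` S) W"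
      obtain S' where S': "S \<subseteq> S'" "S' \<subseteq> box Ls" "lconnected S'" "card S' = d"
        using lconnected_extend[OF finite_box con S dbox] by blast
      have "supported_unitary ?P (Site ` S') W"
        using S' by (intro supported_unitary_mono[OF finite_phys _ _ W]) (auto simp: phys_def)
      from code_exp_diff_le_max_eps_tilde[OF V S'(2-4) this \<psi>]
      show "Re (inner ?P \<psi> (app ?P W \<psi>)) - Re (mixed_exp ?L ?P V W) \<le> 2 * (2 * max_eps_tilde Ls k V d)"
        by simp
    qed
  qed
  let ?C = "{length cs | cs. (\<forall>gs\<in>set cs. valid_layer Ls gs) \<and>
       tnorm ?P (opdiff (proj (run_circuit ?P cs)) (proj \<psi>)) \<le> \<delta>}"
  obtain cs0 where cs0: "\<forall>gs\<in>set cs0. valid_layer Ls gs" "run_circuit ?P cs0 = \<psi>"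
    using universal_state_preparation[OF con two v] by blast
  have "tnorm ?P (opdiff (proj \<psi>) (proj \<psi>)) = 0"
  proof -
    have z: "mmult ?P (\<lambda>_ _. 0) (\<lambda>_ _. 0) = (\<lambda>_ _. 0)" by (intro ext) (simp add: mmult_def)
    have "psd ?P (\<lambda>_ _. 0)" by (simp add: psd_def op_on_def inner_def app_def)
    then have "msqrt ?P (\<lambda>_ _. 0) = (\<lambda>_ _. 0)" using z by (intro msqrt_eqI) simp_all
    moreover have "opdiff (proj \<psi>) (proj \<psi>) = (\<lambda>_ _. 0)" by (simp add: opdiff_def)
    moreover have "adj (\<lambda>_ _. 0) = (\<lambda>_ _. 0)" by (simp add: adj_def)
    ultimately show ?thesis by (simp add: tnorm_def z tr_def)
  qed
  then have "length cs0 \<in> ?C" using cs0 assms(5) by auto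
  \<comment> \<open>The set of depths is nonempty, so the infimum is the depth of an actual
    circuit.\<close>
  then have "circ_complexity Ls \<delta> \<psi> \<in> ?C" unfolding circ_complexity_def by (intro Inf_nat_def1) blast
  then obtain cs where cs: "length cs = circ_complexity Ls \<delta> \<psi>" "\<forall>gs\<in>set cs. valid_layer Ls gs"
    "tnorm ?P (opdiff (proj (run_circuit ?P cs)) (proj \<psi>)) \<le> \<delta>" by auto
  let ?U = "circuit_op ?P cs" and ?t = "length cs"
  have U: "unitary ?P ?U" by (rule unitary_circuit_op[OF finite_phys cs(2)])
  obtain as s where as: "s ^ ?D = dt" "length as = ?m" "\<forall>a\<in>set as. length a = ?D"
    "box Ls \<subseteq> (\<Union>a\<in>set as. cube ?D a s)"
    by (rule cover_num_attained[OF assms(6,8,1)])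
  have s0: "0 < s" using as(1) D assms(6) by (intro gr0I) (auto simp: power_0_left split: if_splits)
  have size: "(s + 2 * ?t) ^ ?D \<le> d"
    using small light_cone_size[OF D assms(4) s0, of ?t] by (simp add: as(1) cs(1))
  \<comment> \<open>The cubes of the cover may overlap and stick out of the lattice; cutting to the
    lattice and removing earlier cubes makes them a partition.\<close>
  define cell where "cell = (\<lambda>i. (cube ?D (as ! i) s \<inter> box Ls) - (\<Union>j<i. cube ?D (as ! j) s))"
  define B where "B = (\<lambda>i. Site ` cell i)"
  have cell_cube: "cell i \<subseteq> cube ?D (as ! i) s \<inter> box Ls" for i by (auto simp: cell_def)
  have cover: "(\<Union>i<?m. B i) = ?P"
  proof -
    have "x \<in> (\<Union>i<?m. cell i)" if x: "x \<in> box Ls" for x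
    proof -
      obtain a where "a \<in> set as" "x \<in> cube ?D a s" using as(4) x by blast
      then obtain j where j: "j < ?m" "x \<in> cube ?D (as ! j) s"
        unfolding as(2)[symmetric] by (metis in_set_conv_nth)
      define i where "i = (LEAST i. x \<in> cube ?D (as ! i) s)"
      have "x \<in> cube ?D (as ! i) s" unfolding i_def by (rule LeastI[of _ j]) (rule j)
      moreover have "x \<notin> cube ?D (as ! i') s" if "i' < i" for i'
        using not_less_Least[of i' "\<lambda>i. x \<in> cube ?D (as ! i) s"] that by (simp add: i_def)
      moreover have "i \<le> j" unfolding i_def by (rule Least_le) (rule j)
      ultimately show ?thesis using x j(1) by (auto simp: cell_def intro!: bexI[of _ i])
    qed
    then have "(\<Union>i<?m. cell i) = box Ls" using cell_cube by fast
    then show ?thesis unfolding B_def phys_def by (metis image_UN)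
  qed
  have disj: "B i \<inter> B j = {}" if "i < j" for i j
    using that by (auto simp: B_def cell_def)
  have cardB: "card (B i) \<le> dt" if i: "i < ?m" for i
  proof -
    have l: "length (as ! i) = ?D" using as(2,3) i by simp
    have "card (B i) \<le> card (cell i)"
      unfolding B_def using finite_subset[OF cell_cube] by (intro card_image_le) simp
    also have "\<dots> \<le> card (cube ?D (as ! i) s)"
      using cell_cube card_cube(1)[OF l] by (intro card_mono) auto
    also have "\<dots> \<le> dt" using card_cube(2)[OF l, of s] as(1) by simp
    finally show ?thesis .
  qed
  have test: "Re (inner ?P \<psi> (app ?P (conj_by ?P ?U (lift ?P (B i) (zero_test (B i)))) \<psi>))
      - Re (mixed_exp ?L ?P V (conj_by ?P ?U (lift ?P (B i) (zero_test (B i))))) \<le> 2 * \<eta>"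
    if i: "i < ?m" and ne: "B i \<noteq> {}" for i
  proof (rule loc)
    let ?R = "lift ?P (B i) (zero_test (B i))" and ?a = "map (\<lambda>z. z - int ?t) (as ! i)"
    let ?S = "cube ?D ?a (s + 2 * ?t) \<inter> box Ls"
    have l: "length (as ! i) = ?D" "length ?a = ?D" using as(2,3) i by simp_all
    show "?S \<subseteq> box Ls" by simp
    \<comment> \<open>A point of the cell shows that the enlarged cube meets the lattice; a nonempty
      rectangle is connected.\<close>
    have "cell i \<noteq> {}" using ne by (simp add: B_def)
    then obtain x where "x \<in> cube ?D (as ! i) s" "x \<in> box Ls" using cell_cube by blast
    then have "x \<in> ?S" using l by (fastforce simp: cube_def)
    then show "lconnected ?S" using lconnected_rect unfolding cube_Int_box_eq_rect by blast
    have "card ?S \<le> card (cube ?D ?a (s + 2 * ?t))"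
      using card_cube(1)[OF l(2)] by (intro card_mono) auto
    also have "\<dots> \<le> d" using card_cube(2)[OF l(2), of "s + 2 * ?t"] size by linarith
    finally show "card ?S \<le> d" .
    have "finite (B i)" unfolding B_def using finite_subset[OF cell_cube] by simp
    then have "supported_unitary ?P (B i) ?R"
      unfolding supported_unitary_def using unitary_zero_test by blast
    then have "supported_unitary ?P (Site ` (cube ?D (as ! i) s \<inter> box Ls)) ?R"
      by (rule supported_unitary_mono[OF finite_phys, rotated 2])
        (use cell_cube in \<open>auto simp: B_def phys_def\<close>)
    from circuit_conj_support[OF l(1) cs(2) this]
    show "supported_unitary ?P (Site ` ?S) (conj_by ?P ?U ?R)"
      by (simp only: conj_by_circuit[OF finite_phys op_on_lift])
  qed
  have "?P \<noteq> {}" using box_ne by (simp add: phys_def)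
  from rate_bound[OF finite_phys this V U v(1) _ cover disj cardB assms(6) test refl \<eta>(1)]
  have "real k \<le> real ?m * H2 (\<eta> + \<delta> / 2) + real ?m * log 2 (2 ^ dt - 1) * (\<eta> + \<delta> / 2)"
    using cs(3) by (simp add: run_circuit_eq)
  then show False using \<eta>(2) by linarith
qed

end
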